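(* Let $R$ be a commutative ring. Then $$\mathrm{fPD}(R)\le \sup\{\mathrm{fPD}(R_{\mathfrak m})\mid \mathfrak m\in\mathrm{Max}(R)\}$$ and $$\mathrm{fPD}(R)\le \sup\{\mathrm{fPD}(R_{\mathfrak p})\mid \mathfrak p\in\mathrm{Spec}(R)\}.$$
   Context: All rings are commutative with identity. $\mathrm{Max}(R)$ and $\mathrm{Spec}(R)$ are the sets of maximal and prime ideals of $R$. For a ring $R$, $\mathcal{FPR}(R)$ is the class of $R$-modules $M$ admitting an exact sequence $0\to P_n\to\cdots\to P_1\to P_0\to M\to 0$ (some $n\ge 0$) with every $P_i$ a finitely generated projective $R$-module. The small finitistic dimension is $\mathrm{fPD}(R)=\sup\{\mathrm{pd}_R M\mid M\in\mathcal{FPR}(R)\}$, where $\mathrm{pd}_R$ is projective dimension. *)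

theory Defs
  imports "HOL-Algebra.Module" "HOL-Algebra.Ideal" "HOL-Library.Extended_Nat"
begin

section \<open>Localization of a commutative ring\<close>

definition frac_rel :: "('a, 'c) ring_scheme \<Rightarrow> 'a set \<Rightarrow> (('a \<times> 'a) \<times> ('a \<times> 'a)) set"
  where "frac_rel R S =
    {((a, s), (b, t)). a \<in> carrier R \<and> b \<in> carrier R \<and> s \<in> S \<and> t \<in> S \<and>
       (\<exists>u\<in>S. u \<otimes>\<^bsub>R\<^esub> (a \<otimes>\<^bsub>R\<^esub> t \<ominus>\<^bsub>R\<^esub> b \<otimes>\<^bsub>R\<^esub> s) = \<zero>\<^bsub>R\<^esub>)}"

definition fraction :: "('a, 'c) ring_scheme \<Rightarrow> 'a set \<Rightarrow> 'a \<Rightarrow> 'a \<Rightarrow> ('a \<times> 'a) set"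
  where "fraction R S a s = frac_rel R S `` {(a, s)}"

text \<open>The operations are defined on representatives; the unions below are unions of equal
  classes.\<close>

definition localization :: "('a, 'c) ring_scheme \<Rightarrow> 'a set \<Rightarrow> ('a \<times> 'a) set ring"
  where "localization R S =
    \<lparr>carrier = (carrier R \<times> S) // frac_rel R S,
     mult = \<lambda>X Y. \<Union>(a, s)\<in>X. \<Union>(b, t)\<in>Y. fraction R S (a \<otimes>\<^bsub>R\<^esub> b) (s \<otimes>\<^bsub>R\<^esub> t),
     one = fraction R S \<one>\<^bsub>R\<^esub> \<one>\<^bsub>R\<^esub>,
     zero = fraction R S \<zero>\<^bsub>R\<^esub> \<one>\<^bsub>R\<^esub>,
     add = \<lambda>X Y. \<Union>(a, s)\<in>X. \<Union>(b, t)\<in>Y.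
       fraction R S (a \<otimes>\<^bsub>R\<^esub> t \<oplus>\<^bsub>R\<^esub> b \<otimes>\<^bsub>R\<^esub> s) (s \<otimes>\<^bsub>R\<^esub> t)\<rparr>"

lemma (in cring) frac_rel_equiv:
  assumes S: "S \<subseteq> carrier R" "\<one> \<in> S" "\<And>s t. s \<in> S \<Longrightarrow> t \<in> S \<Longrightarrow> s \<otimes> t \<in> S"
  shows "equiv (carrier R \<times> S) (frac_rel R S)"
proof -
  have r: "refl_on (carrier R \<times> S) (frac_rel R S)"
    using S unfolding refl_on_def frac_rel_def by (auto simp: r_neg minus_eq intro!: bexI[of _ \<one>])
  have sy: "sym (frac_rel R S)"
  proof (rule symI, clarify)
    fix a s b t assume "((a,s),(b,t)) \<in> frac_rel R S"
    then obtain u where u: "a \<in> carrier R" "b \<in> carrier R" "s \<in> S" "t \<in> S" "u \<in> S"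
      "u \<otimes> (a \<otimes> t \<ominus> b \<otimes> s) = \<zero>" by (auto simp: frac_rel_def)
    then have c: "s \<in> carrier R" "t \<in> carrier R" "u \<in> carrier R" using S by auto
    have "u \<otimes> (b \<otimes> s \<ominus> a \<otimes> t) = \<ominus> (u \<otimes> (a \<otimes> t \<ominus> b \<otimes> s))" using u(1,2) c by algebra
    then show "((b,t),(a,s)) \<in> frac_rel R S" using u unfolding frac_rel_def by auto
  qed
  have tr: "trans (frac_rel R S)"
  proof (rule transI, clarify)
    fix a s b t c v assume "((a,s),(b,t)) \<in> frac_rel R S" "((b,t),(c,v)) \<in> frac_rel R S"
    then obtain u w where u: "a \<in> carrier R" "b \<in> carrier R" "c \<in> carrier R" "s \<in> S" "t \<in> S" "v \<in> S" "u \<in> S" "w \<in> S"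
      "u \<otimes> (a \<otimes> t \<ominus> b \<otimes> s) = \<zero>" "w \<otimes> (b \<otimes> v \<ominus> c \<otimes> t) = \<zero>" by (auto simp: frac_rel_def)
    then have cc: "s \<in> carrier R" "t \<in> carrier R" "v \<in> carrier R" "u \<in> carrier R" "w \<in> carrier R" using S by auto
    have "(u \<otimes> w \<otimes> t) \<otimes> (a \<otimes> v \<ominus> c \<otimes> s) = (w \<otimes> v) \<otimes> (u \<otimes> (a \<otimes> t \<ominus> b \<otimes> s)) \<oplus> (u \<otimes> s) \<otimes> (w \<otimes> (b \<otimes> v \<ominus> c \<otimes> t))"
      using u(1,2,3) cc by algebra
    also have "\<dots> = \<zero>" using u cc by simp
    finally show "((a,s),(c,v)) \<in> frac_rel R S" using u S unfolding frac_rel_def by auto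
  qed
  show ?thesis using r sy tr by (intro equivI) (auto simp: frac_rel_def)
qed

lemma (in cring) localization_cring:
  assumes S: "S \<subseteq> carrier R" "\<one> \<in> S" "\<And>s t. s \<in> S \<Longrightarrow> t \<in> S \<Longrightarrow> s \<otimes> t \<in> S"
  shows "cring (localization R S)"
proof -
  let ?L = "localization R S"
  note eq = frac_rel_equiv[OF S]
  have Sc: "s \<in> S \<Longrightarrow> s \<in> carrier R" for s using S by auto
  have fr_eq: "fraction R S a s = fraction R S b t" if "a \<in> carrier R" "b \<in> carrier R" "s \<in> S" "t \<in> S"
      "u \<in> S" "u \<otimes> (a \<otimes> t \<ominus> b \<otimes> s) = \<zero>" for a b s t u
    unfolding fraction_def using that by (intro equiv_class_eq[OF eq]) (auto simp: frac_rel_def)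
  have fr_eq1: "fraction R S a s = fraction R S b t" if "a \<in> carrier R" "b \<in> carrier R" "s \<in> S" "t \<in> S"
      "a \<otimes> t = b \<otimes> s" for a b s t 
    using that S by (intro fr_eq[of a b s t \<one>]) (auto simp: r_neg minus_eq)
  have c2a: "congruent2 (frac_rel R S) (frac_rel R S) (\<lambda>p q. case p of (a,s) \<Rightarrow> case q of (b,t) \<Rightarrow> fraction R S (a \<otimes> t \<oplus> b \<otimes> s) (s \<otimes> t))"
  proof (rule congruent2_commuteI[OF eq])
    fix y z assume "y \<in> carrier R \<times> S" "z \<in> carrier R \<times> S"
    then show "(case y of (a,s) \<Rightarrow> case z of (b,t) \<Rightarrow> fraction R S (a \<otimes> t \<oplus> b \<otimes> s) (s \<otimes> t)) = (case z of (a,s) \<Rightarrow> case y of (b,t) \<Rightarrow> fraction R S (a \<otimes> t \<oplus> b \<otimes> s) (s \<otimes> t))" using Sc by (auto simp: m_comm a_comm)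
  next
    fix w y z assume 2: "w \<in> carrier R \<times> S" "(y, z) \<in> frac_rel R S"
    obtain a s b t c v where d: "w = (a,s)" "y = (b,t)" "z = (c,v)" by (metis prod.exhaust)
    with 2 obtain u where u: "a \<in> carrier R" "b \<in> carrier R" "c \<in> carrier R" "s \<in> S" "t \<in> S" "v \<in> S" "u \<in> S"
      "u \<otimes> (b \<otimes> v \<ominus> c \<otimes> t) = \<zero>" by (auto simp: frac_rel_def)
    note cc = Sc[OF u(4)] Sc[OF u(5)] Sc[OF u(6)] Sc[OF u(7)]
    have "u \<otimes> ((a \<otimes> t \<oplus> b \<otimes> s) \<otimes> (s \<otimes> v) \<ominus> (a \<otimes> v \<oplus> c \<otimes> s) \<otimes> (s \<otimes> t)) = (s \<otimes> s) \<otimes> (u \<otimes> (b \<otimes> v \<ominus> c \<otimes> t))"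
      using u(1,2,3) cc by algebra
    also have "\<dots> = \<zero>" using u cc by simp
    finally show "(case w of (a,s) \<Rightarrow> case y of (b,t) \<Rightarrow> fraction R S (a \<otimes> t \<oplus> b \<otimes> s) (s \<otimes> t)) = (case w of (a,s) \<Rightarrow> case z of (b,t) \<Rightarrow> fraction R S (a \<otimes> t \<oplus> b \<otimes> s) (s \<otimes> t))" unfolding d prod.case
      by (intro fr_eq[of _ _ _ _ u]) (use u(1-7) cc S in auto)
  qed
  have c2m: "congruent2 (frac_rel R S) (frac_rel R S) (\<lambda>p q. case p of (a,s) \<Rightarrow> case q of (b,t) \<Rightarrow> fraction R S (a \<otimes> b) (s \<otimes> t))"
  proof (rule congruent2_commuteI[OF eq])
    fix y z assume "y \<in> carrier R \<times> S" "z \<in> carrier R \<times> S"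
    then show "(case y of (a,s) \<Rightarrow> case z of (b,t) \<Rightarrow> fraction R S (a \<otimes> b) (s \<otimes> t)) = (case z of (a,s) \<Rightarrow> case y of (b,t) \<Rightarrow> fraction R S (a \<otimes> b) (s \<otimes> t))" using Sc by (auto simp: m_comm)
  next
    fix w y z assume 2: "w \<in> carrier R \<times> S" "(y, z) \<in> frac_rel R S"
    obtain a s b t c v where d: "w = (a,s)" "y = (b,t)" "z = (c,v)" by (metis prod.exhaust)
    with 2 obtain u where u: "a \<in> carrier R" "b \<in> carrier R" "c \<in> carrier R" "s \<in> S" "t \<in> S" "v \<in> S" "u \<in> S"
      "u \<otimes> (b \<otimes> v \<ominus> c \<otimes> t) = \<zero>" by (auto simp: frac_rel_def)
    note cc = Sc[OF u(4)] Sc[OF u(5)] Sc[OF u(6)] Sc[OF u(7)]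
    have "u \<otimes> ((a \<otimes> b) \<otimes> (s \<otimes> v) \<ominus> (a \<otimes> c) \<otimes> (s \<otimes> t)) = (a \<otimes> s) \<otimes> (u \<otimes> (b \<otimes> v \<ominus> c \<otimes> t))"
      using u(1,2,3) cc by algebra
    also have "\<dots> = \<zero>" using u cc by simp
    finally show "(case w of (a,s) \<Rightarrow> case y of (b,t) \<Rightarrow> fraction R S (a \<otimes> b) (s \<otimes> t)) = (case w of (a,s) \<Rightarrow> case z of (b,t) \<Rightarrow> fraction R S (a \<otimes> b) (s \<otimes> t))" unfolding d prod.case
      by (intro fr_eq[of _ _ _ _ u]) (use u(1-7) cc S in auto)
  qed
  have add: "fraction R S a s \<oplus>\<^bsub>?L\<^esub> fraction R S b t = fraction R S (a \<otimes> t \<oplus> b \<otimes> s) (s \<otimes> t)"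
    if "a \<in> carrier R" "b \<in> carrier R" "s \<in> S" "t \<in> S" for a b s t
    using UN_equiv_class2[OF eq eq c2a, of "(a,s)" "(b,t)"] that
    by (simp add: localization_def fraction_def case_prod_unfold)
  have mult: "fraction R S a s \<otimes>\<^bsub>?L\<^esub> fraction R S b t = fraction R S (a \<otimes> b) (s \<otimes> t)"
    if "a \<in> carrier R" "b \<in> carrier R" "s \<in> S" "t \<in> S" for a b s t
    using UN_equiv_class2[OF eq eq c2m, of "(a,s)" "(b,t)"] that
    by (simp add: localization_def fraction_def case_prod_unfold)
  have car: "carrier ?L = {fraction R S a s | a s. a \<in> carrier R \<and> s \<in> S}"
    by (auto simp: localization_def fraction_def quotient_def)
  have one: "\<one>\<^bsub>?L\<^esub> = fraction R S \<one> \<one>" and zero: "\<zero>\<^bsub>?L\<^esub> = fraction R S \<zero> \<one>"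
    by (simp_all add: localization_def)
  note ss = add mult car one zero
  have repr: "\<exists>a s. x = fraction R S a s \<and> a \<in> carrier R \<and> s \<in> S \<and> s \<in> carrier R" if "x \<in> carrier ?L" for x
    using that Sc by (auto simp: car)
  have inL: "fraction R S a s \<in> carrier ?L" if "a \<in> carrier R" "s \<in> S" for a s
    using that by (auto simp: car)
  show ?thesis
  proof (rule cringI)
    show "abelian_group ?L"
    proof (rule abelian_groupI)
      fix x y assume xy: "x \<in> carrier ?L" "y \<in> carrier ?L"
      then obtain a s b t where x: "x = fraction R S a s" "a \<in> carrier R" "s \<in> S" "s \<in> carrier R"
        and y: "y = fraction R S b t" "b \<in> carrier R" "t \<in> S" "t \<in> carrier R" using repr by blast
      show "x \<oplus>\<^bsub>?L\<^esub> y \<in> carrier ?L" using x y S by (simp add: add inL)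
      show "x \<oplus>\<^bsub>?L\<^esub> y = y \<oplus>\<^bsub>?L\<^esub> x" using x y S by (simp add: add m_comm a_comm)
      show "\<zero>\<^bsub>?L\<^esub> \<oplus>\<^bsub>?L\<^esub> x = x" using x S by (simp add: zero add)
      have "fraction R S (\<ominus> a) s \<oplus>\<^bsub>?L\<^esub> x = \<zero>\<^bsub>?L\<^esub>"
        unfolding x zero using x S by (simp add: add) (intro fr_eq1, auto simp: l_minus l_neg)
      then show "\<exists>y\<in>carrier ?L. y \<oplus>\<^bsub>?L\<^esub> x = \<zero>\<^bsub>?L\<^esub>" using x inL by blast
      fix z assume "z \<in> carrier ?L"
      then obtain c v where z: "z = fraction R S c v" "c \<in> carrier R" "v \<in> S" "v \<in> carrier R" using repr by blast
      have e: "(a \<otimes> t \<oplus> b \<otimes> s) \<otimes> v \<oplus> c \<otimes> (s \<otimes> t) = a \<otimes> (t \<otimes> v) \<oplus> (b \<otimes> v \<oplus> c \<otimes> t) \<otimes> s"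
        using x(2,4) y(2,4) z(2,4) by algebra
      show "x \<oplus>\<^bsub>?L\<^esub> y \<oplus>\<^bsub>?L\<^esub> z = x \<oplus>\<^bsub>?L\<^esub> (y \<oplus>\<^bsub>?L\<^esub> z)"
        using x y z S by (simp add: add e m_assoc)
    qed (use S in \<open>simp add: zero inL\<close>)
    show "Group.comm_monoid ?L"
    proof (rule comm_monoidI)
      fix x y assume xy: "x \<in> carrier ?L" "y \<in> carrier ?L"
      then obtain a s b t where x: "x = fraction R S a s" "a \<in> carrier R" "s \<in> S" "s \<in> carrier R"
        and y: "y = fraction R S b t" "b \<in> carrier R" "t \<in> S" "t \<in> carrier R" using repr by blast
      show "x \<otimes>\<^bsub>?L\<^esub> y \<in> carrier ?L" using x y S by (simp add: mult inL)
      show "x \<otimes>\<^bsub>?L\<^esub> y = y \<otimes>\<^bsub>?L\<^esub> x" using x y S by (simp add: mult m_comm)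
      show "\<one>\<^bsub>?L\<^esub> \<otimes>\<^bsub>?L\<^esub> x = x" using x S by (simp add: one mult)
      fix z assume "z \<in> carrier ?L"
      then obtain c v where z: "z = fraction R S c v" "c \<in> carrier R" "v \<in> S" "v \<in> carrier R" using repr by blast
      show "x \<otimes>\<^bsub>?L\<^esub> y \<otimes>\<^bsub>?L\<^esub> z = x \<otimes>\<^bsub>?L\<^esub> (y \<otimes>\<^bsub>?L\<^esub> z)"
        using x y z S by (simp add: mult m_assoc)
    qed (use S in \<open>simp add: one inL\<close>)
    fix x y z assume "x \<in> carrier ?L" "y \<in> carrier ?L" "z \<in> carrier ?L"
    then obtain a s b t c v where x: "x = fraction R S a s" "a \<in> carrier R" "s \<in> S" "s \<in> carrier R"
        and y: "y = fraction R S b t" "b \<in> carrier R" "t \<in> S" "t \<in> carrier R"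
        and z: "z = fraction R S c v" "c \<in> carrier R" "v \<in> S" "v \<in> carrier R" using repr by metis
    have e: "(a \<otimes> t \<oplus> b \<otimes> s) \<otimes> c \<otimes> (s \<otimes> v \<otimes> (t \<otimes> v)) = 
        (a \<otimes> c \<otimes> (t \<otimes> v) \<oplus> b \<otimes> c \<otimes> (s \<otimes> v)) \<otimes> (s \<otimes> t \<otimes> v)"
        using x(2,4) y(2,4) z(2,4) by algebra
    have "(x \<oplus>\<^bsub>?L\<^esub> y) \<otimes>\<^bsub>?L\<^esub> z = fraction R S ((a \<otimes> t \<oplus> b \<otimes> s) \<otimes> c) (s \<otimes> t \<otimes> v)"
      using x y z S by (simp add: add mult)
    also have "\<dots> = fraction R S (a \<otimes> c \<otimes> (t \<otimes> v) \<oplus> b \<otimes> c \<otimes> (s \<otimes> v)) (s \<otimes> v \<otimes> (t \<otimes> v))"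
      by (rule fr_eq1[OF _ _ _ _ e]) (use x y z S in auto)
    also have "\<dots> = x \<otimes>\<^bsub>?L\<^esub> z \<oplus>\<^bsub>?L\<^esub> y \<otimes>\<^bsub>?L\<^esub> z"
      using x y z S by (simp add: add mult)
    finally show "(x \<oplus>\<^bsub>?L\<^esub> y) \<otimes>\<^bsub>?L\<^esub> z = x \<otimes>\<^bsub>?L\<^esub> z \<oplus>\<^bsub>?L\<^esub> y \<otimes>\<^bsub>?L\<^esub> z" .
  qed
qed

definition localization_at :: "('a, 'c) ring_scheme \<Rightarrow> 'a set \<Rightarrow> ('a \<times> 'a) set ring"
  where "localization_at R p = localization R (carrier R - p)"

definition Max_ideals :: "('a, 'c) ring_scheme \<Rightarrow> 'a set set"
  where "Max_ideals R = {m. maximalideal m R}"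

definition Spec :: "('a, 'c) ring_scheme \<Rightarrow> 'a set set"
  where "Spec R = {p. primeideal p R}"


section \<open>Finitely generated and projective modules\<close>

definition mod_hom ::
    "('a, 'c) ring_scheme \<Rightarrow> ('a, 'm) module \<Rightarrow> ('a, 'n) module \<Rightarrow> ('m \<Rightarrow> 'n) set"
  where "mod_hom R M N =
    {f \<in> carrier M \<rightarrow> carrier N.
       (\<forall>x\<in>carrier M. \<forall>y\<in>carrier M. f (x \<oplus>\<^bsub>M\<^esub> y) = f x \<oplus>\<^bsub>N\<^esub> f y) \<and>
       (\<forall>a\<in>carrier R. \<forall>x\<in>carrier M. f (a \<odot>\<^bsub>M\<^esub> x) = a \<odot>\<^bsub>N\<^esub> f x)}"

definition fin_gen :: "('a, 'c) ring_scheme \<Rightarrow> ('a, 'm) module \<Rightarrow> bool"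
  where "fin_gen R M \<longleftrightarrow>
    (\<exists>A. finite A \<and> A \<subseteq> carrier M \<and>
       (\<forall>x\<in>carrier M. \<exists>c \<in> A \<rightarrow> carrier R. x = (\<Oplus>\<^bsub>M\<^esub> v\<in>A. c v \<odot>\<^bsub>M\<^esub> v)))"

text \<open>The lifting property. A definition cannot quantify over the carrier types of the test
  modules, so these types are fixed: the type \<open>'m \<Rightarrow> 'a\<close> holds the free module on the carrier
  of \<open>P\<close>, hence the canonical surjection from that module to \<open>P\<close> is among the
  tested ones. The lemma \<open>projective_lift\<close> shows that nothing is lost: lifts then exist
  for surjections between modules on arbitrary types.\<close>

definition projective :: "('a, 'c) ring_scheme \<Rightarrow> ('a, 'm) module \<Rightarrow> bool"
  where "projective R P \<longleftrightarrow>
    (\<forall>(M :: ('a, 'm \<Rightarrow> 'a) module) (N :: ('a, 'm) module) g f.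
       Module.module R M \<and> Module.module R N \<and> g \<in> mod_hom R M N \<and> g ` carrier M = carrier N \<and>
       f \<in> mod_hom R P N \<longrightarrow>
       (\<exists>h \<in> mod_hom R P M. \<forall>x\<in>carrier P. g (h x) = f x))"


definition free_module :: "('a, 'c) ring_scheme \<Rightarrow> 'm set \<Rightarrow> ('a, 'm \<Rightarrow> 'a) module"
  where "free_module R B =
    \<lparr>carrier = {\<phi>. (\<forall>x. \<phi> x \<in> carrier R) \<and> {x. \<phi> x \<noteq> \<zero>\<^bsub>R\<^esub>} \<subseteq> B \<and> finite {x. \<phi> x \<noteq> \<zero>\<^bsub>R\<^esub>}},
     mult = undefined, one = undefined, zero = \<lambda>x. \<zero>\<^bsub>R\<^esub>,
     add = \<lambda>\<phi> \<psi> x. \<phi> x \<oplus>\<^bsub>R\<^esub> \<psi> x, smult = \<lambda>a \<phi> x. a \<otimes>\<^bsub>R\<^esub> \<phi> x\<rparr>"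

lemma free_module:
  assumes "cring R" shows "Module.module R (free_module R B)"
proof -
  interpret cring R by fact
  note fm = free_module_def
  show ?thesis
  proof (rule moduleI[OF assms])
    show "abelian_group (free_module R B)"
    proof (rule abelian_groupI, goal_cases)
      case (1 x y)
      then have "{z. x z \<oplus>\<^bsub>R\<^esub> y z \<noteq> \<zero>\<^bsub>R\<^esub>} \<subseteq> {z. x z \<noteq> \<zero>\<^bsub>R\<^esub>} \<union> {z. y z \<noteq> \<zero>\<^bsub>R\<^esub>}" by auto
      with 1 show ?case by (auto simp: fm dest: finite_subset)
    next
      case (6 x)
      have "{z. \<ominus>\<^bsub>R\<^esub> x z \<noteq> \<zero>\<^bsub>R\<^esub>} \<subseteq> {z. x z \<noteq> \<zero>\<^bsub>R\<^esub>}" by auto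
      with 6 show ?case by (intro bexI[of _ "\<lambda>z. \<ominus>\<^bsub>R\<^esub> x z"]) (auto simp: fm l_neg dest: finite_subset)
    qed (auto simp: fm a_ac fun_eq_iff)
  next
    fix a x assume "a \<in> carrier R" "x \<in> carrier (free_module R B)"
    moreover have "a \<in> carrier R \<Longrightarrow> {z. a \<otimes>\<^bsub>R\<^esub> x z \<noteq> \<zero>\<^bsub>R\<^esub>} \<subseteq> {z. x z \<noteq> \<zero>\<^bsub>R\<^esub>}" by auto
    ultimately show "a \<odot>\<^bsub>free_module R B\<^esub> x \<in> carrier (free_module R B)" 
      by (auto simp: fm dest: finite_subset)
  qed (auto simp: fm fun_eq_iff l_distr r_distr m_assoc)
qed

definition lincomb :: "('a, 'c) ring_scheme \<Rightarrow> ('a, 'n) module \<Rightarrow> ('m \<Rightarrow> 'n) \<Rightarrow> ('m \<Rightarrow> 'a) \<Rightarrow> 'n"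
  where "lincomb R M h \<phi> = (\<Oplus>\<^bsub>M\<^esub> x\<in>{x. \<phi> x \<noteq> \<zero>\<^bsub>R\<^esub>}. \<phi> x \<odot>\<^bsub>M\<^esub> h x)"

lemma lincomb_superset:
  assumes "Module.module R M" "\<phi> \<in> carrier (free_module R B)" "h \<in> B \<rightarrow> carrier M"
    "finite S" "{x. \<phi> x \<noteq> \<zero>\<^bsub>R\<^esub>} \<subseteq> S" "S \<subseteq> B"
  shows "lincomb R M h \<phi> = (\<Oplus>\<^bsub>M\<^esub> x\<in>S. \<phi> x \<odot>\<^bsub>M\<^esub> h x)"
proof -
  interpret Module.module R M by fact
  show ?thesis unfolding lincomb_def
    using assms by (intro M.add.finprod_mono_neutral_cong_left) (auto simp: free_module_def Pi_def)
qed

lemma lincomb_hom: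
  assumes "Module.module R M" "h \<in> B \<rightarrow> carrier M"
  shows "lincomb R M h \<in> mod_hom R (free_module R B) M"
proof -
  interpret Module.module R M by fact
  interpret F: Module.module R "free_module R B" by (rule free_module) (rule R.is_cring)
  note sup = lincomb_superset[OF assms(1) _ assms(2)]
  show ?thesis unfolding mod_hom_def
  proof (intro CollectI conjI ballI Pi_I)
    fix \<phi> assume p: "\<phi> \<in> carrier (free_module R B)"
    show "lincomb R M h \<phi> \<in> carrier M" unfolding lincomb_def
      using p assms(2) by (intro M.finsum_closed) (auto simp: free_module_def)
  next
    fix \<phi> \<psi> assume p: "\<phi> \<in> carrier (free_module R B)" and q: "\<psi> \<in> carrier (free_module R B)"
    let ?S = "{x. \<phi> x \<noteq> \<zero>\<^bsub>R\<^esub>} \<union> {x. \<psi> x \<noteq> \<zero>\<^bsub>R\<^esub>}"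
    have S: "finite ?S" "?S \<subseteq> B" using p q by (auto simp: free_module_def)
    have cl: "\<phi> x \<in> carrier R" "\<psi> x \<in> carrier R" for x using p q by (auto simp: free_module_def)
    have hc: "x \<in> B \<Longrightarrow> h x \<in> carrier M" for x using assms(2) by auto
    have ad: "(\<phi> \<oplus>\<^bsub>free_module R B\<^esub> \<psi>) x = \<phi> x \<oplus>\<^bsub>R\<^esub> \<psi> x" for x by (simp add: free_module_def)
    have "lincomb R M h (\<phi> \<oplus>\<^bsub>free_module R B\<^esub> \<psi>) = (\<Oplus>\<^bsub>M\<^esub> x\<in>?S. (\<phi> \<oplus>\<^bsub>free_module R B\<^esub> \<psi>) x \<odot>\<^bsub>M\<^esub> h x)"
      by (intro sup F.a_closed p q S) (auto simp: ad)
    also have "\<dots> = (\<Oplus>\<^bsub>M\<^esub> x\<in>?S. \<phi> x \<odot>\<^bsub>M\<^esub> h x \<oplus>\<^bsub>M\<^esub> \<psi> x \<odot>\<^bsub>M\<^esub> h x)"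
      using S hc cl by (intro M.finsum_cong') (auto simp: ad smult_l_distr subset_iff)
    also have "\<dots> = (\<Oplus>\<^bsub>M\<^esub> x\<in>?S. \<phi> x \<odot>\<^bsub>M\<^esub> h x) \<oplus>\<^bsub>M\<^esub> (\<Oplus>\<^bsub>M\<^esub> x\<in>?S. \<psi> x \<odot>\<^bsub>M\<^esub> h x)"
      using S hc cl by (intro M.finsum_addf) (auto simp: subset_iff)
    also have "\<dots> = lincomb R M h \<phi> \<oplus>\<^bsub>M\<^esub> lincomb R M h \<psi>"
      using sup[OF p S(1) _ S(2)] sup[OF q S(1) _ S(2)] by simp
    finally show "lincomb R M h (\<phi> \<oplus>\<^bsub>free_module R B\<^esub> \<psi>) = lincomb R M h \<phi> \<oplus>\<^bsub>M\<^esub> lincomb R M h \<psi>" .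
  next
    fix a \<phi> assume a: "a \<in> carrier R" and p: "\<phi> \<in> carrier (free_module R B)"
    let ?S = "{x. \<phi> x \<noteq> \<zero>\<^bsub>R\<^esub>}"
    have S: "finite ?S" "?S \<subseteq> B" using p by (auto simp: free_module_def)
    have cl: "\<phi> x \<in> carrier R" for x using p by (auto simp: free_module_def)
    have hc: "x \<in> B \<Longrightarrow> h x \<in> carrier M" for x using assms(2) by auto
    have ad: "(a \<odot>\<^bsub>free_module R B\<^esub> \<phi>) x = a \<otimes>\<^bsub>R\<^esub> \<phi> x" for x by (simp add: free_module_def)
    have "lincomb R M h (a \<odot>\<^bsub>free_module R B\<^esub> \<phi>) = (\<Oplus>\<^bsub>M\<^esub> x\<in>?S. (a \<odot>\<^bsub>free_module R B\<^esub> \<phi>) x \<odot>\<^bsub>M\<^esub> h x)"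
      using a by (intro sup F.smult_closed p S) (auto simp: ad)
    also have "\<dots> = (\<Oplus>\<^bsub>M\<^esub> x\<in>?S. a \<odot>\<^bsub>M\<^esub> (\<phi> x \<odot>\<^bsub>M\<^esub> h x))"
      using a S hc cl by (intro M.finsum_cong') (auto simp: ad smult_assoc1 subset_iff)
    also have "\<dots> = a \<odot>\<^bsub>M\<^esub> lincomb R M h \<phi>" unfolding lincomb_def
      using a S hc cl by (intro finsum_smult_ldistr[symmetric]) (auto simp: subset_iff)
    finally show "lincomb R M h (a \<odot>\<^bsub>free_module R B\<^esub> \<phi>) = a \<odot>\<^bsub>M\<^esub> lincomb R M h \<phi>" .
  qed
qed

lemma mod_hom_lincomb:
  assumes "Module.module R M" "Module.module R N" "g \<in> mod_hom R M N" "h \<in> B \<rightarrow> carrier M"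
    "\<phi> \<in> carrier (free_module R B)"
  shows "g (lincomb R M h \<phi>) = lincomb R N (\<lambda>x. g (h x)) \<phi>"
proof -
  interpret M: Module.module R M by fact
  interpret N: Module.module R N by fact
  have g: "g x \<in> carrier N" "y \<in> carrier M \<Longrightarrow> g (x \<oplus>\<^bsub>M\<^esub> y) = g x \<oplus>\<^bsub>N\<^esub> g y"
      "a \<in> carrier R \<Longrightarrow> g (a \<odot>\<^bsub>M\<^esub> x) = a \<odot>\<^bsub>N\<^esub> g x" if "x \<in> carrier M" for x y a
    using assms(3) that by (auto simp: mod_hom_def)
  have g0: "g \<zero>\<^bsub>M\<^esub> = \<zero>\<^bsub>N\<^esub>"
    using g(3)[of "\<zero>\<^bsub>M\<^esub>" "\<zero>\<^bsub>R\<^esub>"] g(1)[of "\<zero>\<^bsub>M\<^esub>"] by simp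
  have "g (\<Oplus>\<^bsub>M\<^esub> x\<in>S. k x) = (\<Oplus>\<^bsub>N\<^esub> x\<in>S. g (k x))" if "finite S" "k \<in> S \<rightarrow> carrier M" for S k
    using that by (induction S rule: finite_induct) (auto simp: g0 g Pi_def)
  from this[of "{x. \<phi> x \<noteq> \<zero>\<^bsub>R\<^esub>}" "\<lambda>x. \<phi> x \<odot>\<^bsub>M\<^esub> h x"]
  have "g (lincomb R M h \<phi>) = (\<Oplus>\<^bsub>N\<^esub> x\<in>{x. \<phi> x \<noteq> \<zero>\<^bsub>R\<^esub>}. g (\<phi> x \<odot>\<^bsub>M\<^esub> h x))"
    using assms(4,5) unfolding lincomb_def by (auto simp: free_module_def)
  also have "\<dots> = lincomb R N (\<lambda>x. g (h x)) \<phi>" unfolding lincomb_def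
    using assms(4,5) g by (intro N.finsum_cong') (auto simp: free_module_def Pi_def subset_iff)
  finally show ?thesis .
qed

lemma lincomb_surj:
  assumes "Module.module R P"
  shows "lincomb R P (\<lambda>x. x) ` carrier (free_module R (carrier P)) = carrier P"
proof
  interpret Module.module R P by fact
  show "lincomb R P (\<lambda>x. x) ` carrier (free_module R (carrier P)) \<subseteq> carrier P"
    using lincomb_hom[OF assms, of "\<lambda>x. x" "carrier P"] by (auto simp: mod_hom_def)
  show "carrier P \<subseteq> lincomb R P (\<lambda>x. x) ` carrier (free_module R (carrier P))"
  proof
    fix x assume x: "x \<in> carrier P"
    let ?d = "\<lambda>y. if y = x then \<one>\<^bsub>R\<^esub> else \<zero>\<^bsub>R\<^esub>"
    have d: "?d \<in> carrier (free_module R (carrier P))"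
      using x by (auto simp: free_module_def intro: finite_subset[of _ "{x}"])
    have "lincomb R P (\<lambda>x. x) ?d = (\<Oplus>\<^bsub>P\<^esub> y\<in>{x}. ?d y \<odot>\<^bsub>P\<^esub> y)"
      using x by (intro lincomb_superset[OF assms d]) auto
    also have "\<dots> = x" using x by simp
    finally show "x \<in> lincomb R P (\<lambda>x. x) ` carrier (free_module R (carrier P))"
      using d by force
  qed
qed

lemma projective_lift:
  fixes P :: "('a, 'm) module" and A :: "('a, 'b) module" and B :: "('a, 'n) module"
  assumes "Module.module R P" "projective R P" and AB: "Module.module R A" "Module.module R B"
    and g: "g \<in> mod_hom R A B" "g ` carrier A = carrier B" and f: "f \<in> mod_hom R P B"
  shows "\<exists>h \<in> mod_hom R P A. \<forall>x\<in>carrier P. g (h x) = f x"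
proof -
  interpret Module.module R P by fact
  let ?F = "free_module R (carrier P)" and ?p = "lincomb R P (\<lambda>x. x)"
  have "(\<lambda>x. x) \<in> mod_hom R P P" by (auto simp: mod_hom_def)
  moreover have F: "Module.module R ?F" by (rule free_module) (rule R.is_cring)
  moreover have "?p \<in> mod_hom R ?F P" by (rule lincomb_hom[OF assms(1)]) auto
  ultimately obtain s where s: "s \<in> mod_hom R P ?F" "\<forall>x\<in>carrier P. ?p (s x) = x"
    using assms(1,2) lincomb_surj[OF assms(1)] unfolding projective_def by blast
  have fc: "x \<in> carrier P \<Longrightarrow> f x \<in> carrier B" for x using f by (auto simp: mod_hom_def)
  define k where "k x = (SOME y. y \<in> carrier A \<and> g y = f x)" for x
  have k: "k x \<in> carrier A" "g (k x) = f x" if "x \<in> carrier P" for x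
  proof -
    have "\<exists>y. y \<in> carrier A \<and> g y = f x" using fc[OF that] g(2) by (metis imageE)
    from someI_ex[OF this] show "k x \<in> carrier A" "g (k x) = f x" unfolding k_def by auto
  qed
  have kc: "k \<in> carrier P \<rightarrow> carrier A" using k by auto
  have "lincomb R A k \<in> mod_hom R ?F A" by (rule lincomb_hom[OF AB(1) kc])
  with s have "(\<lambda>x. lincomb R A k (s x)) \<in> mod_hom R P A" by (auto simp: mod_hom_def Pi_iff)
  moreover have "g (lincomb R A k (s x)) = f x" if x: "x \<in> carrier P" for x
  proof -
    interpret B: Module.module R B by fact
    have sx: "s x \<in> carrier ?F" using s x by (auto simp: mod_hom_def)
    have "g (lincomb R A k (s x)) = lincomb R B (\<lambda>y. g (k y)) (s x)"
      by (rule mod_hom_lincomb[OF AB g(1) kc sx])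
    also have "\<dots> = lincomb R B (\<lambda>y. f y) (s x)" unfolding lincomb_def
      using sx k fc by (intro B.finsum_cong') (auto simp: free_module_def Pi_def subset_iff)
    also have "\<dots> = f (?p (s x))"
      by (rule mod_hom_lincomb[OF assms(1) AB(2) f _ sx, symmetric]) auto
    also have "?p (s x) = x" using s(2) x by (rule bspec)
    finally show ?thesis .
  qed
  ultimately show ?thesis by (intro bexI[of _ "\<lambda>x. lincomb R A k (s x)"] ballI)
qed

section \<open>Resolutions, projective dimension and small finitistic dimension\<close>

text \<open>\<open>0 \<rightarrow> P n \<rightarrow> \<dots> \<rightarrow> P 1 \<rightarrow> P 0 \<rightarrow> M \<rightarrow> 0\<close> is exact, where \<open>d i\<close> maps \<open>P (Suc i)\<close> to \<open>P i\<close>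
  and \<open>e\<close> maps \<open>P 0\<close> to \<open>M\<close>; \<open>syzygy P d e M i\<close> is the kernel of the map out of
  \<open>P i\<close>.\<close>

definition syzygy ::
    "(nat \<Rightarrow> ('a, 'p) module) \<Rightarrow> (nat \<Rightarrow> 'p \<Rightarrow> 'p) \<Rightarrow> ('p \<Rightarrow> 'm) \<Rightarrow> ('a, 'm) module \<Rightarrow> nat \<Rightarrow> 'p set"
  where "syzygy P d e M i =
    (case i of 0 \<Rightarrow> a_kernel (P 0) M e | Suc j \<Rightarrow> a_kernel (P (Suc j)) (P j) (d j))"

definition resolution ::
    "('a, 'c) ring_scheme \<Rightarrow> nat \<Rightarrow> (nat \<Rightarrow> ('a, 'p) module) \<Rightarrow> (nat \<Rightarrow> 'p \<Rightarrow> 'p) \<Rightarrow> ('p \<Rightarrow> 'm) \<Rightarrow>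
     ('a, 'm) module \<Rightarrow> bool"
  where "resolution R n P d e M \<longleftrightarrow>
    (\<forall>i\<le>n. Module.module R (P i)) \<and>
    e \<in> mod_hom R (P 0) M \<and> (\<forall>i<n. d i \<in> mod_hom R (P (Suc i)) (P i)) \<and>
    e ` carrier (P 0) = carrier M \<and>
    (\<forall>i<n. d i ` carrier (P (Suc i)) = syzygy P d e M i) \<and>
    syzygy P d e M n = {\<zero>\<^bsub>P n\<^esub>}"

text \<open>A finitely generated module is a quotient of some \<open>R\<^sup>k\<close>, so up to isomorphism its carrier
  lies in \<open>nat \<Rightarrow> 'a\<close>. Hence the choice of that type for the modules \<open>P i\<close> here, and for
  \<open>M\<close> in \<open>fPD\<close>, is no restriction.\<close>

definition FPR :: "('a, 'c) ring_scheme \<Rightarrow> ('a, 'm) module \<Rightarrow> bool"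
  where "FPR R M \<longleftrightarrow> Module.module R M \<and>
    (\<exists>n (P :: nat \<Rightarrow> ('a, nat \<Rightarrow> 'a) module) d e. resolution R n P d e M \<and>
       (\<forall>i\<le>n. fin_gen R (P i) \<and> projective R (P i)))"

text \<open>Here the modules \<open>P i\<close> need not be finitely generated. A shortest projective resolution can
  be cut out of a free resolution, whose modules have cardinality at most
  \<open>max (|R|, |M|, |nat|)\<close>. If \<open>R\<close> has at least two elements, then sets of this cardinality embed
  into \<open>'m + nat \<Rightarrow> 'a\<close>; otherwise all modules are zero. The zero module has dimension \<open>0\<close>, and
  the infimum of the empty set is \<open>\<infinity>\<close>.\<close>

definition pd :: "('a, 'c) ring_scheme \<Rightarrow> ('a, 'm) module \<Rightarrow> enat"
  where "pd R M =
    (INF n \<in> {n. \<exists>(P :: nat \<Rightarrow> ('a, 'm + nat \<Rightarrow> 'a) module) d e.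
        resolution R n P d e M \<and> (\<forall>i\<le>n. projective R (P i))}. enat n)"

definition fPD :: "('a, 'c) ring_scheme \<Rightarrow> enat"
  where "fPD R = (SUP M \<in> {M :: ('a, nat \<Rightarrow> 'a) module. FPR R M}. pd R M)"

end

theory Submission
  imports Defs
begin

text \<open>Take a finite resolution of \<open>M\<close> by finitely generated projectives of least length \<open>N\<close>, and let
  \<open>d: P\<^sub>N \<rightarrow> P\<^sub>N\<^sub>-\<^sub>1\<close> be its last map. If \<open>N\<close> exceeded \<open>fPD(R\<^sub>m)\<close> for every maximal ideal \<open>m\<close>, then
  \<open>M\<^sub>m\<close> would have a projective resolution shorter than \<open>N\<close>, and comparing it with the localized
  resolution shows that \<open>d\<^sub>m\<close> has a left inverse. Clearing denominators gives \<open>h: P\<^sub>N\<^sub>-\<^sub>1 \<rightarrow> P\<^sub>N\<close> such that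
  \<open>h \<circ> d\<close> is multiplication by some \<open>s \<notin> m\<close>. The elements \<open>s\<close> admitting such an \<open>h\<close> form an ideal,
  which lies in no maximal ideal, so it contains \<open>1\<close> and \<open>d\<close> splits. Replacing \<open>P\<^sub>N\<^sub>-\<^sub>1\<close> by \<open>ker h\<close> then
  gives a resolution of length \<open>N - 1\<close>, a contradiction.\<close>

section \<open>Homomorphisms and dual bases\<close>

text \<open>Denominators can be cleared because a map out of a finitely generated module is
  controlled by finitely many values. The lifting property \<open>projective\<close> does not
  visibly survive localization, since over \<open>R\<^sub>m\<close> it tests modules and maps that
  need not come from \<open>R\<close>. Finitely generated projectives are therefore handled through
  finite dual bases: such a basis is an equation that localizes term by term, and it also supplies
  the candidate for \<open>h\<close>. The shorter resolution that the bound on \<open>fPD\<close>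
  provides consists of arbitrary projectives, so the comparison of resolutions asks for projectivity
  only and keeps the two carrier types independent. The other obstacle is that \<open>fPD\<close>
  and \<open>pd\<close> fix carrier types while localization changes them; isomorphic copies along
  injections mediate. The least length is taken among resolutions by finitely generated projectives,
  not read off from \<open>pd\<close>, because splittings of the last map have to descend from
  \<open>R\<^sub>m\<close> to \<open>R\<close>.\<close>

lemma mod_homI:
  assumes "\<And>x. x \<in> carrier M \<Longrightarrow> f x \<in> carrier N"
    "\<And>x y. x \<in> carrier M \<Longrightarrow> y \<in> carrier M \<Longrightarrow> f (x \<oplus>\<^bsub>M\<^esub> y) = f x \<oplus>\<^bsub>N\<^esub> f y"
    "\<And>a x. a \<in> carrier R \<Longrightarrow> x \<in> carrier M \<Longrightarrow> f (a \<odot>\<^bsub>M\<^esub> x) = a \<odot>\<^bsub>N\<^esub> f x"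
  shows "f \<in> mod_hom R M N"
  using assms by (auto simp: mod_hom_def)

lemma mod_hom_closed: "f \<in> mod_hom R M N \<Longrightarrow> x \<in> carrier M \<Longrightarrow> f x \<in> carrier N"
  by (auto simp: mod_hom_def)

lemma mod_hom_add:
  "f \<in> mod_hom R M N \<Longrightarrow> x \<in> carrier M \<Longrightarrow> y \<in> carrier M \<Longrightarrow> f (x \<oplus>\<^bsub>M\<^esub> y) = f x \<oplus>\<^bsub>N\<^esub> f y"
  by (auto simp: mod_hom_def)

lemma mod_hom_smult:
  "f \<in> mod_hom R M N \<Longrightarrow> a \<in> carrier R \<Longrightarrow> x \<in> carrier M \<Longrightarrow> f (a \<odot>\<^bsub>M\<^esub> x) = a \<odot>\<^bsub>N\<^esub> f x"
  by (auto simp: mod_hom_def)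

lemma mod_hom_zero:
  assumes "Module.module R M" "Module.module R N" "f \<in> mod_hom R M N"
  shows "f \<zero>\<^bsub>M\<^esub> = \<zero>\<^bsub>N\<^esub>"
proof -
  interpret M: Module.module R M by fact
  interpret N: Module.module R N by fact
  show ?thesis
    using mod_hom_smult[OF assms(3), of "\<zero>\<^bsub>R\<^esub>" "\<zero>\<^bsub>M\<^esub>"] mod_hom_closed[OF assms(3), of "\<zero>\<^bsub>M\<^esub>"] by simp
qed

lemma mod_hom_minus:
  assumes "Module.module R M" "Module.module R N" "f \<in> mod_hom R M N" "x \<in> carrier M" "y \<in> carrier M"
  shows "f (x \<ominus>\<^bsub>M\<^esub> y) = f x \<ominus>\<^bsub>N\<^esub> f y"
proof -
  interpret M: Module.module R M by fact
  interpret N: Module.module R N by fact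
  have "f (\<ominus>\<^bsub>M\<^esub> y) \<oplus>\<^bsub>N\<^esub> f y = \<zero>\<^bsub>N\<^esub>"
    using assms mod_hom_add[OF assms(3), of "\<ominus>\<^bsub>M\<^esub> y" y]
    by (simp add: M.M.l_neg mod_hom_zero[OF assms(1-3)])
  then have "f (\<ominus>\<^bsub>M\<^esub> y) = \<ominus>\<^bsub>N\<^esub> f y"
    using assms by (metis N.M.minus_equality M.M.a_inv_closed mod_hom_closed)
  then show ?thesis using assms by (simp add: M.M.minus_eq N.M.minus_eq mod_hom_add)
qed

lemma mod_hom_finsum:
  assumes "Module.module R M" "Module.module R N" "f \<in> mod_hom R M N" "finite I" "k \<in> I \<rightarrow> carrier M"
  shows "f (\<Oplus>\<^bsub>M\<^esub> i\<in>I. k i) = (\<Oplus>\<^bsub>N\<^esub> i\<in>I. f (k i))"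
proof -
  interpret M: Module.module R M by fact
  interpret N: Module.module R N by fact
  show ?thesis using assms(4,5)
    by (induction I rule: finite_induct)
      (auto simp: mod_hom_zero[OF assms(1-3)] mod_hom_add[OF assms(3)] mod_hom_closed[OF assms(3)] Pi_def)
qed

lemma mod_hom_comp:
  assumes "f \<in> mod_hom R M N" "g \<in> mod_hom R N K"
  shows "(\<lambda>x. g (f x)) \<in> mod_hom R M K"
  using assms by (auto simp: mod_hom_def Pi_def)

lemma mod_hom_id: "(\<lambda>x. x) \<in> mod_hom R M M"
  by (auto simp: mod_hom_def)

lemma (in Module.module) minus_eq_iff:
  assumes "x \<in> carrier M" "y \<in> carrier M" "z \<in> carrier M"
  shows "x \<ominus>\<^bsub>M\<^esub> y = z \<longleftrightarrow> x = z \<oplus>\<^bsub>M\<^esub> y"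
proof
  assume "x \<ominus>\<^bsub>M\<^esub> y = z"
  then have "z \<oplus>\<^bsub>M\<^esub> y = x \<oplus>\<^bsub>M\<^esub> (\<ominus>\<^bsub>M\<^esub> y \<oplus>\<^bsub>M\<^esub> y)" using assms by (auto simp add: M.minus_eq M.a_assoc)
  then show "x = z \<oplus>\<^bsub>M\<^esub> y" using assms by (simp add: M.l_neg)
next
  assume "x = z \<oplus>\<^bsub>M\<^esub> y"
  then show "x \<ominus>\<^bsub>M\<^esub> y = z" using assms by (simp add: M.minus_eq M.a_assoc M.r_neg)
qed

lemma (in Module.module) add_minus_add:
  assumes "x \<in> carrier M" "y \<in> carrier M" "z \<in> carrier M" "w \<in> carrier M"
  shows "(x \<oplus>\<^bsub>M\<^esub> y) \<ominus>\<^bsub>M\<^esub> (z \<oplus>\<^bsub>M\<^esub> w) = (x \<ominus>\<^bsub>M\<^esub> z) \<oplus>\<^bsub>M\<^esub> (y \<ominus>\<^bsub>M\<^esub> w)"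
  using assms by (simp add: M.minus_eq M.minus_add M.a_ac)

lemma (in Module.module) smult_minus:
  assumes "a \<in> carrier R" "x \<in> carrier M" "y \<in> carrier M"
  shows "a \<odot>\<^bsub>M\<^esub> (x \<ominus>\<^bsub>M\<^esub> y) = a \<odot>\<^bsub>M\<^esub> x \<ominus>\<^bsub>M\<^esub> a \<odot>\<^bsub>M\<^esub> y"
  using assms by (simp add: M.minus_eq smult_r_distr smult_r_minus)

lemma (in Module.module) smult_commute:
  assumes "a \<in> carrier R" "b \<in> carrier R" "x \<in> carrier M"
  shows "a \<odot>\<^bsub>M\<^esub> (b \<odot>\<^bsub>M\<^esub> x) = b \<odot>\<^bsub>M\<^esub> (a \<odot>\<^bsub>M\<^esub> x)"
  using assms by (metis R.m_comm smult_assoc1)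

lemma mod_hom_pointwise_add:
  assumes "Module.module R N" "f \<in> mod_hom R M N" "g \<in> mod_hom R M N"
  shows "(\<lambda>x. f x \<oplus>\<^bsub>N\<^esub> g x) \<in> mod_hom R M N"
proof -
  interpret N: Module.module R N by fact
  show ?thesis
    using assms(2,3) by (intro mod_homI) (auto simp: mod_hom_def Pi_def N.M.a_ac N.smult_r_distr)
qed

lemma mod_hom_pointwise_minus:
  assumes "Module.module R N" "f \<in> mod_hom R M N" "g \<in> mod_hom R M N"
  shows "(\<lambda>x. f x \<ominus>\<^bsub>N\<^esub> g x) \<in> mod_hom R M N"
proof -
  interpret N: Module.module R N by fact
  show ?thesis
    using assms(2,3)
    by (intro mod_homI) (auto simp: mod_hom_def Pi_def N.add_minus_add N.smult_minus)
qed

lemma mod_hom_pointwise_smult: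
  assumes "Module.module R N" "f \<in> mod_hom R M N" "a \<in> carrier R"
  shows "(\<lambda>x. a \<odot>\<^bsub>N\<^esub> f x) \<in> mod_hom R M N"
proof -
  interpret N: Module.module R N by fact
  show ?thesis
    using assms(2,3)
    by (intro mod_homI) (auto simp: mod_hom_def Pi_def N.smult_r_distr N.smult_commute)
qed

lemma mod_hom_const_zero:
  assumes "Module.module R N"
  shows "(\<lambda>x. \<zero>\<^bsub>N\<^esub>) \<in> mod_hom R M N"
proof -
  interpret N: Module.module R N by fact
  show ?thesis by (intro mod_homI) auto
qed

section \<open>Functionals and finite dual bases\<close>

definition module_of_ring :: "('a, 'c) ring_scheme \<Rightarrow> ('a, 'a) module" where
  "module_of_ring R = \<lparr>carrier = carrier R, mult = mult R, one = one R, zero = zero R, add = add R,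
     smult = mult R\<rparr>"

lemma module_of_ring_simps [simp]:
  "carrier (module_of_ring R) = carrier R" "\<zero>\<^bsub>module_of_ring R\<^esub> = \<zero>\<^bsub>R\<^esub>"
  "x \<oplus>\<^bsub>module_of_ring R\<^esub> y = x \<oplus>\<^bsub>R\<^esub> y" "x \<odot>\<^bsub>module_of_ring R\<^esub> y = x \<otimes>\<^bsub>R\<^esub> y"
  by (simp_all add: module_of_ring_def)

lemma module_of_ring: assumes "cring R" shows "Module.module R (module_of_ring R)"
proof -
  interpret cring R by fact
  show ?thesis
  proof (intro moduleI abelian_groupI assms)
    fix x assume "x \<in> carrier (module_of_ring R)"
    then show "\<exists>y\<in>carrier (module_of_ring R). y \<oplus>\<^bsub>module_of_ring R\<^esub> x = \<zero>\<^bsub>module_of_ring R\<^esub>"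
      by (intro bexI[of _ "\<ominus>\<^bsub>R\<^esub> x"]) (auto simp: l_neg)
  qed (auto simp: a_ac l_distr r_distr m_assoc)
qed

text \<open>The dual basis criterion for finitely generated projective modules. The
  \<open>b i\<close> may repeat and need not be independent; the functionals \<open>l i\<close>
  select one expansion of each element, linearly in that element.\<close>

definition dual_basis ::
    "('a, 'c) ring_scheme \<Rightarrow> ('a, 'm) module \<Rightarrow> nat \<Rightarrow> (nat \<Rightarrow> 'm) \<Rightarrow> (nat \<Rightarrow> 'm \<Rightarrow> 'a) \<Rightarrow> bool" where
  "dual_basis R P k b l \<longleftrightarrow> (\<forall>i<k. b i \<in> carrier P \<and> l i \<in> mod_hom R P (module_of_ring R)) \<and>
    (\<forall>x\<in>carrier P. x = (\<Oplus>\<^bsub>P\<^esub> i\<in>{..<k}. l i x \<odot>\<^bsub>P\<^esub> b i))"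

text \<open>Linearity comes from the functionals alone, so the values \<open>m i\<close> are
  arbitrary even if the \<open>b i\<close> satisfy relations. The resulting map need not send
  \<open>b i\<close> to \<open>m i\<close>.\<close>

lemma dual_basis_comb_hom:
  assumes N: "Module.module R N" and db: "dual_basis R P k b l" and m: "\<And>i. i < k \<Longrightarrow> m i \<in> carrier N"
  shows "(\<lambda>x. \<Oplus>\<^bsub>N\<^esub> i\<in>{..<k}. l i x \<odot>\<^bsub>N\<^esub> m i) \<in> mod_hom R P N"
proof -
  interpret N: Module.module R N by fact
  have l: "i < k \<Longrightarrow> l i \<in> mod_hom R P (module_of_ring R)" for i using db by (auto simp: dual_basis_def)
  have lc: "l i x \<in> carrier R" if "i < k" "x \<in> carrier P" for i x
    using mod_hom_closed[OF l that(2)] that by simp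
  have la: "l i (x \<oplus>\<^bsub>P\<^esub> y) = l i x \<oplus>\<^bsub>R\<^esub> l i y" if "i < k" "x \<in> carrier P" "y \<in> carrier P" for i x y
    using mod_hom_add[OF l that(2,3)] that by simp
  have ls: "l i (a \<odot>\<^bsub>P\<^esub> x) = a \<otimes>\<^bsub>R\<^esub> l i x" if "i < k" "x \<in> carrier P" "a \<in> carrier R" for i x a
    using mod_hom_smult[OF l that(3,2)] that by simp
  show ?thesis
  proof (rule mod_homI)
    fix x assume x: "x \<in> carrier P"
    then show "(\<Oplus>\<^bsub>N\<^esub> i\<in>{..<k}. l i x \<odot>\<^bsub>N\<^esub> m i) \<in> carrier N"
      using m lc by (intro N.finsum_closed) auto
    { fix y assume y: "y \<in> carrier P"
      have "(\<Oplus>\<^bsub>N\<^esub> i\<in>{..<k}. l i (x \<oplus>\<^bsub>P\<^esub> y) \<odot>\<^bsub>N\<^esub> m i)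
        = (\<Oplus>\<^bsub>N\<^esub> i\<in>{..<k}. l i x \<odot>\<^bsub>N\<^esub> m i \<oplus>\<^bsub>N\<^esub> l i y \<odot>\<^bsub>N\<^esub> m i)"
        using x y m lc by (intro N.finsum_cong') (auto simp: la N.smult_l_distr)
      also have "\<dots> = (\<Oplus>\<^bsub>N\<^esub> i\<in>{..<k}. l i x \<odot>\<^bsub>N\<^esub> m i) \<oplus>\<^bsub>N\<^esub> (\<Oplus>\<^bsub>N\<^esub> i\<in>{..<k}. l i y \<odot>\<^bsub>N\<^esub> m i)"
        using x y m lc by (intro N.finsum_addf) auto
      finally show "(\<Oplus>\<^bsub>N\<^esub> i\<in>{..<k}. l i (x \<oplus>\<^bsub>P\<^esub> y) \<odot>\<^bsub>N\<^esub> m i) = \<dots>" . }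
    { fix a assume a: "a \<in> carrier R"
      have "(\<Oplus>\<^bsub>N\<^esub> i\<in>{..<k}. l i (a \<odot>\<^bsub>P\<^esub> x) \<odot>\<^bsub>N\<^esub> m i)
        = (\<Oplus>\<^bsub>N\<^esub> i\<in>{..<k}. a \<odot>\<^bsub>N\<^esub> (l i x \<odot>\<^bsub>N\<^esub> m i))"
        using x a m lc by (intro N.finsum_cong') (auto simp: ls N.smult_assoc1)
      also have "\<dots> = a \<odot>\<^bsub>N\<^esub> (\<Oplus>\<^bsub>N\<^esub> i\<in>{..<k}. l i x \<odot>\<^bsub>N\<^esub> m i)"
        using x a m lc by (intro N.finsum_smult_ldistr[symmetric]) auto
      finally show "(\<Oplus>\<^bsub>N\<^esub> i\<in>{..<k}. l i (a \<odot>\<^bsub>P\<^esub> x) \<odot>\<^bsub>N\<^esub> m i) = \<dots>" . }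
  qed
qed

lemma dual_basis_hom_eq:
  assumes P: "Module.module R P" and N: "Module.module R N" and db: "dual_basis R P k b l"
    and f: "f \<in> mod_hom R P N" and x: "x \<in> carrier P"
  shows "f x = (\<Oplus>\<^bsub>N\<^esub> i\<in>{..<k}. l i x \<odot>\<^bsub>N\<^esub> f (b i))"
proof -
  interpret P: Module.module R P by fact
  interpret N: Module.module R N by fact
  have b: "i < k \<Longrightarrow> b i \<in> carrier P" and lc: "i < k \<Longrightarrow> l i x \<in> carrier R" for i
    using db x by (auto simp: dual_basis_def mod_hom_def Pi_def)
  have "f x = f (\<Oplus>\<^bsub>P\<^esub> i\<in>{..<k}. l i x \<odot>\<^bsub>P\<^esub> b i)"
    using db x by (metis dual_basis_def)
  also have "\<dots> = (\<Oplus>\<^bsub>N\<^esub> i\<in>{..<k}. f (l i x \<odot>\<^bsub>P\<^esub> b i))"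
    using b lc by (intro mod_hom_finsum[OF P N f]) auto
  also have "\<dots> = (\<Oplus>\<^bsub>N\<^esub> i\<in>{..<k}. l i x \<odot>\<^bsub>N\<^esub> f (b i))"
    using b lc by (intro N.finsum_cong') (auto simp: mod_hom_smult[OF f] mod_hom_closed[OF f])
  finally show ?thesis .
qed

text \<open>Reduces an identity of homomorphisms to finitely many equations. This is what allows a
  single multiplier when the identity holds only up to elements of a multiplicative set.\<close>

lemma dual_basis_hom_ext:
  assumes "Module.module R P" "Module.module R N" "dual_basis R P k b l"
    "f \<in> mod_hom R P N" "g \<in> mod_hom R P N" "\<And>i. i < k \<Longrightarrow> f (b i) = g (b i)" "x \<in> carrier P"
  shows "f x = g x"
proof -
  interpret N: Module.module R N by fact
  have "(\<Oplus>\<^bsub>N\<^esub> i\<in>{..<k}. l i x \<odot>\<^bsub>N\<^esub> f (b i)) = (\<Oplus>\<^bsub>N\<^esub> i\<in>{..<k}. l i x \<odot>\<^bsub>N\<^esub> g (b i))"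
    using assms(3,5-) by (intro N.finsum_cong')
      (auto simp: dual_basis_def mod_hom_closed[OF assms(4)] mod_hom_def Pi_def)
  then show ?thesis using dual_basis_hom_eq[OF assms(1-3)] assms(4,5,7) by metis
qed

text \<open>It suffices to choose a preimage \<open>m i\<close> of each \<open>f (b i)\<close>. The
  combined map may differ from \<open>m i\<close> at \<open>b i\<close>, but applying
  \<open>g\<close> to it produces the expansion of \<open>f x\<close>.\<close>

lemma dual_basis_projective:
  fixes P :: "('a, 'm) module"
  assumes P: "Module.module R P" and db: "dual_basis R P k b l"
  shows "projective R P"
  unfolding projective_def
proof (intro allI impI, elim conjE)
  fix M :: "('a, 'm \<Rightarrow> 'a) module" and N :: "('a, 'm) module" and g f
  assume M: "Module.module R M" and N: "Module.module R N" and g: "g \<in> mod_hom R M N"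
    and s: "g ` carrier M = carrier N" and f: "f \<in> mod_hom R P N"
  have "\<forall>i. \<exists>m. i < k \<longrightarrow> m \<in> carrier M \<and> g m = f (b i)"
  proof (intro allI)
    fix i
    have "f (b i) \<in> g ` carrier M" if "i < k"
      using db that unfolding s dual_basis_def by (intro mod_hom_closed[OF f]) auto
    then show "\<exists>m. i < k \<longrightarrow> m \<in> carrier M \<and> g m = f (b i)" by force
  qed
  from choice[OF this] obtain m where m: "\<And>i. i < k \<Longrightarrow> m i \<in> carrier M" "\<And>i. i < k \<Longrightarrow> g (m i) = f (b i)"
    by blast
  interpret M: Module.module R M by fact
  interpret N: Module.module R N by fact
  show "\<exists>h\<in>mod_hom R P M. \<forall>x\<in>carrier P. g (h x) = f x"
  proof (rule bexI[OF _ dual_basis_comb_hom[OF M db m(1)]], intro ballI)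
    fix x assume x: "x \<in> carrier P"
    have lc: "i < k \<Longrightarrow> l i x \<in> carrier R" for i
      using db x by (auto simp: dual_basis_def mod_hom_def Pi_def)
    have "g (\<Oplus>\<^bsub>M\<^esub> i\<in>{..<k}. l i x \<odot>\<^bsub>M\<^esub> m i) = (\<Oplus>\<^bsub>N\<^esub> i\<in>{..<k}. g (l i x \<odot>\<^bsub>M\<^esub> m i))"
      using m lc by (intro mod_hom_finsum[OF M N g]) auto
    also have "\<dots> = (\<Oplus>\<^bsub>N\<^esub> i\<in>{..<k}. l i x \<odot>\<^bsub>N\<^esub> f (b i))"
      using m lc mod_hom_closed[OF f] db
      by (intro N.finsum_cong') (auto simp: mod_hom_smult[OF g] mod_hom_closed[OF f] dual_basis_def)
    also have "\<dots> = f x" using dual_basis_hom_eq[OF P N db f x] by simp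
    finally show "g (\<Oplus>\<^bsub>M\<^esub> i\<in>{..<k}. l i x \<odot>\<^bsub>M\<^esub> m i) = f x" .
  qed
qed

text \<open>An indexed counterpart of \<open>fin_gen\<close>. Repetitions are allowed, so generators
  can be mapped along a homomorphism or taken from a dual basis without any injectivity.\<close>

definition spans :: "('a, 'c) ring_scheme \<Rightarrow> ('a, 'm) module \<Rightarrow> nat \<Rightarrow> (nat \<Rightarrow> 'm) \<Rightarrow> bool" where
  "spans R M k b \<longleftrightarrow> (\<forall>i<k. b i \<in> carrier M) \<and>
    (\<forall>x\<in>carrier M. \<exists>c. (\<forall>i<k. c i \<in> carrier R) \<and> x = (\<Oplus>\<^bsub>M\<^esub> i\<in>{..<k}. c i \<odot>\<^bsub>M\<^esub> b i))"

lemma dual_basis_spans: "dual_basis R P k b l \<Longrightarrow> spans R P k b"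
  unfolding dual_basis_def spans_def
  by (intro conjI ballI) (force, rule exI, auto simp: mod_hom_def Pi_def)

lemma fin_gen_spans:
  assumes "Module.module R M" "fin_gen R M"
  shows "\<exists>k b. spans R M k b"
proof -
  interpret M: Module.module R M by fact
  obtain A where A: "finite A" "A \<subseteq> carrier M"
    "\<And>x. x \<in> carrier M \<Longrightarrow> \<exists>c \<in> A \<rightarrow> carrier R. x = (\<Oplus>\<^bsub>M\<^esub> v\<in>A. c v \<odot>\<^bsub>M\<^esub> v)"
    using assms(2) unfolding fin_gen_def by blast
  obtain b where b: "bij_betw b {..<card A} A" using ex_bij_betw_nat_finite[OF A(1)] by (metis atLeast0LessThan)
  have "\<exists>c. (\<forall>i<card A. c i \<in> carrier R) \<and> x = (\<Oplus>\<^bsub>M\<^esub> i\<in>{..<card A}. c i \<odot>\<^bsub>M\<^esub> b i)"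
    if x: "x \<in> carrier M" for x
  proof -
    obtain c where c: "c \<in> A \<rightarrow> carrier R" "x = (\<Oplus>\<^bsub>M\<^esub> v\<in>A. c v \<odot>\<^bsub>M\<^esub> v)" using A(3)[OF x] by blast
    have bA: "b ` {..<card A} = A" "inj_on b {..<card A}" using b by (auto simp: bij_betw_def)
    have "(\<Oplus>\<^bsub>M\<^esub> v\<in>b ` {..<card A}. c v \<odot>\<^bsub>M\<^esub> v) = (\<Oplus>\<^bsub>M\<^esub> i\<in>{..<card A}. c (b i) \<odot>\<^bsub>M\<^esub> b i)"
      using A c bA by (intro M.M.finsum_reindex) auto
    then have "x = (\<Oplus>\<^bsub>M\<^esub> i\<in>{..<card A}. c (b i) \<odot>\<^bsub>M\<^esub> b i)" using bA c by simp
    moreover have "\<forall>i<card A. c (b i) \<in> carrier R" using c(1) bA by auto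
    ultimately show ?thesis by (intro exI[of _ "\<lambda>i. c (b i)"]) auto
  qed
  moreover have "\<forall>i<card A. b i \<in> carrier M" using b A(2) by (auto simp: bij_betw_def)
  ultimately show ?thesis unfolding spans_def by blast
qed

text \<open>\<open>fin_gen\<close> sums over a set, so the coefficients of equal \<open>b i\<close>
  have to be merged. The sum runs over the whole image from the start, and the induction on
  \<open>j\<close> feeds in one indexed term at a time.\<close>

lemma spans_fin_gen:
  assumes M: "Module.module R M" and "spans R M k b"
  shows "fin_gen R M"
  unfolding fin_gen_def
proof (intro exI[of _ "b ` {..<k}"] conjI ballI)
  interpret M: Module.module R M by fact
  let ?A = "b ` {..<k}"
  have bA: "?A \<subseteq> carrier M" and bc: "\<And>i. i < k \<Longrightarrow> b i \<in> carrier M" and sp: "\<And>x. x \<in> carrier M \<Longrightarrow>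
    \<exists>c. (\<forall>i<k. c i \<in> carrier R) \<and> x = (\<Oplus>\<^bsub>M\<^esub> i\<in>{..<k}. c i \<odot>\<^bsub>M\<^esub> b i)"
    using assms(2) by (auto simp: spans_def)
  show "finite ?A" by simp
  show "?A \<subseteq> carrier M" by fact
  have *: "\<exists>c \<in> ?A \<rightarrow> carrier R. (\<Oplus>\<^bsub>M\<^esub> i\<in>{..<j}. c' i \<odot>\<^bsub>M\<^esub> b i) = (\<Oplus>\<^bsub>M\<^esub> v\<in>?A. c v \<odot>\<^bsub>M\<^esub> v)"
    if "j \<le> k" "\<forall>i<k. c' i \<in> carrier R" for j c'
    using that(1)
  proof (induction j)
    case 0
    have "(\<Oplus>\<^bsub>M\<^esub> v\<in>?A. \<zero>\<^bsub>R\<^esub> \<odot>\<^bsub>M\<^esub> v) = (\<Oplus>\<^bsub>M\<^esub> v\<in>?A. \<zero>\<^bsub>M\<^esub>)" using bA by (intro M.finsum_cong') auto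
    then show ?case by (intro bexI[of _ "\<lambda>_. \<zero>\<^bsub>R\<^esub>"]) auto
  next
    case (Suc j)
    then obtain c where c: "c \<in> ?A \<rightarrow> carrier R"
      "(\<Oplus>\<^bsub>M\<^esub> i\<in>{..<j}. c' i \<odot>\<^bsub>M\<^esub> b i) = (\<Oplus>\<^bsub>M\<^esub> v\<in>?A. c v \<odot>\<^bsub>M\<^esub> v)" by auto
    have j: "c' j \<in> carrier R" "b j \<in> carrier M" "b j \<in> ?A" using Suc that bA by auto
    \<comment> \<open>Adding \<open>?d\<close> raises the coefficient at \<open>b j\<close> by
      \<open>c' j\<close>, whether or not the same generator has occurred before.\<close>
    let ?d = "\<lambda>v. if v = b j then c' j else \<zero>\<^bsub>R\<^esub>"
    have "(\<Oplus>\<^bsub>M\<^esub> v\<in>?A. (c v \<oplus>\<^bsub>R\<^esub> ?d v) \<odot>\<^bsub>M\<^esub> v) = (\<Oplus>\<^bsub>M\<^esub> v\<in>?A. c v \<odot>\<^bsub>M\<^esub> v \<oplus>\<^bsub>M\<^esub> ?d v \<odot>\<^bsub>M\<^esub> v)"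
      using bA j c(1) by (intro M.finsum_cong') (auto simp: M.smult_l_distr Pi_def)
    also have "\<dots> = (\<Oplus>\<^bsub>M\<^esub> v\<in>?A. c v \<odot>\<^bsub>M\<^esub> v) \<oplus>\<^bsub>M\<^esub> (\<Oplus>\<^bsub>M\<^esub> v\<in>?A. ?d v \<odot>\<^bsub>M\<^esub> v)"
      using bA j c(1) by (intro M.finsum_addf) (auto simp: Pi_def)
    also have "(\<Oplus>\<^bsub>M\<^esub> v\<in>?A. ?d v \<odot>\<^bsub>M\<^esub> v) = (\<Oplus>\<^bsub>M\<^esub> v\<in>{b j}. ?d v \<odot>\<^bsub>M\<^esub> v)"
      using bA j by (intro M.M.add.finprod_mono_neutral_cong_right) auto
    also have "\<dots> = c' j \<odot>\<^bsub>M\<^esub> b j" using j by simp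
    also have "(\<Oplus>\<^bsub>M\<^esub> v\<in>?A. c v \<odot>\<^bsub>M\<^esub> v) \<oplus>\<^bsub>M\<^esub> c' j \<odot>\<^bsub>M\<^esub> b j = (\<Oplus>\<^bsub>M\<^esub> i\<in>{..<Suc j}. c' i \<odot>\<^bsub>M\<^esub> b i)"
    proof -
      have "(\<Oplus>\<^bsub>M\<^esub> i\<in>{..<Suc j}. c' i \<odot>\<^bsub>M\<^esub> b i) = c' j \<odot>\<^bsub>M\<^esub> b j \<oplus>\<^bsub>M\<^esub> (\<Oplus>\<^bsub>M\<^esub> i\<in>{..<j}. c' i \<odot>\<^bsub>M\<^esub> b i)"
        unfolding lessThan_Suc using bc Suc.prems that(2) by (intro M.M.finsum_insert) auto
      moreover have "(\<Oplus>\<^bsub>M\<^esub> i\<in>{..<j}. c' i \<odot>\<^bsub>M\<^esub> b i) \<in> carrier M"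
        using bc Suc.prems that(2) by (intro M.finsum_closed) auto
      ultimately show ?thesis using c(2) j by (simp add: M.M.a_comm)
    qed
    finally have e: "(\<Oplus>\<^bsub>M\<^esub> v\<in>?A. (c v \<oplus>\<^bsub>R\<^esub> ?d v) \<odot>\<^bsub>M\<^esub> v) = (\<Oplus>\<^bsub>M\<^esub> i\<in>{..<Suc j}. c' i \<odot>\<^bsub>M\<^esub> b i)" .
    have "(\<lambda>v. c v \<oplus>\<^bsub>R\<^esub> ?d v) \<in> ?A \<rightarrow> carrier R" using c(1) j by (auto simp: Pi_def)
    then show ?case by (rule bexI[rotated]) (rule e[symmetric])
  qed
  show "\<exists>c\<in>?A \<rightarrow> carrier R. x = (\<Oplus>\<^bsub>M\<^esub> v\<in>?A. c v \<odot>\<^bsub>M\<^esub> v)" if "x \<in> carrier M" for x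
    using sp[OF that] *[of k] by auto
qed

text \<open>The surjection from the free module on \<open>k\<close> letters splits, and the
  coordinates of the section are the functionals.\<close>

lemma fin_gen_projective_dual_basis:
  assumes P: "Module.module R P" and fg: "fin_gen R P" and pr: "projective R P"
  shows "\<exists>k b l. dual_basis R P k b l"
proof -
  interpret P: Module.module R P by fact
  obtain k b where kb: "spans R P k b" using fin_gen_spans[OF P fg] by blast
  have bP: "i < k \<Longrightarrow> b i \<in> carrier P" for i using kb by (auto simp: spans_def)
  let ?F = "free_module R {..<k}" and ?p = "lincomb R P b"
  have F: "Module.module R ?F" by (rule free_module) (rule P.R.is_cring)
  have p: "?p \<in> mod_hom R ?F P" using bP by (intro lincomb_hom[OF P]) auto
  have pc: "?p \<phi> = (\<Oplus>\<^bsub>P\<^esub> i\<in>{..<k}. \<phi> i \<odot>\<^bsub>P\<^esub> b i)" if "\<phi> \<in> carrier ?F" for \<phi>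
    using that bP by (intro lincomb_superset[OF P that]) (auto simp: free_module_def)
  have "?p ` carrier ?F = carrier P"
  proof (intro subset_antisym subsetI)
    fix x assume "x \<in> carrier P"
    then obtain c where c: "\<forall>i<k. c i \<in> carrier R" "x = (\<Oplus>\<^bsub>P\<^esub> i\<in>{..<k}. c i \<odot>\<^bsub>P\<^esub> b i)"
      using kb unfolding spans_def by blast
    \<comment> \<open>Members of \<open>free_module\<close> vanish outside the index set, hence the
      default zero.\<close>
    let ?c = "\<lambda>i. if i < k then c i else \<zero>\<^bsub>R\<^esub>"
    have cF: "?c \<in> carrier ?F" using c by (auto simp: free_module_def intro: finite_subset[of _ "{..<k}"])
    have "?p ?c = x" unfolding pc[OF cF] c(2) using bP c by (intro P.finsum_cong') auto
    then show "x \<in> ?p ` carrier ?F" using cF by blast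
  qed (auto simp: mod_hom_closed[OF p])
  from projective_lift[OF P pr F P p this mod_hom_id]
  obtain s where s: "s \<in> mod_hom R P ?F" "\<And>x. x \<in> carrier P \<Longrightarrow> ?p (s x) = x" by blast
  have "dual_basis R P k b (\<lambda>i x. s x i)"
    unfolding dual_basis_def
  proof (intro conjI allI impI ballI bP)
    fix i show "(\<lambda>x. s x i) \<in> mod_hom R P (module_of_ring R)"
      using s(1) by (intro mod_homI) (auto simp: mod_hom_def free_module_def Pi_def)
  next
    fix x assume "x \<in> carrier P"
    then show "x = (\<Oplus>\<^bsub>P\<^esub> i\<in>{..<k}. s x i \<odot>\<^bsub>P\<^esub> b i)"
      using pc[OF mod_hom_closed[OF s(1)], of x] s(2)[of x] by simp
  qed
  then show ?thesis by blast
qed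

text \<open>Generators are pushed forward and functionals pulled back. Used for isomorphic copies
  and for the direct summand that remains when a resolution is shortened.\<close>

lemma dual_basis_retract:
  assumes P: "Module.module R P" and P': "Module.module R P'" and db: "dual_basis R P k b l"
    and r: "r \<in> mod_hom R P P'" and i: "i \<in> mod_hom R P' P"
    and ri: "\<And>x. x \<in> carrier P' \<Longrightarrow> r (i x) = x"
  shows "dual_basis R P' k (\<lambda>j. r (b j)) (\<lambda>j x. l j (i x))"
  unfolding dual_basis_def
proof (intro conjI allI impI ballI)
  fix j assume j: "j < k"
  show "r (b j) \<in> carrier P'" using db j mod_hom_closed[OF r] by (auto simp: dual_basis_def)
  show "(\<lambda>x. l j (i x)) \<in> mod_hom R P' (module_of_ring R)"
    using db j by (intro mod_hom_comp[OF i]) (auto simp: dual_basis_def)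
next
  fix x assume x: "x \<in> carrier P'"
  show "x = (\<Oplus>\<^bsub>P'\<^esub> j\<in>{..<k}. l j (i x) \<odot>\<^bsub>P'\<^esub> r (b j))"
    using dual_basis_hom_eq[OF P P' db r mod_hom_closed[OF i x]] ri[OF x] by simp
qed

lemma spans_image:
  assumes P: "Module.module R P" and P': "Module.module R P'" and sp: "spans R P k b"
    and r: "r \<in> mod_hom R P P'" "r ` carrier P = carrier P'"
  shows "spans R P' k (\<lambda>j. r (b j))"
  unfolding spans_def
proof (intro conjI allI impI ballI)
  interpret P: Module.module R P by fact
  interpret P': Module.module R P' by fact
  have b: "j < k \<Longrightarrow> b j \<in> carrier P" for j using sp by (auto simp: spans_def)
  then show "j < k \<Longrightarrow> r (b j) \<in> carrier P'" for j using mod_hom_closed[OF r(1)] by auto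
  fix x assume "x \<in> carrier P'"
  then obtain y where y: "y \<in> carrier P" "x = r y" using r(2) by blast
  then obtain c where c: "\<forall>i<k. c i \<in> carrier R" "y = (\<Oplus>\<^bsub>P\<^esub> i\<in>{..<k}. c i \<odot>\<^bsub>P\<^esub> b i)"
    using sp unfolding spans_def by blast
  have "x = (\<Oplus>\<^bsub>P'\<^esub> i\<in>{..<k}. r (c i \<odot>\<^bsub>P\<^esub> b i))"
    unfolding y(2) c(2) using b c by (intro mod_hom_finsum[OF P P' r(1)]) auto
  also have "\<dots> = (\<Oplus>\<^bsub>P'\<^esub> i\<in>{..<k}. c i \<odot>\<^bsub>P'\<^esub> r (b i))"
    using b c by (intro P'.finsum_cong') (auto simp: mod_hom_smult[OF r(1)] mod_hom_closed[OF r(1)])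
  finally show "\<exists>c. (\<forall>i<k. c i \<in> carrier R) \<and> x = (\<Oplus>\<^bsub>P'\<^esub> i\<in>{..<k}. c i \<odot>\<^bsub>P'\<^esub> r (b i))"
    using c by blast
qed

section \<open>Comparing two resolutions\<close>

lemma kernel_module:
  assumes M: "Module.module R M" and N: "Module.module R N" and f: "f \<in> mod_hom R M N"
  shows "Module.module R (M\<lparr>carrier := a_kernel M N f\<rparr>)"
proof -
  interpret M: Module.module R M by fact
  interpret N: Module.module R N by fact
  have z: "f \<zero>\<^bsub>M\<^esub> = \<zero>\<^bsub>N\<^esub>" by (rule mod_hom_zero[OF M N f])
  show ?thesis
  proof (intro moduleI abelian_groupI)
    show "cring R" by (rule M.R.is_cring)
    fix x assume x: "x \<in> carrier (M\<lparr>carrier := a_kernel M N f\<rparr>)"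
    then have *: "x \<in> carrier M" "f x = \<zero>\<^bsub>N\<^esub>" by (auto simp: a_kernel_def')
    have "f (\<zero>\<^bsub>M\<^esub> \<ominus>\<^bsub>M\<^esub> x) = \<zero>\<^bsub>N\<^esub>" using mod_hom_minus[OF M N f _ *(1), of "\<zero>\<^bsub>M\<^esub>"] * z
      by (simp add: N.M.minus_eq)
    then show "\<exists>y\<in>carrier (M\<lparr>carrier := a_kernel M N f\<rparr>).
        y \<oplus>\<^bsub>M\<lparr>carrier := a_kernel M N f\<rparr>\<^esub> x = \<zero>\<^bsub>M\<lparr>carrier := a_kernel M N f\<rparr>\<^esub>"
      using * by (intro bexI[of _ "\<ominus>\<^bsub>M\<^esub> x"]) (auto simp: a_kernel_def' M.M.l_neg M.M.minus_eq)
  qed (auto simp: a_kernel_def' z mod_hom_add[OF f] mod_hom_smult[OF f] M.M.a_ac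
      M.smult_l_distr M.smult_r_distr M.smult_assoc1)
qed

lemma mem_syzygy_0: "x \<in> syzygy P d e M 0 \<longleftrightarrow> x \<in> carrier (P 0) \<and> e x = \<zero>\<^bsub>M\<^esub>"
  by (auto simp: syzygy_def a_kernel_def')

lemma mem_syzygy_Suc:
  "x \<in> syzygy P d e M (Suc i) \<longleftrightarrow> x \<in> carrier (P (Suc i)) \<and> d i x = \<zero>\<^bsub>P i\<^esub>"
  by (auto simp: syzygy_def a_kernel_def')

lemma syzygy_subset: "syzygy P d e M i \<subseteq> carrier (P i)"
  by (cases i) (auto simp: mem_syzygy_0 mem_syzygy_Suc)

context
  fixes R :: "('a, 'c) ring_scheme" and n P d e M
  assumes M: "Module.module R M" and res: "resolution R n P d e M"
begin

lemma resolution_module: "i \<le> n \<Longrightarrow> Module.module R (P i)"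
  using res by (auto simp: resolution_def)

lemma resolution_e_hom: "e \<in> mod_hom R (P 0) M"
  using res by (auto simp: resolution_def)

lemma resolution_e_surj: "e ` carrier (P 0) = carrier M"
  using res by (auto simp: resolution_def)

lemma resolution_hom: "i < n \<Longrightarrow> d i \<in> mod_hom R (P (Suc i)) (P i)"
  using res by (auto simp: resolution_def)

lemma resolution_image: "i < n \<Longrightarrow> d i ` carrier (P (Suc i)) = syzygy P d e M i"
  using res by (auto simp: resolution_def)

lemma resolution_mem: "i < n \<Longrightarrow> x \<in> carrier (P (Suc i)) \<Longrightarrow> d i x \<in> syzygy P d e M i"
  using resolution_image by blast

lemma resolution_last: "syzygy P d e M n = {\<zero>\<^bsub>P n\<^esub>}"
  using res by (auto simp: resolution_def)

lemma syzygy_module: "i \<le> n \<Longrightarrow> Module.module R ((P i)\<lparr>carrier := syzygy P d e M i\<rparr>)"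
  unfolding syzygy_def
  using kernel_module[OF resolution_module M resolution_e_hom]
    kernel_module[OF resolution_module resolution_module resolution_hom]
  by (cases i) auto

text \<open>By exactness \<open>d i\<close> is surjective onto \<open>?B\<close>, which is
  \<open>P i\<close> with its carrier cut down to the syzygy. Projectivity is applied to this
  surjection, as \<open>d i\<close> need not be onto \<open>P i\<close>.\<close>

lemma lift_through_syzygy:
  assumes i: "i < n" and F: "Module.module R F" "projective R F" and f: "f \<in> mod_hom R F (P i)"
    and fz: "\<And>x. x \<in> carrier F \<Longrightarrow> f x \<in> syzygy P d e M i"
  shows "\<exists>h\<in>mod_hom R F (P (Suc i)). \<forall>x\<in>carrier F. d i (h x) = f x"
proof (rule projective_lift[OF F])
  let ?B = "(P i)\<lparr>carrier := syzygy P d e M i\<rparr>"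
  show "Module.module R (P (Suc i))" using i by (intro resolution_module) auto
  show "Module.module R ?B" using i by (intro syzygy_module) auto
  show "d i \<in> mod_hom R (P (Suc i)) ?B"
    using resolution_hom[OF i] resolution_mem[OF i] by (auto simp: mod_hom_def)
  show "d i ` carrier (P (Suc i)) = carrier ?B" using resolution_image[OF i] by simp
  show "f \<in> mod_hom R F ?B" using f fz by (auto simp: mod_hom_def)
qed

end

text \<open>Comparison maps \<open>a\<close>, \<open>b\<close> between the two resolutions and a homotopy \<open>h\<close> from \<open>b \<circ> a\<close> to the
  identity are built degree by degree. Only the restriction of the homotopy relation to the
  syzygies enters the step from degree \<open>i\<close> to \<open>Suc i\<close>, so the homotopy of the preceding degree
  can be forgotten. Past the end of the shorter resolution \<open>a\<close> vanishes on syzygies.\<close>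

lemma resolution_last_map_split:
  fixes P :: "nat \<Rightarrow> ('a, 'p) module" and Q :: "nat \<Rightarrow> ('a, 'q) module"
  assumes M: "Module.module R M"
    and P: "resolution R N P d e M" "\<And>i. i \<le> N \<Longrightarrow> projective R (P i)"
    and Q: "resolution R n Q d' e' M" "\<And>i. i \<le> n \<Longrightarrow> projective R (Q i)"
    and nN: "n < N"
  shows "\<exists>h\<in>mod_hom R (P (N - 1)) (P N). \<forall>x\<in>carrier (P N). h (d (N - 1) x) = x"
proof -
  let ?Z = "syzygy P d e M" and ?Y = "syzygy Q d' e' M"
  note Pm = resolution_module[OF M P(1)] and Qm = resolution_module[OF M Q(1)]
  note dh = resolution_hom[OF M P(1)] and dh' = resolution_hom[OF M Q(1)]
  have Zc: "x \<in> ?Z i \<Longrightarrow> x \<in> carrier (P i)" and Yc: "y \<in> ?Y i \<Longrightarrow> y \<in> carrier (Q i)" for x y i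
    by (auto intro: subsetD[OF syzygy_subset])
  interpret M: Module.module R M by fact
  have inv: "\<exists>a\<in>mod_hom R (P i) (Q i). \<exists>b\<in>mod_hom R (Q i) (P i). \<exists>h\<in>mod_hom R (P i) (P (Suc i)).
      (\<forall>x\<in>?Z i. a x \<in> ?Y i) \<and> (\<forall>y\<in>?Y i. b y \<in> ?Z i) \<and> (\<forall>x\<in>?Z i. x = b (a x) \<oplus>\<^bsub>P i\<^esub> d i (h x))"
    if "i \<le> n" for i
    using that
  proof (induction i)
    case 0
    note eP = resolution_e_hom[OF M P(1)] resolution_e_surj[OF M P(1)]
    note eQ = resolution_e_hom[OF M Q(1)] resolution_e_surj[OF M Q(1)]
    have P0: "Module.module R (P 0)" and Q0: "Module.module R (Q 0)" using Pm Qm by auto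
    interpret P0: Module.module R "P 0" by fact
    obtain a where a: "a \<in> mod_hom R (P 0) (Q 0)" "\<And>x. x \<in> carrier (P 0) \<Longrightarrow> e' (a x) = e x"
      using projective_lift[OF P0 P(2) Q0 M eQ eP(1)] by auto
    obtain b where b: "b \<in> mod_hom R (Q 0) (P 0)" "\<And>x. x \<in> carrier (Q 0) \<Longrightarrow> e (b x) = e' x"
      using projective_lift[OF Q0 Q(2) P0 M eP eQ(1)] by auto
    note ac = mod_hom_closed[OF a(1)] and bc = mod_hom_closed[OF b(1)]
    have f: "(\<lambda>x. x \<ominus>\<^bsub>P 0\<^esub> b (a x)) \<in> mod_hom R (P 0) (P 0)"
      by (intro mod_hom_pointwise_minus[OF P0] mod_hom_id mod_hom_comp[OF a(1) b(1)])
    have fz: "x \<ominus>\<^bsub>P 0\<^esub> b (a x) \<in> ?Z 0" if x: "x \<in> carrier (P 0)" for x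
      using x ac bc mod_hom_minus[OF P0 M eP(1), of x "b (a x)"]
      by (auto simp: mem_syzygy_0 a b M.M.minus_eq M.M.r_neg mod_hom_closed[OF eP(1)])
    obtain h where h: "h \<in> mod_hom R (P 0) (P (Suc 0))"
      "\<And>x. x \<in> carrier (P 0) \<Longrightarrow> d 0 (h x) = x \<ominus>\<^bsub>P 0\<^esub> b (a x)"
      using lift_through_syzygy[OF M P(1) _ P0 P(2) f fz] nN by auto
    have "x = b (a x) \<oplus>\<^bsub>P 0\<^esub> d 0 (h x)" if x: "x \<in> carrier (P 0)" for x
      using P0.minus_eq_iff[of x "b (a x)" "d 0 (h x)"] h(2)[OF x] x ac bc fz[OF x]
      by (metis P0.M.a_comm Zc)
    then show ?case using a b h ac bc by (intro bexI[OF _ a(1)] bexI[OF _ b(1)] bexI[OF _ h(1)])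
      (auto simp: mem_syzygy_0)
  next
    case (Suc i)
    then obtain a b h where a: "a \<in> mod_hom R (P i) (Q i)" "\<And>x. x \<in> ?Z i \<Longrightarrow> a x \<in> ?Y i"
      and b: "b \<in> mod_hom R (Q i) (P i)" "\<And>x. x \<in> ?Y i \<Longrightarrow> b x \<in> ?Z i"
      and h: "h \<in> mod_hom R (P i) (P (Suc i))" "\<And>x. x \<in> ?Z i \<Longrightarrow> x = b (a x) \<oplus>\<^bsub>P i\<^esub> d i (h x)" by auto
    \<comment> \<open>\<open>Suc i \<le> n < N\<close> leaves room for the module
      \<open>P (Suc (Suc i))\<close>, into which the new homotopy maps.\<close>
    have i: "i < n" "i < N" "Suc i < N" "Suc i \<le> N" "i \<le> N" using Suc.prems nN by auto
    have P0: "Module.module R (P i)" and P1: "Module.module R (P (Suc i))"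
      and Q0: "Module.module R (Q i)" and Q1: "Module.module R (Q (Suc i))" using Pm Qm i by auto
    interpret P0: Module.module R "P i" by fact
    interpret P1: Module.module R "P (Suc i)" by fact
    note dP = dh[OF i(2)] and dQ = dh'[OF i(1)]
    note dZ = resolution_mem[OF M P(1) i(2)] and dY = resolution_mem[OF M Q(1) i(1)]
    have "\<exists>a'\<in>mod_hom R (P (Suc i)) (Q (Suc i)). \<forall>x\<in>carrier (P (Suc i)). d' i (a' x) = a (d i x)"
      by (rule lift_through_syzygy[OF M Q(1) i(1) P1 P(2)[OF i(4)] mod_hom_comp[OF dP a(1)] a(2)[OF dZ]])
    then obtain a' where a': "a' \<in> mod_hom R (P (Suc i)) (Q (Suc i))"
      "\<And>x. x \<in> carrier (P (Suc i)) \<Longrightarrow> d' i (a' x) = a (d i x)" by auto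
    have "\<exists>b'\<in>mod_hom R (Q (Suc i)) (P (Suc i)). \<forall>x\<in>carrier (Q (Suc i)). d i (b' x) = b (d' i x)"
      by (rule lift_through_syzygy[OF M P(1) i(2) Q1 Q(2)[OF Suc.prems] mod_hom_comp[OF dQ b(1)] b(2)[OF dY]])
    then obtain b' where b': "b' \<in> mod_hom R (Q (Suc i)) (P (Suc i))"
      "\<And>x. x \<in> carrier (Q (Suc i)) \<Longrightarrow> d i (b' x) = b (d' i x)" by auto
    note ac = mod_hom_closed[OF a'(1)] and bc = mod_hom_closed[OF b'(1)]
    note hdc = mod_hom_closed[OF h(1) mod_hom_closed[OF dP]]
    \<comment> \<open>The part of the identity not accounted for by \<open>b' \<circ> a'\<close> and
      the old homotopy. It lies in the syzygy because the relation in degree \<open>i\<close>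
      applies to \<open>d i x\<close>.\<close>
    let ?f = "\<lambda>x. (x \<ominus>\<^bsub>P (Suc i)\<^esub> b' (a' x)) \<ominus>\<^bsub>P (Suc i)\<^esub> h (d i x)"
    have f: "?f \<in> mod_hom R (P (Suc i)) (P (Suc i))"
      by (intro mod_hom_pointwise_minus[OF P1] mod_hom_id mod_hom_comp[OF a'(1) b'(1)] mod_hom_comp[OF dP h(1)])
    have fz: "?f x \<in> ?Z (Suc i)" if x: "x \<in> carrier (P (Suc i))" for x
    proof -
      have c: "d i x \<in> carrier (P i)" "b (a (d i x)) \<in> carrier (P i)" "d i (h (d i x)) \<in> carrier (P i)"
        using x hdc[OF x] mod_hom_closed[OF dP] mod_hom_closed[OF a(1)] mod_hom_closed[OF b(1)] by auto
      have "d i (?f x) = (d i x \<ominus>\<^bsub>P i\<^esub> d i (b' (a' x))) \<ominus>\<^bsub>P i\<^esub> d i (h (d i x))"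
        using x ac bc hdc by (simp add: mod_hom_minus[OF P1 P0 dP])
      also have "d i (b' (a' x)) = b (a (d i x))" using x ac by (simp add: a' b')
      also have "d i x \<ominus>\<^bsub>P i\<^esub> b (a (d i x)) = d i (h (d i x))"
        using P0.minus_eq_iff[OF c] h(2)[OF dZ[OF x]] c P0.M.a_comm by metis
      finally have "d i (?f x) = \<zero>\<^bsub>P i\<^esub>" using c by (simp add: P0.M.minus_eq P0.M.r_neg)
      then show ?thesis using mod_hom_closed[OF f x] by (simp add: mem_syzygy_Suc)
    qed
    obtain h' where h': "h' \<in> mod_hom R (P (Suc i)) (P (Suc (Suc i)))"
      "\<And>x. x \<in> carrier (P (Suc i)) \<Longrightarrow> d (Suc i) (h' x) = ?f x"
      using lift_through_syzygy[OF M P(1) i(3) P1 P(2)[OF i(4)] f fz] by auto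
    have hz: "h \<zero>\<^bsub>P i\<^esub> = \<zero>\<^bsub>P (Suc i)\<^esub>" by (rule mod_hom_zero[OF P0 P1 h(1)])
    have "x = b' (a' x) \<oplus>\<^bsub>P (Suc i)\<^esub> d (Suc i) (h' x)" if "x \<in> ?Z (Suc i)" for x
    proof -
      have x: "x \<in> carrier (P (Suc i))" "d i x = \<zero>\<^bsub>P i\<^esub>" using that by (auto simp: mem_syzygy_Suc)
      \<comment> \<open>On a syzygy \<open>d i x\<close> is zero, so the contribution of
        \<open>h\<close> drops out and the relation regains the form it had in degree
        \<open>i\<close>.\<close>
      have "d (Suc i) (h' x) = x \<ominus>\<^bsub>P (Suc i)\<^esub> b' (a' x)"
        using h'(2)[OF x(1)] x ac bc hz by (simp add: P1.M.minus_eq)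
      then show ?thesis using P1.minus_eq_iff[of x "b' (a' x)" "d (Suc i) (h' x)"] x ac bc P1.M.a_comm
        by (metis P1.M.minus_closed)
    qed
    moreover have "a' x \<in> ?Y (Suc i)" if "x \<in> ?Z (Suc i)" for x
      using that ac mod_hom_zero[OF P0 Q0 a(1)] by (auto simp: mem_syzygy_Suc a')
    moreover have "b' x \<in> ?Z (Suc i)" if "x \<in> ?Y (Suc i)" for x
      using that bc mod_hom_zero[OF Q0 P0 b(1)] by (auto simp: mem_syzygy_Suc b')
    ultimately show ?case by (intro bexI[OF _ a'(1)] bexI[OF _ b'(1)] bexI[OF _ h'(1)]) blast
  qed
  have inv': "\<exists>h\<in>mod_hom R (P i) (P (Suc i)). \<forall>x\<in>?Z i. x = d i (h x)" if "n \<le> i" "i < N" for i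
    using that
  proof (induction i rule: dec_induct)
    case base
    obtain a b h where a: "\<And>x. x \<in> ?Z n \<Longrightarrow> a x \<in> ?Y n"
      and b: "b \<in> mod_hom R (Q n) (P n)"
      and h: "h \<in> mod_hom R (P n) (P (Suc n))" "\<And>x. x \<in> ?Z n \<Longrightarrow> x = b (a x) \<oplus>\<^bsub>P n\<^esub> d n (h x)"
      using inv[OF order_refl] by blast
    have Pn: "Module.module R (P n)" and Qn: "Module.module R (Q n)" using Pm Qm nN by auto
    interpret Pn: Module.module R "P n" by fact
    have "x = d n (h x)" if x: "x \<in> ?Z n" for x
    proof -
      have "b (a x) = \<zero>\<^bsub>P n\<^esub>"
        using a[OF x] mod_hom_zero[OF Qn Pn b] by (simp add: resolution_last[OF M Q(1)])
      then show ?thesis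
        using h(2)[OF x] mod_hom_closed[OF dh[OF nN] mod_hom_closed[OF h(1) Zc[OF x]]] by simp
    qed
    then show ?case using h(1) by blast
  next
    case (step i)
    then obtain h where h: "h \<in> mod_hom R (P i) (P (Suc i))" "\<And>x. x \<in> ?Z i \<Longrightarrow> x = d i (h x)" by auto
    have i: "i < N" "Suc i < N" "Suc i \<le> N" "i \<le> N" using step.prems by auto
    have P0: "Module.module R (P i)" and P1: "Module.module R (P (Suc i))" using Pm i by auto
    interpret P0: Module.module R "P i" by fact
    interpret P1: Module.module R "P (Suc i)" by fact
    note dP = dh[OF i(1)] and dZ = resolution_mem[OF M P(1) i(1)]
    \<comment> \<open>The previous correction with zero in place of \<open>b' \<circ> a'\<close>,
      since beyond degree \<open>n\<close> there is nothing to pass through.\<close>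
    let ?f = "\<lambda>x. x \<ominus>\<^bsub>P (Suc i)\<^esub> h (d i x)"
    note hdc = mod_hom_closed[OF h(1) mod_hom_closed[OF dP]]
    have f: "?f \<in> mod_hom R (P (Suc i)) (P (Suc i))"
      by (intro mod_hom_pointwise_minus[OF P1] mod_hom_id mod_hom_comp[OF dP h(1)])
    have fz: "?f x \<in> ?Z (Suc i)" if x: "x \<in> carrier (P (Suc i))" for x
      using mod_hom_minus[OF P1 P0 dP x hdc[OF x]] h(2)[OF dZ[OF x]] mod_hom_closed[OF f x]
        mod_hom_closed[OF dP x] by (simp add: mem_syzygy_Suc P0.M.minus_eq P0.M.r_neg)
    obtain h' where h': "h' \<in> mod_hom R (P (Suc i)) (P (Suc (Suc i)))"
      "\<And>x. x \<in> carrier (P (Suc i)) \<Longrightarrow> d (Suc i) (h' x) = ?f x"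
      using lift_through_syzygy[OF M P(1) i(2) P1 P(2)[OF i(3)] f fz] by auto
    have "x = d (Suc i) (h' x)" if "x \<in> ?Z (Suc i)" for x
      using that h'(2)[of x] mod_hom_zero[OF P0 P1 h(1)] by (auto simp: mem_syzygy_Suc P1.M.minus_eq)
    then show ?case using h'(1) by blast
  qed
  define j where "j = N - 1"
  have j: "n \<le> j" "j < N" "N = Suc j" using nN by (auto simp: j_def)
  obtain h where h: "h \<in> mod_hom R (P j) (P N)" "\<And>x. x \<in> ?Z j \<Longrightarrow> x = d j (h x)"
    using inv'[OF j(1,2)] j(3) by auto
  have P0: "Module.module R (P j)" and P1: "Module.module R (P N)" using Pm j by auto
  interpret P0: Module.module R "P j" by fact
  interpret P1: Module.module R "P N" by fact
  have dP: "d j \<in> mod_hom R (P N) (P j)" using dh[OF j(2)] j(3) by simp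
  have "h (d j x) = x" if x: "x \<in> carrier (P N)" for x
  proof -
    have hd: "h (d j x) \<in> carrier (P N)" using mod_hom_closed[OF h(1) mod_hom_closed[OF dP x]] .
    \<comment> \<open>The relation on syzygies gives the desired identity after applying
      \<open>d j\<close>; exactness at \<open>P N\<close> makes \<open>d j\<close> injective, so it
      can be cancelled.\<close>
    have "d j x = d j (h (d j x))" using h(2)[of "d j x"] resolution_mem[OF M P(1) j(2)] x j(3) by simp
    then have "d j (h (d j x) \<ominus>\<^bsub>P N\<^esub> x) = \<zero>\<^bsub>P j\<^esub>"
      using mod_hom_minus[OF P1 P0 dP hd x] mod_hom_closed[OF dP x]
      by (simp add: P0.M.minus_eq P0.M.r_neg)
    then have "h (d j x) \<ominus>\<^bsub>P N\<^esub> x = \<zero>\<^bsub>P N\<^esub>"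
      using resolution_last[OF M P(1)] P1.M.minus_closed[OF hd x] j(3) mem_syzygy_Suc[of _ P d e M j]
      by auto
    then show ?thesis using P1.minus_eq_iff[of "h (d j x)" x "\<zero>\<^bsub>P N\<^esub>"] hd x by simp
  qed
  then show ?thesis using h(1) unfolding j_def by blast
qed

section \<open>Localization of modules\<close>

text \<open>Equality of fractions is stated without subtraction, so a homomorphism respects it
  simply by being applied to both sides. The factor \<open>u\<close> keeps the relation transitive
  when elements of \<open>S\<close> annihilate nonzero elements of \<open>M\<close>.\<close>

definition mfrac_rel :: "('a, 'c) ring_scheme \<Rightarrow> 'a set \<Rightarrow> ('a, 'm) module \<Rightarrow> (('m \<times> 'a) \<times> ('m \<times> 'a)) set"
  where "mfrac_rel R S M =
    {((x, s), (y, t)). x \<in> carrier M \<and> y \<in> carrier M \<and> s \<in> S \<and> t \<in> S \<and>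
       (\<exists>u\<in>S. u \<odot>\<^bsub>M\<^esub> (t \<odot>\<^bsub>M\<^esub> x) = u \<odot>\<^bsub>M\<^esub> (s \<odot>\<^bsub>M\<^esub> y))}"

definition mfraction :: "('a, 'c) ring_scheme \<Rightarrow> 'a set \<Rightarrow> ('a, 'm) module \<Rightarrow> 'm \<Rightarrow> 'a \<Rightarrow> ('m \<times> 'a) set"
  where "mfraction R S M x s = mfrac_rel R S M `` {(x, s)}"

text \<open>The scalars are classes too, since this is a module over
  \<open>localization R S\<close>. Each union is a union of equal classes, which
  \<open>mfrac_cong2_add\<close> and \<open>mfrac_cong2_smult\<close> justify.\<close>

definition loc_module ::
    "('a, 'c) ring_scheme \<Rightarrow> 'a set \<Rightarrow> ('a, 'm) module \<Rightarrow> (('a \<times> 'a) set, ('m \<times> 'a) set) module"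
  where "loc_module R S M =
    \<lparr>carrier = (carrier M \<times> S) // mfrac_rel R S M, mult = undefined, one = undefined,
     zero = mfraction R S M \<zero>\<^bsub>M\<^esub> \<one>\<^bsub>R\<^esub>,
     add = \<lambda>X Y. \<Union>(x, s)\<in>X. \<Union>(y, t)\<in>Y.
       mfraction R S M (t \<odot>\<^bsub>M\<^esub> x \<oplus>\<^bsub>M\<^esub> s \<odot>\<^bsub>M\<^esub> y) (s \<otimes>\<^bsub>R\<^esub> t),
     smult = \<lambda>A X. \<Union>(a, s)\<in>A. \<Union>(x, t)\<in>X. mfraction R S M (a \<odot>\<^bsub>M\<^esub> x) (s \<otimes>\<^bsub>R\<^esub> t)\<rparr>"

text \<open>Only the target is an argument: the source enters through the representatives contained
  in \<open>X\<close>.\<close>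

definition loc_map ::
    "('a, 'c) ring_scheme \<Rightarrow> 'a set \<Rightarrow> ('a, 'n) module \<Rightarrow> ('m \<Rightarrow> 'n) \<Rightarrow> ('m \<times> 'a) set \<Rightarrow> ('n \<times> 'a) set"
  where "loc_map R S N f X = (\<Union>(x, s)\<in>X. mfraction R S N (f x) s)"

locale mult_set = cring R for R :: "('a, 'c) ring_scheme" (structure) +
  fixes S :: "'a set"
  assumes S_sub: "S \<subseteq> carrier R" and S_one [simp, intro]: "\<one> \<in> S"
    and S_mult [simp, intro]: "s \<in> S \<Longrightarrow> t \<in> S \<Longrightarrow> s \<otimes> t \<in> S"
begin

abbreviation L where "L \<equiv> localization R S"
abbreviation frac where "frac \<equiv> fraction R S"
abbreviation LM :: "('a, 'm) module \<Rightarrow> (('a \<times> 'a) set, ('m \<times> 'a) set) module"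
  where "LM \<equiv> loc_module R S"
abbreviation mfrac :: "('a, 'm) module \<Rightarrow> 'm \<Rightarrow> 'a \<Rightarrow> ('m \<times> 'a) set" where "mfrac \<equiv> mfraction R S"

lemma S_carrier [simp, intro]: "s \<in> S \<Longrightarrow> s \<in> carrier R"
  using S_sub by auto

lemma eq_iff_minus_zero: "x \<in> carrier R \<Longrightarrow> y \<in> carrier R \<Longrightarrow> x \<ominus> y = \<zero> \<longleftrightarrow> x = y"
  using minus_equality[of x "\<ominus> y"] by (auto simp: minus_eq r_neg)

lemma frac_equiv: "equiv (carrier R \<times> S) (frac_rel R S)"
  by (rule frac_rel_equiv) auto

lemma cring_L: "cring L"
  by (rule localization_cring) auto

lemma L_carrier: "carrier L = {frac a s | a s. a \<in> carrier R \<and> s \<in> S}"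
  by (auto simp: localization_def fraction_def quotient_def)

text \<open>Trades the difference in \<open>frac_rel\<close> for an equation of products. In this
  form equalities of fractions follow by multiplying through and rearranging factors, exactly as for
  \<open>mfrac_rel\<close>.\<close>

lemma frac_eq_iff:
  assumes "a \<in> carrier R" "b \<in> carrier R" "s \<in> S" "t \<in> S"
  shows "frac a s = frac b t \<longleftrightarrow> (\<exists>u\<in>S. u \<otimes> (t \<otimes> a) = u \<otimes> (s \<otimes> b))"
proof -
  have "u \<otimes> (a \<otimes> t \<ominus> b \<otimes> s) = \<zero> \<longleftrightarrow> u \<otimes> (t \<otimes> a) = u \<otimes> (s \<otimes> b)" if "u \<in> S" for u
  proof -
    have "u \<otimes> (a \<otimes> t \<ominus> b \<otimes> s) = u \<otimes> (t \<otimes> a) \<ominus> u \<otimes> (s \<otimes> b)"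
      using assms that by (simp add: minus_eq r_distr r_minus m_ac)
    then show ?thesis using assms that eq_iff_minus_zero by simp
  qed
  moreover have "frac a s = frac b t \<longleftrightarrow> ((a, s), (b, t)) \<in> frac_rel R S"
    unfolding fraction_def using assms by (intro eq_equiv_class_iff[OF frac_equiv]) auto
  ultimately show ?thesis using assms by (auto simp: frac_rel_def)
qed

lemma frac_cong2_mult: "congruent2 (frac_rel R S) (frac_rel R S)
    (\<lambda>p q. case p of (a,s) \<Rightarrow> case q of (b,t) \<Rightarrow> frac (a \<otimes> b) (s \<otimes> t))"
proof (rule congruent2_commuteI[OF frac_equiv])
  fix w y z assume 2: "w \<in> carrier R \<times> S" "(y, z) \<in> frac_rel R S"
  obtain a s b t c v where d: "w = (a,s)" "y = (b,t)" "z = (c,v)" by (metis prod.exhaust)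
  have c: "a \<in> carrier R" "b \<in> carrier R" "c \<in> carrier R" "s \<in> S" "t \<in> S" "v \<in> S"
    using 2 d by (auto simp: frac_rel_def)
  have "frac b t = frac c v"
    unfolding fraction_def using 2 d by (intro equiv_class_eq[OF frac_equiv]) auto
  then obtain u where u: "u \<in> S" "u \<otimes> (v \<otimes> b) = u \<otimes> (t \<otimes> c)" using c by (auto simp: frac_eq_iff)
  have "(a \<otimes> s) \<otimes> (u \<otimes> (v \<otimes> b)) = (a \<otimes> s) \<otimes> (u \<otimes> (t \<otimes> c))" using u(2) by simp
  then have "u \<otimes> ((s \<otimes> v) \<otimes> (a \<otimes> b)) = u \<otimes> ((s \<otimes> t) \<otimes> (a \<otimes> c))" using c u(1) by (simp add: m_ac)
  then show "(case w of (a,s) \<Rightarrow> case y of (b,t) \<Rightarrow> frac (a \<otimes> b) (s \<otimes> t))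
    = (case w of (a,s) \<Rightarrow> case z of (b,t) \<Rightarrow> frac (a \<otimes> b) (s \<otimes> t))"
    unfolding d prod.case using c u(1) by (subst frac_eq_iff) auto
qed (auto simp: m_comm)

lemma frac_cong2_add: "congruent2 (frac_rel R S) (frac_rel R S)
    (\<lambda>p q. case p of (a,s) \<Rightarrow> case q of (b,t) \<Rightarrow> frac (a \<otimes> t \<oplus> b \<otimes> s) (s \<otimes> t))"
proof (rule congruent2_commuteI[OF frac_equiv])
  fix w y z assume 2: "w \<in> carrier R \<times> S" "(y, z) \<in> frac_rel R S"
  obtain a s b t c v where d: "w = (a,s)" "y = (b,t)" "z = (c,v)" by (metis prod.exhaust)
  have c: "a \<in> carrier R" "b \<in> carrier R" "c \<in> carrier R" "s \<in> S" "t \<in> S" "v \<in> S"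
    using 2 d by (auto simp: frac_rel_def)
  have "frac b t = frac c v"
    unfolding fraction_def using 2 d by (intro equiv_class_eq[OF frac_equiv]) auto
  then obtain u where u: "u \<in> S" "u \<otimes> (v \<otimes> b) = u \<otimes> (t \<otimes> c)" using c by (auto simp: frac_eq_iff)
  have "(s \<otimes> s) \<otimes> (u \<otimes> (v \<otimes> b)) = (s \<otimes> s) \<otimes> (u \<otimes> (t \<otimes> c))" using u(2) by simp
  then have "u \<otimes> ((s \<otimes> v) \<otimes> (a \<otimes> t \<oplus> b \<otimes> s)) = u \<otimes> ((s \<otimes> t) \<otimes> (a \<otimes> v \<oplus> c \<otimes> s))"
    using c u(1) by (simp add: m_ac r_distr)
  then show "(case w of (a,s) \<Rightarrow> case y of (b,t) \<Rightarrow> frac (a \<otimes> t \<oplus> b \<otimes> s) (s \<otimes> t))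
    = (case w of (a,s) \<Rightarrow> case z of (b,t) \<Rightarrow> frac (a \<otimes> t \<oplus> b \<otimes> s) (s \<otimes> t))"
    unfolding d prod.case using c u(1) by (subst frac_eq_iff) auto
qed (auto simp: m_comm a_comm)

lemma frac_mult:
  assumes "a \<in> carrier R" "b \<in> carrier R" "s \<in> S" "t \<in> S"
  shows "frac a s \<otimes>\<^bsub>L\<^esub> frac b t = frac (a \<otimes> b) (s \<otimes> t)"
  using UN_equiv_class2[OF frac_equiv frac_equiv frac_cong2_mult, of "(a,s)" "(b,t)"] assms
  by (simp add: localization_def fraction_def case_prod_unfold)

lemma frac_add:
  assumes "a \<in> carrier R" "b \<in> carrier R" "s \<in> S" "t \<in> S"
  shows "frac a s \<oplus>\<^bsub>L\<^esub> frac b t = frac (a \<otimes> t \<oplus> b \<otimes> s) (s \<otimes> t)"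
  using UN_equiv_class2[OF frac_equiv frac_equiv frac_cong2_add, of "(a,s)" "(b,t)"] assms
  by (simp add: localization_def fraction_def case_prod_unfold)

lemma L_one: "\<one>\<^bsub>L\<^esub> = frac \<one> \<one>"
  by (simp add: localization_def)

lemma frac_closed [simp, intro]: "a \<in> carrier R \<Longrightarrow> s \<in> S \<Longrightarrow> frac a s \<in> carrier L"
  by (auto simp: L_carrier)

lemma L_cases:
  assumes "A \<in> carrier L"
  obtains a s where "A = frac a s" "a \<in> carrier R" "s \<in> S"
  using assms by (auto simp: L_carrier)

end

locale mult_set_module = mult_set R S + Module.module R M
  for R :: "('a, 'c) ring_scheme" (structure) and S and M :: "('a, 'm) module"
begin

lemma mfrac_equiv: "equiv (carrier M \<times> S) (mfrac_rel R S M)"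
proof (intro equivI)
  show "refl_on (carrier M \<times> S) (mfrac_rel R S M)"
    by (auto simp: refl_on_def mfrac_rel_def)
  show "sym (mfrac_rel R S M)"
    by (rule symI) (auto simp: mfrac_rel_def intro: sym)
  show "trans (mfrac_rel R S M)"
  proof (rule transI, clarify)
    fix x s y t z v assume "((x,s),(y,t)) \<in> mfrac_rel R S M" "((y,t),(z,v)) \<in> mfrac_rel R S M"
    then obtain u w where c: "x \<in> carrier M" "y \<in> carrier M" "z \<in> carrier M" "s \<in> S" "t \<in> S" "v \<in> S" "u \<in> S" "w \<in> S"
      and e: "u \<odot>\<^bsub>M\<^esub> (t \<odot>\<^bsub>M\<^esub> x) = u \<odot>\<^bsub>M\<^esub> (s \<odot>\<^bsub>M\<^esub> y)" "w \<odot>\<^bsub>M\<^esub> (v \<odot>\<^bsub>M\<^esub> y) = w \<odot>\<^bsub>M\<^esub> (t \<odot>\<^bsub>M\<^esub> z)"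
      by (auto simp: mfrac_rel_def)
    have "(w \<otimes> v) \<odot>\<^bsub>M\<^esub> (u \<odot>\<^bsub>M\<^esub> (t \<odot>\<^bsub>M\<^esub> x)) = (w \<otimes> v) \<odot>\<^bsub>M\<^esub> (u \<odot>\<^bsub>M\<^esub> (s \<odot>\<^bsub>M\<^esub> y))" using e by simp
    also have "\<dots> = (u \<otimes> s) \<odot>\<^bsub>M\<^esub> (w \<odot>\<^bsub>M\<^esub> (v \<odot>\<^bsub>M\<^esub> y))" using c by (simp add: smult_assoc1[symmetric] m_ac)
    also have "\<dots> = (u \<otimes> s) \<odot>\<^bsub>M\<^esub> (w \<odot>\<^bsub>M\<^esub> (t \<odot>\<^bsub>M\<^esub> z))" using e by simp
    finally have "(u \<otimes> w \<otimes> t) \<odot>\<^bsub>M\<^esub> (v \<odot>\<^bsub>M\<^esub> x) = (u \<otimes> w \<otimes> t) \<odot>\<^bsub>M\<^esub> (s \<odot>\<^bsub>M\<^esub> z)"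
      using c by (simp add: smult_assoc1[symmetric] m_ac)
    then show "((x,s),(z,v)) \<in> mfrac_rel R S M" using c unfolding mfrac_rel_def by blast
  qed
qed (auto simp: mfrac_rel_def)

lemma mfrac_eq_iff:
  assumes "x \<in> carrier M" "y \<in> carrier M" "s \<in> S" "t \<in> S"
  shows "mfrac M x s = mfrac M y t \<longleftrightarrow> (\<exists>u\<in>S. u \<odot>\<^bsub>M\<^esub> (t \<odot>\<^bsub>M\<^esub> x) = u \<odot>\<^bsub>M\<^esub> (s \<odot>\<^bsub>M\<^esub> y))"
proof -
  have "mfrac M x s = mfrac M y t \<longleftrightarrow> ((x, s), (y, t)) \<in> mfrac_rel R S M"
    unfolding mfraction_def using assms by (intro eq_equiv_class_iff[OF mfrac_equiv]) auto
  then show ?thesis using assms by (auto simp: mfrac_rel_def)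
qed

lemma mfrac_expand:
  assumes "x \<in> carrier M" "s \<in> S" "t \<in> S"
  shows "mfrac M (t \<odot>\<^bsub>M\<^esub> x) (t \<otimes> s) = mfrac M x s"
  using assms by (subst mfrac_eq_iff) (auto simp: smult_assoc1[symmetric] m_ac intro: bexI[of _ \<one>])

lemma LM_carrier: "carrier (LM M) = {mfrac M x s | x s. x \<in> carrier M \<and> s \<in> S}"
  by (auto simp: loc_module_def mfraction_def quotient_def)

lemma LM_zero: "\<zero>\<^bsub>LM M\<^esub> = mfrac M \<zero>\<^bsub>M\<^esub> \<one>"
  by (simp add: loc_module_def)

lemma mfrac_closed [simp, intro]: "x \<in> carrier M \<Longrightarrow> s \<in> S \<Longrightarrow> mfrac M x s \<in> carrier (LM M)"
  by (auto simp: LM_carrier)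

lemma LM_cases:
  assumes "X \<in> carrier (LM M)"
  obtains x s where "X = mfrac M x s" "x \<in> carrier M" "s \<in> S"
  using assms by (auto simp: LM_carrier)

lemma mfrac_cong2_add: "congruent2 (mfrac_rel R S M) (mfrac_rel R S M)
    (\<lambda>p q. case p of (x,s) \<Rightarrow> case q of (y,t) \<Rightarrow> mfrac M (t \<odot>\<^bsub>M\<^esub> x \<oplus>\<^bsub>M\<^esub> s \<odot>\<^bsub>M\<^esub> y) (s \<otimes> t))"
proof (rule congruent2_commuteI[OF mfrac_equiv])
  fix w y z assume 2: "w \<in> carrier M \<times> S" "(y, z) \<in> mfrac_rel R S M"
  obtain a s b t c v where d: "w = (a,s)" "y = (b,t)" "z = (c,v)" by (metis prod.exhaust)
  obtain u where c: "a \<in> carrier M" "b \<in> carrier M" "c \<in> carrier M" "s \<in> S" "t \<in> S" "v \<in> S"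
    and u: "u \<in> S" "u \<odot>\<^bsub>M\<^esub> (v \<odot>\<^bsub>M\<^esub> b) = u \<odot>\<^bsub>M\<^esub> (t \<odot>\<^bsub>M\<^esub> c)"
    using 2 d by (auto simp: mfrac_rel_def)
  have "(s \<otimes> s) \<odot>\<^bsub>M\<^esub> (u \<odot>\<^bsub>M\<^esub> (v \<odot>\<^bsub>M\<^esub> b)) = (s \<otimes> s) \<odot>\<^bsub>M\<^esub> (u \<odot>\<^bsub>M\<^esub> (t \<odot>\<^bsub>M\<^esub> c))" using u(2) by simp
  then have "u \<odot>\<^bsub>M\<^esub> ((s \<otimes> v) \<odot>\<^bsub>M\<^esub> (t \<odot>\<^bsub>M\<^esub> a \<oplus>\<^bsub>M\<^esub> s \<odot>\<^bsub>M\<^esub> b))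
    = u \<odot>\<^bsub>M\<^esub> ((s \<otimes> t) \<odot>\<^bsub>M\<^esub> (v \<odot>\<^bsub>M\<^esub> a \<oplus>\<^bsub>M\<^esub> s \<odot>\<^bsub>M\<^esub> c))"
    using c u(1) by (simp add: m_ac smult_r_distr smult_assoc1[symmetric])
  then show "(case w of (x,s) \<Rightarrow> case y of (y,t) \<Rightarrow> mfrac M (t \<odot>\<^bsub>M\<^esub> x \<oplus>\<^bsub>M\<^esub> s \<odot>\<^bsub>M\<^esub> y) (s \<otimes> t))
    = (case w of (x,s) \<Rightarrow> case z of (y,t) \<Rightarrow> mfrac M (t \<odot>\<^bsub>M\<^esub> x \<oplus>\<^bsub>M\<^esub> s \<odot>\<^bsub>M\<^esub> y) (s \<otimes> t))"
    unfolding d prod.case using c u(1) by (subst mfrac_eq_iff) auto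
qed (auto simp: m_comm M.a_comm)

lemma mfrac_cong2_smult: "congruent2 (frac_rel R S) (mfrac_rel R S M)
    (\<lambda>p q. case p of (a,s) \<Rightarrow> case q of (x,t) \<Rightarrow> mfrac M (a \<odot>\<^bsub>M\<^esub> x) (s \<otimes> t))"
proof (rule congruent2I[OF frac_equiv mfrac_equiv])
  fix y z w assume 2: "(y, z) \<in> frac_rel R S" "w \<in> carrier M \<times> S"
  obtain x s b t c v where d: "w = (x,s)" "y = (b,t)" "z = (c,v)" by (metis prod.exhaust)
  have c: "x \<in> carrier M" "b \<in> carrier R" "c \<in> carrier R" "s \<in> S" "t \<in> S" "v \<in> S"
    using 2 d by (auto simp: frac_rel_def)
  have "frac b t = frac c v"
    unfolding fraction_def using 2 d by (intro equiv_class_eq[OF frac_equiv]) auto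
  then obtain u where u: "u \<in> S" "u \<otimes> (v \<otimes> b) = u \<otimes> (t \<otimes> c)" using c by (auto simp: frac_eq_iff)
  have "(u \<otimes> (v \<otimes> b)) \<odot>\<^bsub>M\<^esub> (s \<odot>\<^bsub>M\<^esub> x) = (u \<otimes> (t \<otimes> c)) \<odot>\<^bsub>M\<^esub> (s \<odot>\<^bsub>M\<^esub> x)" using u(2) by simp
  then have "u \<odot>\<^bsub>M\<^esub> ((v \<otimes> s) \<odot>\<^bsub>M\<^esub> (b \<odot>\<^bsub>M\<^esub> x)) = u \<odot>\<^bsub>M\<^esub> ((t \<otimes> s) \<odot>\<^bsub>M\<^esub> (c \<odot>\<^bsub>M\<^esub> x))"
    using c u(1) by (simp add: m_ac smult_assoc1[symmetric])
  then show "(case y of (a,s) \<Rightarrow> case w of (x,t) \<Rightarrow> mfrac M (a \<odot>\<^bsub>M\<^esub> x) (s \<otimes> t))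
    = (case z of (a,s) \<Rightarrow> case w of (x,t) \<Rightarrow> mfrac M (a \<odot>\<^bsub>M\<^esub> x) (s \<otimes> t))"
    unfolding d prod.case using c u(1) by (subst mfrac_eq_iff) auto
next
  fix y z w assume 2: "(y, z) \<in> mfrac_rel R S M" "w \<in> carrier R \<times> S"
  obtain a s b t c v where d: "w = (a,s)" "y = (b,t)" "z = (c,v)" by (metis prod.exhaust)
  obtain u where c: "a \<in> carrier R" "b \<in> carrier M" "c \<in> carrier M" "s \<in> S" "t \<in> S" "v \<in> S"
    and u: "u \<in> S" "u \<odot>\<^bsub>M\<^esub> (v \<odot>\<^bsub>M\<^esub> b) = u \<odot>\<^bsub>M\<^esub> (t \<odot>\<^bsub>M\<^esub> c)"
    using 2 d by (auto simp: mfrac_rel_def)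
  have "(s \<otimes> a) \<odot>\<^bsub>M\<^esub> (u \<odot>\<^bsub>M\<^esub> (v \<odot>\<^bsub>M\<^esub> b)) = (s \<otimes> a) \<odot>\<^bsub>M\<^esub> (u \<odot>\<^bsub>M\<^esub> (t \<odot>\<^bsub>M\<^esub> c))" using u(2) by simp
  then have "u \<odot>\<^bsub>M\<^esub> ((s \<otimes> v) \<odot>\<^bsub>M\<^esub> (a \<odot>\<^bsub>M\<^esub> b)) = u \<odot>\<^bsub>M\<^esub> ((s \<otimes> t) \<odot>\<^bsub>M\<^esub> (a \<odot>\<^bsub>M\<^esub> c))"
    using c u(1) by (simp add: m_ac smult_assoc1[symmetric])
  then show "(case w of (a,s) \<Rightarrow> case y of (x,t) \<Rightarrow> mfrac M (a \<odot>\<^bsub>M\<^esub> x) (s \<otimes> t))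
    = (case w of (a,s) \<Rightarrow> case z of (x,t) \<Rightarrow> mfrac M (a \<odot>\<^bsub>M\<^esub> x) (s \<otimes> t))"
    unfolding d prod.case using c u(1) by (subst mfrac_eq_iff) auto
qed

lemma mfrac_add:
  assumes "x \<in> carrier M" "y \<in> carrier M" "s \<in> S" "t \<in> S"
  shows "mfrac M x s \<oplus>\<^bsub>LM M\<^esub> mfrac M y t = mfrac M (t \<odot>\<^bsub>M\<^esub> x \<oplus>\<^bsub>M\<^esub> s \<odot>\<^bsub>M\<^esub> y) (s \<otimes> t)"
  using UN_equiv_class2[OF mfrac_equiv mfrac_equiv mfrac_cong2_add, of "(x,s)" "(y,t)"] assms
  by (simp add: loc_module_def mfraction_def case_prod_unfold)

lemma mfrac_smult:
  assumes "a \<in> carrier R" "x \<in> carrier M" "s \<in> S" "t \<in> S"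
  shows "frac a s \<odot>\<^bsub>LM M\<^esub> mfrac M x t = mfrac M (a \<odot>\<^bsub>M\<^esub> x) (s \<otimes> t)"
  using UN_equiv_class2[OF frac_equiv mfrac_equiv mfrac_cong2_smult, of "(a,s)" "(x,t)"] assms
  by (simp add: loc_module_def mfraction_def fraction_def case_prod_unfold)

lemma mfrac_eqI:
  assumes "x \<in> carrier M" "y \<in> carrier M" "s \<in> S" "t \<in> S" "t \<odot>\<^bsub>M\<^esub> x = s \<odot>\<^bsub>M\<^esub> y"
  shows "mfrac M x s = mfrac M y t"
  using assms by (subst mfrac_eq_iff) (auto intro: bexI[of _ \<one>])

lemma mfrac_add_same:
  assumes "x \<in> carrier M" "y \<in> carrier M" "s \<in> S"
  shows "mfrac M x s \<oplus>\<^bsub>LM M\<^esub> mfrac M y s = mfrac M (x \<oplus>\<^bsub>M\<^esub> y) s"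
  using assms mfrac_expand[of "x \<oplus>\<^bsub>M\<^esub> y" s s] by (simp add: mfrac_add smult_r_distr)

lemma mfrac_zero:
  assumes "s \<in> S" shows "mfrac M \<zero>\<^bsub>M\<^esub> s = \<zero>\<^bsub>LM M\<^esub>"
  unfolding LM_zero using assms by (intro mfrac_eqI) auto

lemma mfrac_eq_zero_iff:
  assumes "x \<in> carrier M" "s \<in> S"
  shows "mfrac M x s = \<zero>\<^bsub>LM M\<^esub> \<longleftrightarrow> (\<exists>u\<in>S. u \<odot>\<^bsub>M\<^esub> x = \<zero>\<^bsub>M\<^esub>)"
  unfolding LM_zero using assms by (subst mfrac_eq_iff) auto

lemma module_LM: "Module.module L (LM M)"
proof (intro moduleI abelian_groupI cring_L)
  fix X Y assume "X \<in> carrier (LM M)" "Y \<in> carrier (LM M)"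
  then obtain x s y t where X: "X = mfrac M x s" "x \<in> carrier M" "s \<in> S"
    and Y: "Y = mfrac M y t" "y \<in> carrier M" "t \<in> S" by (metis LM_cases)
  show "X \<oplus>\<^bsub>LM M\<^esub> Y \<in> carrier (LM M)" using X Y by (simp add: mfrac_add)
  show "X \<oplus>\<^bsub>LM M\<^esub> Y = Y \<oplus>\<^bsub>LM M\<^esub> X" using X Y by (simp add: mfrac_add M.a_comm m_comm)
  show "\<zero>\<^bsub>LM M\<^esub> \<oplus>\<^bsub>LM M\<^esub> X = X" using X by (simp add: mfrac_add LM_zero)
  have "mfrac M (\<ominus>\<^bsub>M\<^esub> x) s \<oplus>\<^bsub>LM M\<^esub> X = \<zero>\<^bsub>LM M\<^esub>"
    using X by (simp add: mfrac_add_same M.l_neg mfrac_zero)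
  then show "\<exists>Y\<in>carrier (LM M). Y \<oplus>\<^bsub>LM M\<^esub> X = \<zero>\<^bsub>LM M\<^esub>" using X by blast
  show "\<one>\<^bsub>L\<^esub> \<odot>\<^bsub>LM M\<^esub> X = X" using X by (simp add: L_one mfrac_smult)
  { fix Z assume "Z \<in> carrier (LM M)"
    then obtain z v where Z: "Z = mfrac M z v" "z \<in> carrier M" "v \<in> S" by (metis LM_cases)
    show "X \<oplus>\<^bsub>LM M\<^esub> Y \<oplus>\<^bsub>LM M\<^esub> Z = X \<oplus>\<^bsub>LM M\<^esub> (Y \<oplus>\<^bsub>LM M\<^esub> Z)"
      using X Y Z by (simp add: mfrac_add smult_r_distr smult_assoc1[symmetric] m_ac M.a_ac) }
  fix A assume "A \<in> carrier L"
  then obtain a p where A: "A = frac a p" "a \<in> carrier R" "p \<in> S" by (metis L_cases)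
  show "A \<odot>\<^bsub>LM M\<^esub> X \<in> carrier (LM M)" using A X by (simp add: mfrac_smult)
  show "A \<odot>\<^bsub>LM M\<^esub> (X \<oplus>\<^bsub>LM M\<^esub> Y) = A \<odot>\<^bsub>LM M\<^esub> X \<oplus>\<^bsub>LM M\<^esub> A \<odot>\<^bsub>LM M\<^esub> Y"
    unfolding A X Y using A(2-) X(2-) Y(2-)
    by (simp add: mfrac_add mfrac_smult)
      (intro mfrac_eqI, auto simp: smult_r_distr smult_assoc1[symmetric] m_ac)
  fix B assume "B \<in> carrier L"
  then obtain b q where B: "B = frac b q" "b \<in> carrier R" "q \<in> S" by (metis L_cases)
  show "(A \<oplus>\<^bsub>L\<^esub> B) \<odot>\<^bsub>LM M\<^esub> X = A \<odot>\<^bsub>LM M\<^esub> X \<oplus>\<^bsub>LM M\<^esub> B \<odot>\<^bsub>LM M\<^esub> X"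
    unfolding A X B using A(2-) X(2-) B(2-)
    by (simp add: mfrac_add mfrac_smult frac_add)
      (intro mfrac_eqI, auto simp: smult_l_distr smult_r_distr smult_assoc1[symmetric] m_ac r_distr)
  show "(A \<otimes>\<^bsub>L\<^esub> B) \<odot>\<^bsub>LM M\<^esub> X = A \<odot>\<^bsub>LM M\<^esub> (B \<odot>\<^bsub>LM M\<^esub> X)"
    using A X B by (simp add: mfrac_smult frac_mult smult_assoc1 m_assoc)
qed (simp add: LM_zero mfrac_closed)

lemma mfrac_finsum:
  assumes "finite I" "g \<in> I \<rightarrow> carrier M" "t \<in> S"
  shows "mfrac M (\<Oplus>\<^bsub>M\<^esub> i\<in>I. g i) t = (\<Oplus>\<^bsub>LM M\<^esub> i\<in>I. mfrac M (g i) t)"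
proof -
  interpret LM: Module.module L "LM M" by (rule module_LM)
  show ?thesis using assms(1,2)
  proof (induction I rule: finite_induct)
    case empty
    then show ?case using assms(3) by (simp add: mfrac_zero)
  next
    case (insert i I)
    then show ?case using assms(3) by (subst M.finsum_insert) (auto simp: Pi_def mfrac_add_same[symmetric])
  qed
qed

end

section \<open>Localized homomorphisms, exactness and dual bases\<close>

context mult_set
begin

lemma mult_set_moduleI: "Module.module R M \<Longrightarrow> mult_set_module R S M"
  unfolding mult_set_module_def using mult_set_axioms by blast

lemma loc_map_mfrac:
  assumes M: "Module.module R M" and N: "Module.module R N" and f: "f \<in> mod_hom R M N"
    and x: "x \<in> carrier M" "s \<in> S"
  shows "loc_map R S N f (mfrac M x s) = mfrac N (f x) s"
proof -
  interpret M: mult_set_module R S M by (rule mult_set_moduleI[OF M])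
  interpret N: mult_set_module R S N by (rule mult_set_moduleI[OF N])
  note fc = mod_hom_closed[OF f]
  have "congruent (mfrac_rel R S M) (\<lambda>p. case p of (x, s) \<Rightarrow> mfrac N (f x) s)"
  proof (rule congruentI, clarify)
    fix x s y t assume "((x, s), (y, t)) \<in> mfrac_rel R S M"
    then obtain u where c: "x \<in> carrier M" "y \<in> carrier M" "s \<in> S" "t \<in> S" "u \<in> S"
      and u: "u \<odot>\<^bsub>M\<^esub> (t \<odot>\<^bsub>M\<^esub> x) = u \<odot>\<^bsub>M\<^esub> (s \<odot>\<^bsub>M\<^esub> y)" by (auto simp: mfrac_rel_def)
    have "f (u \<odot>\<^bsub>M\<^esub> (t \<odot>\<^bsub>M\<^esub> x)) = f (u \<odot>\<^bsub>M\<^esub> (s \<odot>\<^bsub>M\<^esub> y))" using u by simp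
    then have "u \<odot>\<^bsub>N\<^esub> (t \<odot>\<^bsub>N\<^esub> f x) = u \<odot>\<^bsub>N\<^esub> (s \<odot>\<^bsub>N\<^esub> f y)" using c by (simp add: mod_hom_smult[OF f])
    then show "mfrac N (f x) s = mfrac N (f y) t" using c fc by (subst N.mfrac_eq_iff) auto
  qed
  from UN_equiv_class[OF M.mfrac_equiv this, of "(x, s)"] x show ?thesis
    by (simp add: loc_map_def mfraction_def)
qed

lemma loc_map_hom:
  assumes M: "Module.module R M" and N: "Module.module R N" and f: "f \<in> mod_hom R M N"
  shows "loc_map R S N f \<in> mod_hom L (LM M) (LM N)"
proof -
  interpret M: mult_set_module R S M by (rule mult_set_moduleI[OF M])
  interpret N: mult_set_module R S N by (rule mult_set_moduleI[OF N])
  note fc = mod_hom_closed[OF f] and lf = loc_map_mfrac[OF M N f]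
  show ?thesis
  proof (rule mod_homI)
    fix X assume "X \<in> carrier (LM M)"
    then obtain x s where X: "X = mfrac M x s" "x \<in> carrier M" "s \<in> S" by (metis M.LM_cases)
    show "loc_map R S N f X \<in> carrier (LM N)" using X fc by (simp add: lf)
    { fix Y assume "Y \<in> carrier (LM M)"
      then obtain y t where Y: "Y = mfrac M y t" "y \<in> carrier M" "t \<in> S" by (metis M.LM_cases)
      show "loc_map R S N f (X \<oplus>\<^bsub>LM M\<^esub> Y) = loc_map R S N f X \<oplus>\<^bsub>LM N\<^esub> loc_map R S N f Y"
        using X Y fc by (simp add: lf M.mfrac_add N.mfrac_add mod_hom_add[OF f] mod_hom_smult[OF f]) }
    fix A assume "A \<in> carrier L"
    then obtain a p where A: "A = frac a p" "a \<in> carrier R" "p \<in> S" by (metis L_cases)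
    show "loc_map R S N f (A \<odot>\<^bsub>LM M\<^esub> X) = A \<odot>\<^bsub>LM N\<^esub> loc_map R S N f X"
      using X A fc by (simp add: lf M.mfrac_smult N.mfrac_smult mod_hom_smult[OF f])
  qed
qed

lemma loc_map_image:
  assumes M: "Module.module R M" and N: "Module.module R N" and f: "f \<in> mod_hom R M N"
  shows "loc_map R S N f ` carrier (LM M) = {mfrac N y s | y s. y \<in> f ` carrier M \<and> s \<in> S}"
proof -
  interpret M: mult_set_module R S M by (rule mult_set_moduleI[OF M])
  note lf = loc_map_mfrac[OF M N f]
  show ?thesis unfolding M.LM_carrier using lf by (fastforce simp: image_iff)
qed

text \<open>If \<open>x / s\<close> is killed, then \<open>f x\<close> vanishes only after
  multiplication by some \<open>u\<close>; rewriting the fraction as \<open>u x / u s\<close> moves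
  its numerator into the kernel. Together with \<open>loc_map_image\<close> this is exactness of
  localization.\<close>

lemma loc_map_kernel:
  assumes M: "Module.module R M" and N: "Module.module R N" and f: "f \<in> mod_hom R M N"
  shows "a_kernel (LM M) (LM N) (loc_map R S N f) = {mfrac M x s | x s. x \<in> a_kernel M N f \<and> s \<in> S}"
proof -
  interpret M: mult_set_module R S M by (rule mult_set_moduleI[OF M])
  interpret N: mult_set_module R S N by (rule mult_set_moduleI[OF N])
  note fc = mod_hom_closed[OF f] and lf = loc_map_mfrac[OF M N f]
  show ?thesis
  proof (intro subset_antisym subsetI)
    fix X assume "X \<in> a_kernel (LM M) (LM N) (loc_map R S N f)"
    then have X: "X \<in> carrier (LM M)" "loc_map R S N f X = \<zero>\<^bsub>LM N\<^esub>" by (auto simp: a_kernel_def')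
    then obtain x s where x: "X = mfrac M x s" "x \<in> carrier M" "s \<in> S" by (metis M.LM_cases)
    obtain u where u: "u \<in> S" "u \<odot>\<^bsub>N\<^esub> f x = \<zero>\<^bsub>N\<^esub>"
      using X(2) x fc by (auto simp: lf N.mfrac_eq_zero_iff)
    have "u \<odot>\<^bsub>M\<^esub> x \<in> a_kernel M N f" using u x by (auto simp: a_kernel_def' mod_hom_smult[OF f])
    moreover have "X = mfrac M (u \<odot>\<^bsub>M\<^esub> x) (u \<otimes> s)" using x u by (simp add: M.mfrac_expand)
    ultimately show "X \<in> {mfrac M x s | x s. x \<in> a_kernel M N f \<and> s \<in> S}" using u x by blast
  next
    fix X assume "X \<in> {mfrac M x s | x s. x \<in> a_kernel M N f \<and> s \<in> S}"
    then show "X \<in> a_kernel (LM M) (LM N) (loc_map R S N f)"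
      by (auto simp: a_kernel_def' lf N.mfrac_zero)
  qed
qed

text \<open>A functional over \<open>L\<close> must take values in \<open>L\<close> itself, whereas
  \<open>loc_map\<close> produces values in the localization of \<open>R\<close> regarded as a
  module.\<close>

lemma loc_functional:
  assumes M: "Module.module R M" and f: "f \<in> mod_hom R M (module_of_ring R)"
  shows "\<exists>g\<in>mod_hom L (LM M) (module_of_ring L). \<forall>x\<in>carrier M. \<forall>s\<in>S. g (mfrac M x s) = frac (f x) s"
proof -
  have RM: "Module.module R (module_of_ring R)" by (rule module_of_ring) (rule is_cring)
  interpret M: mult_set_module R S M by (rule mult_set_moduleI[OF M])
  interpret N: mult_set_module R S "module_of_ring R" by (rule mult_set_moduleI[OF RM])
  \<comment> \<open>For \<open>R\<close> as a module over itself the two fraction relations are the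
    same set. The two targets thus share their classes, and no isomorphism has to be carried
    along.\<close>
  have "mfrac_rel R S (module_of_ring R) = frac_rel R S"
  proof -
    have "((a, s), (b, t)) \<in> mfrac_rel R S (module_of_ring R) \<longleftrightarrow> ((a, s), (b, t)) \<in> frac_rel R S" for a s b t
    proof (cases "a \<in> carrier R \<and> b \<in> carrier R \<and> s \<in> S \<and> t \<in> S")
      case True
      then have "frac a s = frac b t \<longleftrightarrow> ((a, s), (b, t)) \<in> frac_rel R S"
        unfolding fraction_def by (intro eq_equiv_class_iff[OF frac_equiv]) auto
      with True show ?thesis by (simp add: frac_eq_iff mfrac_rel_def)
    qed (auto simp: mfrac_rel_def frac_rel_def)
    then show ?thesis by auto
  qed
  then have eq: "mfrac (module_of_ring R) = frac" by (simp add: mfraction_def fraction_def fun_eq_iff)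
  let ?g = "loc_map R S (module_of_ring R) f"
  have g: "?g (mfrac M x s) = frac (f x) s" if "x \<in> carrier M" "s \<in> S" for x s
    using loc_map_mfrac[OF M RM f that] by (simp add: eq)
  have fc: "x \<in> carrier M \<Longrightarrow> f x \<in> carrier R" for x using mod_hom_closed[OF f] by simp
  have fa: "f (x \<oplus>\<^bsub>M\<^esub> y) = f x \<oplus> f y" if "x \<in> carrier M" "y \<in> carrier M" for x y
    using mod_hom_add[OF f that] by simp
  have fs: "f (a \<odot>\<^bsub>M\<^esub> x) = a \<otimes> f x" if "x \<in> carrier M" "a \<in> carrier R" for a x
    using mod_hom_smult[OF f that(2,1)] by simp
  have "?g \<in> mod_hom L (LM M) (module_of_ring L)"
  proof (rule mod_homI)
    fix X assume "X \<in> carrier (LM M)"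
    then obtain x s where X: "X = mfrac M x s" "x \<in> carrier M" "s \<in> S" by (metis M.LM_cases)
    show "?g X \<in> carrier (module_of_ring L)" using X fc by (simp add: g)
    { fix Y assume "Y \<in> carrier (LM M)"
      then obtain y t where Y: "Y = mfrac M y t" "y \<in> carrier M" "t \<in> S" by (metis M.LM_cases)
      show "?g (X \<oplus>\<^bsub>LM M\<^esub> Y) = ?g X \<oplus>\<^bsub>module_of_ring L\<^esub> ?g Y"
        using X Y fc by (simp add: g M.mfrac_add frac_add fa fs m_comm) }
    fix A assume "A \<in> carrier L"
    then obtain a p where A: "A = frac a p" "a \<in> carrier R" "p \<in> S" by (metis L_cases)
    show "?g (A \<odot>\<^bsub>LM M\<^esub> X) = A \<odot>\<^bsub>module_of_ring L\<^esub> ?g X"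
      using X A fc by (simp add: g M.mfrac_smult frac_mult fs)
  qed
  then show ?thesis using g by blast
qed

text \<open>Dividing the expansion of \<open>x\<close> by \<open>s\<close> puts the denominator into
  the functionals, so the generators can stay \<open>b i / 1\<close>.\<close>

lemma loc_dual_basis:
  assumes M: "Module.module R M" and db: "dual_basis R M k b l"
  shows "\<exists>l'. dual_basis L (LM M) k (\<lambda>i. mfrac M (b i) \<one>) l' \<and>
    (\<forall>i<k. \<forall>x\<in>carrier M. \<forall>s\<in>S. l' i (mfrac M x s) = frac (l i x) s)"
proof -
  interpret M: mult_set_module R S M by (rule mult_set_moduleI[OF M])
  interpret LM: Module.module L "LM M" by (rule M.module_LM)
  have b: "i < k \<Longrightarrow> b i \<in> carrier M" and l: "i < k \<Longrightarrow> l i \<in> mod_hom R M (module_of_ring R)"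
    and lc: "i < k \<Longrightarrow> x \<in> carrier M \<Longrightarrow> l i x \<in> carrier R" for i x
    using db by (auto simp: dual_basis_def mod_hom_def Pi_def)
  have "\<forall>i. \<exists>g. i < k \<longrightarrow> g \<in> mod_hom L (LM M) (module_of_ring L) \<and>
      (\<forall>x\<in>carrier M. \<forall>s\<in>S. g (mfrac M x s) = frac (l i x) s)"
    using loc_functional[OF M l] by blast
  from choice[OF this] obtain l' where l': "\<And>i. i < k \<Longrightarrow> l' i \<in> mod_hom L (LM M) (module_of_ring L)"
      "\<And>i x s. i < k \<Longrightarrow> x \<in> carrier M \<Longrightarrow> s \<in> S \<Longrightarrow> l' i (mfrac M x s) = frac (l i x) s" by blast
  have "dual_basis L (LM M) k (\<lambda>i. mfrac M (b i) \<one>) l'"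
    unfolding dual_basis_def
  proof (intro conjI allI impI ballI)
    fix X assume "X \<in> carrier (LM M)"
    then obtain x s where X: "X = mfrac M x s" "x \<in> carrier M" "s \<in> S" by (metis M.LM_cases)
    have "X = mfrac M (\<Oplus>\<^bsub>M\<^esub> i\<in>{..<k}. l i x \<odot>\<^bsub>M\<^esub> b i) s"
      using X db by (metis dual_basis_def)
    also have "\<dots> = (\<Oplus>\<^bsub>LM M\<^esub> i\<in>{..<k}. mfrac M (l i x \<odot>\<^bsub>M\<^esub> b i) s)"
      using X b lc by (intro M.mfrac_finsum) auto
    also have "\<dots> = (\<Oplus>\<^bsub>LM M\<^esub> i\<in>{..<k}. l' i X \<odot>\<^bsub>LM M\<^esub> mfrac M (b i) \<one>)"
      using X b lc by (intro LM.finsum_cong') (auto simp: l' M.mfrac_smult)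
    finally show "X = (\<Oplus>\<^bsub>LM M\<^esub> i\<in>{..<k}. l' i X \<odot>\<^bsub>LM M\<^esub> mfrac M (b i) \<one>)" .
  qed (use b l' in auto)
  then show ?thesis using l' by blast
qed

section \<open>Clearing denominators\<close>

lemma common_denominator:
  fixes k :: nat
  assumes M: "Module.module R M" and X: "\<And>i. i < k \<Longrightarrow> X i \<in> carrier (LM M)"
  shows "\<exists>t\<in>S. \<exists>y. \<forall>i<k. y i \<in> carrier M \<and> X i = mfrac M (y i) t"
  using X
proof (induction k)
  case 0
  then show ?case by auto
next
  case (Suc k)
  interpret M: mult_set_module R S M by (rule mult_set_moduleI[OF M])
  obtain t y where t: "t \<in> S" "\<And>i. i < k \<Longrightarrow> y i \<in> carrier M" "\<And>i. i < k \<Longrightarrow> X i = mfrac M (y i) t"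
    using Suc.IH[OF Suc.prems] by auto
  obtain z w where z: "X k = mfrac M z w" "z \<in> carrier M" "w \<in> S" using Suc.prems[of k] M.LM_cases by blast
  \<comment> \<open>Numerators over the new denominator \<open>w \<otimes> t\<close>: the earlier
    fractions are expanded by \<open>w\<close>, the last one by \<open>t\<close>.\<close>
  let ?y = "\<lambda>i. if i < k then w \<odot>\<^bsub>M\<^esub> y i else t \<odot>\<^bsub>M\<^esub> z"
  have "?y i \<in> carrier M \<and> X i = mfrac M (?y i) (w \<otimes> t)" if "i < Suc k" for i
  proof (cases "i < k")
    case True
    then show ?thesis using t z by (simp add: M.mfrac_expand)
  next
    case False
    then have "i = k" using that by simp
    then show ?thesis using t z M.mfrac_expand[of z w t] by (simp add: m_comm)
  qed
  then show ?case using t(1) z(3) by (intro bexI[of _ "w \<otimes> t"] exI[of _ ?y]) auto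
qed

text \<open>An equality of fractions holds for numerators only after multiplication by an element of
  \<open>S\<close>; the product of finitely many such elements serves all equations at once.\<close>

lemma common_annihilator:
  fixes k :: nat
  assumes M: "Module.module R M" and p: "\<And>i. i < k \<Longrightarrow> p i \<in> carrier M" "\<And>i. i < k \<Longrightarrow> q i \<in> carrier M"
    and e: "\<And>i. i < k \<Longrightarrow> \<exists>u\<in>S. u \<odot>\<^bsub>M\<^esub> p i = u \<odot>\<^bsub>M\<^esub> q i"
  shows "\<exists>u\<in>S. \<forall>i<k. u \<odot>\<^bsub>M\<^esub> p i = u \<odot>\<^bsub>M\<^esub> q i"
  using p e
proof (induction k)
  case 0
  then show ?case by auto
next
  case (Suc k)
  interpret M: Module.module R M by fact
  obtain u where u: "u \<in> S" "\<And>i. i < k \<Longrightarrow> u \<odot>\<^bsub>M\<^esub> p i = u \<odot>\<^bsub>M\<^esub> q i"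
    using Suc.IH[OF Suc.prems] by auto
  obtain v where v: "v \<in> S" "v \<odot>\<^bsub>M\<^esub> p k = v \<odot>\<^bsub>M\<^esub> q k" using Suc.prems(3)[of k] by auto
  have "(u \<otimes> v) \<odot>\<^bsub>M\<^esub> p i = (u \<otimes> v) \<odot>\<^bsub>M\<^esub> q i" if "i < Suc k" for i
  proof (cases "i < k")
    case True
    have "(v \<otimes> u) \<odot>\<^bsub>M\<^esub> p i = (v \<otimes> u) \<odot>\<^bsub>M\<^esub> q i"
      using Suc.prems(1,2)[of i] u v True by (simp add: M.smult_assoc1)
    then show ?thesis using u v by (simp add: m_comm)
  next
    case False
    then have "i = k" using that by simp
    then show ?thesis using Suc.prems(1,2)[of i] u v by (simp add: M.smult_assoc1)
  qed
  then show ?case using u v by blast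
qed

text \<open>The dual basis of \<open>P\<close> builds \<open>h\<close> out of finitely many
  numerators; the dual basis of \<open>Q\<close> reduces the identity for \<open>h \<circ> f\<close>
  to finitely many equations with one multiplier.\<close>

lemma loc_retraction_descends:
  assumes P: "Module.module R P" "dual_basis R P k b l" and Q: "Module.module R Q" "dual_basis R Q m c w"
    and f: "f \<in> mod_hom R Q P" and g: "g \<in> mod_hom L (LM P) (LM Q)"
    and gf: "\<And>X. X \<in> carrier (LM Q) \<Longrightarrow> g (loc_map R S P f X) = X"
  shows "\<exists>s\<in>S. \<exists>h\<in>mod_hom R P Q. \<forall>x\<in>carrier Q. h (f x) = s \<odot>\<^bsub>Q\<^esub> x"
proof -
  interpret P: mult_set_module R S P by (rule mult_set_moduleI[OF P(1)])
  interpret Q: mult_set_module R S Q by (rule mult_set_moduleI[OF Q(1)])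
  interpret LQ: Module.module L "LM Q" by (rule Q.module_LM)
  have b: "i < k \<Longrightarrow> b i \<in> carrier P" and lc: "i < k \<Longrightarrow> x \<in> carrier P \<Longrightarrow> l i x \<in> carrier R" for i x
    using P(2) by (auto simp: dual_basis_def mod_hom_def Pi_def)
  have c: "i < m \<Longrightarrow> c i \<in> carrier Q" for i using Q(2) by (auto simp: dual_basis_def)
  obtain l' where l': "dual_basis L (LM P) k (\<lambda>i. mfrac P (b i) \<one>) l'"
    "\<And>i x s. i < k \<Longrightarrow> x \<in> carrier P \<Longrightarrow> s \<in> S \<Longrightarrow> l' i (mfrac P x s) = frac (l i x) s"
    using loc_dual_basis[OF P] by blast
  have "\<exists>t\<in>S. \<exists>y. \<forall>i<k. y i \<in> carrier Q \<and> g (mfrac P (b i) \<one>) = mfrac Q (y i) t"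
    using b by (intro common_denominator[OF Q(1)] mod_hom_closed[OF g]) auto
  then obtain t y where t: "t \<in> S" and y: "\<And>i. i < k \<Longrightarrow> y i \<in> carrier Q"
    "\<And>i. i < k \<Longrightarrow> g (mfrac P (b i) \<one>) = mfrac Q (y i) t" by blast
  \<comment> \<open>The numerators of the images of the \<open>b i\<close> under \<open>g\<close>
    serve as values, so \<open>h\<close> represents \<open>t\<close> times \<open>g\<close>, as
    \<open>gh\<close> makes precise.\<close>
  define h where "h x = (\<Oplus>\<^bsub>Q\<^esub> i\<in>{..<k}. l i x \<odot>\<^bsub>Q\<^esub> y i)" for x
  have h: "h \<in> mod_hom R P Q" using dual_basis_comb_hom[OF Q(1) P(2) y(1)] by (simp add: h_def[abs_def])
  have gh: "g (mfrac P x \<one>) = mfrac Q (h x) t" if x: "x \<in> carrier P" for x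
  proof -
    have "g (mfrac P x \<one>) = (\<Oplus>\<^bsub>LM Q\<^esub> i\<in>{..<k}. l' i (mfrac P x \<one>) \<odot>\<^bsub>LM Q\<^esub> g (mfrac P (b i) \<one>))"
      using x by (intro dual_basis_hom_eq[OF P.module_LM Q.module_LM l'(1) g]) auto
    also have "\<dots> = (\<Oplus>\<^bsub>LM Q\<^esub> i\<in>{..<k}. mfrac Q (l i x \<odot>\<^bsub>Q\<^esub> y i) t)"
      using x y t lc by (intro LQ.finsum_cong') (auto simp: l' Q.mfrac_smult)
    also have "\<dots> = mfrac Q (h x) t"
      unfolding h_def using x y t lc by (intro Q.mfrac_finsum[symmetric]) auto
    finally show ?thesis .
  qed
  note hf = mod_hom_closed[OF h mod_hom_closed[OF f]]
  have "\<exists>u\<in>S. u \<odot>\<^bsub>Q\<^esub> h (f (c i)) = u \<odot>\<^bsub>Q\<^esub> (t \<odot>\<^bsub>Q\<^esub> c i)" if "i < m" for i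
  proof -
    have "mfrac Q (h (f (c i))) t = g (loc_map R S P f (mfrac Q (c i) \<one>))"
      using gh[OF mod_hom_closed[OF f c[OF that]]] c[OF that] by (simp add: loc_map_mfrac[OF Q(1) P(1) f])
    also have "\<dots> = mfrac Q (c i) \<one>" using c[OF that] by (simp add: gf)
    finally show ?thesis using c[OF that] hf t by (simp add: Q.mfrac_eq_iff)
  qed
  then obtain u where u: "u \<in> S" "\<And>i. i < m \<Longrightarrow> u \<odot>\<^bsub>Q\<^esub> h (f (c i)) = u \<odot>\<^bsub>Q\<^esub> (t \<odot>\<^bsub>Q\<^esub> c i)"
    using common_annihilator[OF Q(1), of m "\<lambda>i. h (f (c i))" "\<lambda>i. t \<odot>\<^bsub>Q\<^esub> c i"] hf c t by auto
  have "u \<odot>\<^bsub>Q\<^esub> h (f x) = u \<odot>\<^bsub>Q\<^esub> (t \<odot>\<^bsub>Q\<^esub> x)" if "x \<in> carrier Q" for x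
    using dual_basis_hom_ext[OF Q(1) Q(1) Q(2)
        mod_hom_pointwise_smult[OF Q(1) mod_hom_comp[OF f h] S_carrier[OF u(1)]]
        mod_hom_pointwise_smult[OF Q(1) mod_hom_pointwise_smult[OF Q(1) mod_hom_id S_carrier[OF t]] S_carrier[OF u(1)]]
        u(2) that] .
  then have "\<forall>x\<in>carrier Q. u \<odot>\<^bsub>Q\<^esub> h (f x) = (u \<otimes> t) \<odot>\<^bsub>Q\<^esub> x" using u t by (simp add: Q.smult_assoc1)
  \<comment> \<open>\<open>h \<circ> f\<close> agrees with multiplication by \<open>t\<close> only
    after multiplying by \<open>u\<close>. Absorbing \<open>u\<close> into the map gives the scalar
    \<open>u \<otimes> t\<close>.\<close>
  then show ?thesis using u t mod_hom_pointwise_smult[OF Q(1) h, of u]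
    by (intro bexI[of _ "u \<otimes> t"] bexI[of _ "\<lambda>x. u \<odot>\<^bsub>Q\<^esub> h x"]) auto
qed

end

section \<open>Transport of structure\<close>

text \<open>The inverse is part of the data so that transported differentials can be written down as
  \<open>j i \<circ> d i \<circ> k (Suc i)\<close>.\<close>

definition mod_iso ::
    "('a, 'c) ring_scheme \<Rightarrow> ('a, 'm) module \<Rightarrow> ('a, 'n) module \<Rightarrow> ('m \<Rightarrow> 'n) \<Rightarrow> ('n \<Rightarrow> 'm) \<Rightarrow> bool" where
  "mod_iso R M N j k \<longleftrightarrow> j \<in> mod_hom R M N \<and> k \<in> mod_hom R N M \<and>
    (\<forall>x\<in>carrier M. k (j x) = x) \<and> (\<forall>y\<in>carrier N. j (k y) = y)"

lemma mod_iso_refl: "mod_iso R M M (\<lambda>x. x) (\<lambda>x. x)"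
  by (simp add: mod_iso_def mod_hom_id)

lemma mod_iso_image:
  assumes "mod_iso R M N j k" shows "j ` carrier M = carrier N"
proof (intro subset_antisym subsetI)
  fix y assume "y \<in> carrier N"
  then show "y \<in> j ` carrier M"
    using assms by (intro image_eqI[of _ _ "k y"]) (auto simp: mod_iso_def mod_hom_def)
qed (use assms in \<open>auto simp: mod_iso_def mod_hom_def\<close>)

text \<open>Moves a module to another carrier type along any injection: the operations on the image
  are conjugated by \<open>j\<close> and its inverse.\<close>

lemma ex_transport:
  fixes M :: "('a, 'm) module" and j :: "'m \<Rightarrow> 'n"
  assumes M: "Module.module R M" and j: "inj_on j (carrier M)"
  shows "\<exists>(N :: ('a, 'n) module) k. Module.module R N \<and> mod_iso R M N j k"
proof -
  interpret M: Module.module R M by fact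
  define k where "k = inv_into (carrier M) j"
  have kj: "x \<in> carrier M \<Longrightarrow> k (j x) = x" for x using j by (simp add: k_def)
  define N :: "('a, 'n) module" where "N = \<lparr>carrier = j ` carrier M, mult = undefined, one = undefined,
     zero = j \<zero>\<^bsub>M\<^esub>, add = \<lambda>x y. j (k x \<oplus>\<^bsub>M\<^esub> k y), smult = \<lambda>a x. j (a \<odot>\<^bsub>M\<^esub> k x)\<rparr>"
  have "Module.module R N"
  proof (intro moduleI abelian_groupI M.R.is_cring)
    fix x assume "x \<in> carrier N"
    then obtain y where y: "y \<in> carrier M" "x = j y" by (auto simp: N_def)
    then show "\<exists>y\<in>carrier N. y \<oplus>\<^bsub>N\<^esub> x = \<zero>\<^bsub>N\<^esub>"
      by (intro bexI[of _ "j (\<ominus>\<^bsub>M\<^esub> y)"]) (auto simp: N_def kj M.M.l_neg)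
  qed (auto simp: N_def kj M.M.a_ac M.smult_l_distr M.smult_r_distr M.smult_assoc1)
  moreover have "mod_iso R M N j k"
    by (auto simp: mod_iso_def mod_hom_def N_def kj)
  ultimately show ?thesis by blast
qed

text \<open>The resolving modules and the resolved module can change carrier type independently;
  \<open>mod_iso_refl\<close> leaves either side as it is.\<close>

lemma resolution_transport:
  assumes M: "Module.module R M" and res: "resolution R n P d e M"
    and M': "Module.module R M'" and P': "\<And>i. i \<le> n \<Longrightarrow> Module.module R (P' i)"
    and iM: "mod_iso R M M' jM kM" and iP: "\<And>i. i \<le> n \<Longrightarrow> mod_iso R (P i) (P' i) (j i) (k i)"
  shows "resolution R n P' (\<lambda>i x. j i (d i (k (Suc i) x))) (\<lambda>x. jM (e (k 0 x))) M'"
proof -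
  note mD = resolution_module[OF M res] resolution_hom[OF M res]
  have jP: "j i \<in> mod_hom R (P i) (P' i)" "k i \<in> mod_hom R (P' i) (P i)"
    "\<And>x. x \<in> carrier (P i) \<Longrightarrow> k i (j i x) = x" "\<And>x. x \<in> carrier (P' i) \<Longrightarrow> j i (k i x) = x"
    if "i \<le> n" for i using iP[OF that] by (auto simp: mod_iso_def)
  have jM: "jM \<in> mod_hom R M M'" "kM \<in> mod_hom R M' M"
    "\<And>x. x \<in> carrier M \<Longrightarrow> kM (jM x) = x" "\<And>x. x \<in> carrier M' \<Longrightarrow> jM (kM x) = x"
    using iM by (auto simp: mod_iso_def)
  have kim: "k i ` carrier (P' i) = carrier (P i)" if "i \<le> n" for i
    using mod_hom_closed[OF jP(1)[OF that]] mod_hom_closed[OF jP(2)[OF that]] jP(3)[OF that] by (force simp: image_iff)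
  let ?d = "\<lambda>i x. j i (d i (k (Suc i) x))" and ?e = "\<lambda>x. jM (e (k 0 x))"
  have j0: "j i x = \<zero>\<^bsub>P' i\<^esub> \<longleftrightarrow> x = \<zero>\<^bsub>P i\<^esub>" if "i \<le> n" "x \<in> carrier (P i)" for i x
    using mod_hom_zero[OF mD(1) P' jP(1)] mod_hom_zero[OF P' mD(1) jP(2)] jP(3) that by metis
  have jM0: "jM x = \<zero>\<^bsub>M'\<^esub> \<longleftrightarrow> x = \<zero>\<^bsub>M\<^esub>" if "x \<in> carrier M" for x
    using mod_hom_zero[OF M M' jM(1)] mod_hom_zero[OF M' M jM(2)] jM(3) that by metis
  have syz: "x \<in> syzygy P' ?d ?e M' i \<longleftrightarrow> x \<in> carrier (P' i) \<and> k i x \<in> syzygy P d e M i" if "i \<le> n" for i x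
  proof (cases i)
    case 0
    then show ?thesis
      using jM0 mod_hom_closed[OF resolution_e_hom[OF M res]] mod_hom_closed[OF jP(2)[of 0]]
      by (auto simp: mem_syzygy_0)
  next
    case (Suc i')
    with that have i': "i' < n" by simp
    show ?thesis unfolding Suc
      using j0[of i'] mod_hom_closed[OF mD(2)[OF i']] mod_hom_closed[OF jP(2)[of "Suc i'"]] i'
      by (auto simp: mem_syzygy_Suc)
  qed
  have ims: "j i ` syzygy P d e M i = syzygy P' ?d ?e M' i" if "i \<le> n" for i
  proof (intro subset_antisym subsetI)
    fix y assume "y \<in> j i ` syzygy P d e M i"
    then obtain x where x: "x \<in> syzygy P d e M i" "y = j i x" by blast
    have "x \<in> carrier (P i)" using subsetD[OF syzygy_subset x(1)] .
    then show "y \<in> syzygy P' ?d ?e M' i"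
      using x jP(3)[OF that] mod_hom_closed[OF jP(1)[OF that]] by (simp add: syz[OF that])
  next
    fix y assume "y \<in> syzygy P' ?d ?e M' i"
    then show "y \<in> j i ` syzygy P d e M i" using jP(4)[OF that, of y] by (force simp: syz[OF that])
  qed
  show ?thesis unfolding resolution_def
  proof (intro conjI allI impI P')
    show "?e \<in> mod_hom R (P' 0) M'"
      by (intro mod_hom_comp[OF _ jM(1)] mod_hom_comp[OF jP(2) resolution_e_hom[OF M res]]) auto
    show "?d i \<in> mod_hom R (P' (Suc i)) (P' i)" if "i < n" for i
      using that by (intro mod_hom_comp[OF _ jP(1)] mod_hom_comp[OF jP(2) mD(2)]) auto
    have "?e ` carrier (P' 0) = jM ` e ` k 0 ` carrier (P' 0)" by (simp add: image_image)
    then show "?e ` carrier (P' 0) = carrier M'"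
      using kim[of 0] resolution_e_surj[OF M res] mod_iso_image[OF iM] by simp
    show "?d i ` carrier (P' (Suc i)) = syzygy P' ?d ?e M' i" if "i < n" for i
    proof -
      have "?d i ` carrier (P' (Suc i)) = j i ` d i ` k (Suc i) ` carrier (P' (Suc i))" by (simp add: image_image)
      then show ?thesis using kim[of "Suc i"] resolution_image[OF M res that] ims[of i] that by simp
    qed
    show "syzygy P' ?d ?e M' n = {\<zero>\<^bsub>P' n\<^esub>}"
      using ims[of n] resolution_last[OF M res] mod_hom_zero[OF mD(1) P' jP(1), of n] by simp
  qed
qed

section \<open>Reaching the carrier types fixed by \<open>fPD\<close> and \<open>pd\<close>\<close>

lemma spans_embedding:
  fixes M :: "('a, 'm) module"
  assumes "spans R M k b"
  shows "\<exists>j :: 'm \<Rightarrow> nat \<Rightarrow> 'a. inj_on j (carrier M)"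
proof -
  \<comment> \<open>An element is recovered from any coefficient family that expands it, so choosing
    one such family is injective.\<close>
  define j where "j x = (SOME c. (\<forall>i<k. c i \<in> carrier R) \<and> x = (\<Oplus>\<^bsub>M\<^esub> i\<in>{..<k}. c i \<odot>\<^bsub>M\<^esub> b i))" for x
  have "x = (\<Oplus>\<^bsub>M\<^esub> i\<in>{..<k}. j x i \<odot>\<^bsub>M\<^esub> b i)" if "x \<in> carrier M" for x
  proof -
    have "\<exists>c. (\<forall>i<k. c i \<in> carrier R) \<and> x = (\<Oplus>\<^bsub>M\<^esub> i\<in>{..<k}. c i \<odot>\<^bsub>M\<^esub> b i)"
      using assms that by (auto simp: spans_def)
    from someI_ex[OF this] show ?thesis by (simp add: j_def)
  qed
  then show ?thesis by (intro exI[of _ j] inj_onI) metis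
qed

lemma dual_basis_iso:
  assumes "Module.module R P" "Module.module R P'" "dual_basis R P k b l" "mod_iso R P P' j i"
  shows "\<exists>b l. dual_basis R P' k b l"
  using dual_basis_retract[OF assms(1-3), of j i] assms(4) unfolding mod_iso_def by blast

text \<open>\<open>fPD\<close> ranges over modules on \<open>nat \<Rightarrow> 'a\<close> only, so a
  bound on it reaches a localized module only through such a copy.\<close>

lemma FPR_transport:
  fixes P :: "nat \<Rightarrow> ('a, 'p) module" and M :: "('a, 'm) module"
  assumes M: "Module.module R M" and res: "resolution R n P d e M"
    and db: "\<And>i. i \<le> n \<Longrightarrow> \<exists>k b l. dual_basis R (P i) k b l"
  shows "\<exists>(M' :: ('a, nat \<Rightarrow> 'a) module) j k. FPR R M' \<and> mod_iso R M M' j k"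
proof -
  note Pm = resolution_module[OF M res]
  have "\<forall>i. \<exists>(N :: ('a, nat \<Rightarrow> 'a) module) j k. i \<le> n \<longrightarrow> Module.module R N \<and> mod_iso R (P i) N j k"
    using spans_embedding[OF dual_basis_spans] ex_transport[OF Pm] db by meson
  from choice[OF this] obtain P' :: "nat \<Rightarrow> ('a, nat \<Rightarrow> 'a) module"
    where "\<forall>i. \<exists>j k. i \<le> n \<longrightarrow> Module.module R (P' i) \<and> mod_iso R (P i) (P' i) j k" by blast
  from choice[OF this] obtain j where "\<forall>i. \<exists>k. i \<le> n \<longrightarrow> Module.module R (P' i) \<and> mod_iso R (P i) (P' i) (j i) k"
    by blast
  from choice[OF this] obtain k where P': "\<And>i. i \<le> n \<Longrightarrow> Module.module R (P' i)"
      "\<And>i. i \<le> n \<Longrightarrow> mod_iso R (P i) (P' i) (j i) (k i)" by blast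
  \<comment> \<open>\<open>M\<close> embeds as well, being generated by the images of the generators
    of \<open>P 0\<close>.\<close>
  obtain m b l where "dual_basis R (P 0) m b l" using db[of 0] by auto
  from spans_image[OF Pm M dual_basis_spans[OF this] resolution_e_hom[OF M res] resolution_e_surj[OF M res]]
  have sp: "spans R M m (\<lambda>j. e (b j))" by simp
  obtain M' :: "('a, nat \<Rightarrow> 'a) module" and jM kM where M': "Module.module R M'" "mod_iso R M M' jM kM"
    using spans_embedding[OF sp] ex_transport[OF M] by meson
  have "resolution R n P' (\<lambda>i x. j i (d i (k (Suc i) x))) (\<lambda>x. jM (e (k 0 x))) M'"
    by (rule resolution_transport[OF M res M'(1) P'(1) M'(2) P'(2)])
  moreover have "fin_gen R (P' i) \<and> projective R (P' i)" if i: "i \<le> n" for i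
  proof -
    obtain k b l where "dual_basis R (P' i) k b l"
      using db[OF i] dual_basis_iso[OF Pm[OF i] P'(1)[OF i] _ P'(2)[OF i]] by blast
    then show ?thesis
      using spans_fin_gen[OF P'(1)[OF i] dual_basis_spans] dual_basis_projective[OF P'(1)[OF i]] by blast
  qed
  ultimately have "FPR R M'" unfolding FPR_def using M' by blast
  then show ?thesis using M' by blast
qed

lemma pd_le_resolution:
  fixes P :: "nat \<Rightarrow> ('a, nat \<Rightarrow> 'a) module" and M :: "('a, 'm) module"
  assumes M: "Module.module R M" and res: "resolution R n P d e M"
    and db: "\<And>i. i \<le> n \<Longrightarrow> \<exists>k b l. dual_basis R (P i) k b l"
  shows "pd R M \<le> enat n"
proof -
  note Pm = resolution_module[OF M res]
  \<comment> \<open>An injection into the type fixed by \<open>pd\<close>: functions are extended to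
    the summand \<open>'m\<close> by a constant.\<close>
  define j :: "(nat \<Rightarrow> 'a) \<Rightarrow> ('m + nat \<Rightarrow> 'a)" where "j f = case_sum (\<lambda>_. undefined) f" for f
  have "inj j" by (auto simp: inj_def j_def fun_eq_iff split: sum.splits)
  then have "\<forall>i. \<exists>(N :: ('a, 'm + nat \<Rightarrow> 'a) module) k. i \<le> n \<longrightarrow> Module.module R N \<and> mod_iso R (P i) N j k"
    using ex_transport[OF Pm inj_on_subset[of j UNIV]] by blast
  from choice[OF this] obtain P' :: "nat \<Rightarrow> ('a, 'm + nat \<Rightarrow> 'a) module"
    where "\<forall>i. \<exists>k. i \<le> n \<longrightarrow> Module.module R (P' i) \<and> mod_iso R (P i) (P' i) j k" by blast
  from choice[OF this] obtain k where P': "\<And>i. i \<le> n \<Longrightarrow> Module.module R (P' i)"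
      "\<And>i. i \<le> n \<Longrightarrow> mod_iso R (P i) (P' i) j (k i)" by blast
  have r: "resolution R n P' (\<lambda>i x. j (d i (k (Suc i) x))) (\<lambda>x. e (k 0 x)) M"
    using resolution_transport[OF M res M P'(1) mod_iso_refl P'(2)] .
  have pr: "projective R (P' i)" if "i \<le> n" for i
    using db[OF that] dual_basis_iso[OF Pm[OF that] P'(1)[OF that] _ P'(2)[OF that]]
      dual_basis_projective[OF P'(1)[OF that]] by blast
  show ?thesis unfolding pd_def
    by (rule INF_lower) (use r pr in blast)
qed

lemma pd_le_imp_resolution:
  fixes M :: "('a, 'm) module"
  assumes "pd R M \<le> enat m"
  obtains n and P :: "nat \<Rightarrow> ('a, 'm + nat \<Rightarrow> 'a) module" and d e
  where "n \<le> m" "resolution R n P d e M" "\<And>i. i \<le> n \<Longrightarrow> projective R (P i)"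
proof -
  let ?X = "{n. \<exists>(P :: nat \<Rightarrow> ('a, 'm + nat \<Rightarrow> 'a) module) d e.
        resolution R n P d e M \<and> (\<forall>i\<le>n. projective R (P i))}"
  have "\<exists>n\<in>?X. n \<le> m"
  proof (rule ccontr)
    assume "\<not> (\<exists>n\<in>?X. n \<le> m)"
    \<comment> \<open>Lengths are integers, so if none is at most \<open>m\<close>, then
      \<open>Suc m\<close> is a lower bound for all of them and hence for the infimum.\<close>
    then have "enat (Suc m) \<le> enat n" if "n \<in> ?X" for n
      using that by (meson enat_ord_simps(1) not_less_eq_eq)
    then have "enat (Suc m) \<le> pd R M" unfolding pd_def by (rule INF_greatest)
    then show False using assms order_trans by fastforce
  qed
  then show ?thesis using that by blast
qed

section \<open>Shortening resolutions\<close>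

text \<open>The splitting makes \<open>P j\<close> the direct sum of the image of \<open>d j\<close>
  and the kernel of \<open>h\<close>. The map out of \<open>P j\<close> has the first summand as its
  kernel, so restricting it to the second keeps its image and makes it injective.\<close>

lemma resolution_shorten:
  assumes M: "Module.module R M" and res: "resolution R (Suc j) P d e M"
    and h: "h \<in> mod_hom R (P j) (P (Suc j))" and hd: "\<And>x. x \<in> carrier (P (Suc j)) \<Longrightarrow> h (d j x) = x"
    and db: "\<And>i. i \<le> Suc j \<Longrightarrow> \<exists>k b l. dual_basis R (P i) k b l"
  defines "P' \<equiv> P(j := (P j)\<lparr>carrier := a_kernel (P j) (P (Suc j)) h\<rparr>)"
  shows "resolution R j P' d e M" "\<And>i. i \<le> j \<Longrightarrow> \<exists>k b l. dual_basis R (P' i) k b l"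
proof -
  note Pm = resolution_module[OF M res] and dh = resolution_hom[OF M res] and eh = resolution_e_hom[OF M res]
  let ?K = "(P j)\<lparr>carrier := a_kernel (P j) (P (Suc j)) h\<rparr>"
  have j: "j < Suc j" by simp
  have P0: "Module.module R (P j)" and P1: "Module.module R (P (Suc j))" using Pm by auto
  interpret P0: Module.module R "P j" by fact
  interpret P1: Module.module R "P (Suc j)" by fact
  have K: "Module.module R ?K" by (rule kernel_module[OF P0 P1 h])
  note hc = mod_hom_closed[OF h] and dc = mod_hom_closed[OF dh[OF j]]
  \<comment> \<open>The projection onto the kernel of \<open>h\<close> along the image of
    \<open>d j\<close>.\<close>
  define r where "r x = x \<ominus>\<^bsub>P j\<^esub> d j (h x)" for x
  have r: "r \<in> mod_hom R (P j) (P j)" unfolding r_def[abs_def]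
    by (intro mod_hom_pointwise_minus[OF P0] mod_hom_id mod_hom_comp[OF h dh]) simp
  have rK: "r x \<in> carrier ?K" if "x \<in> carrier (P j)" for x
    using that mod_hom_closed[OF r that] dc hc
    by (simp add: a_kernel_def' r_def mod_hom_minus[OF P0 P1 h] hd P1.M.minus_eq P1.M.r_neg)
  have r': "r \<in> mod_hom R (P j) ?K" using r rK by (auto simp: mod_hom_def)
  have ri: "r x = x" if "x \<in> carrier ?K" for x
    using that mod_hom_zero[OF P1 P0 dh[OF j]] by (auto simp: a_kernel_def' r_def P0.M.minus_eq)
  have P'm: "Module.module R (P' i)" if "i \<le> j" for i using that K Pm by (auto simp: P'_def)
  have P'j: "carrier (P' i) = carrier (P i)" if "i < j" for i using that by (simp add: P'_def)
  have inc: "carrier (P' i) \<subseteq> carrier (P i)" for i by (auto simp: P'_def a_kernel_def')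
  have dker: "d j x \<in> syzygy P d e M j" if "x \<in> carrier (P (Suc j))" for x
    using resolution_mem[OF M res j that] .
  have eh': "e \<in> mod_hom R (P' 0) M"
    using eh by (auto simp: P'_def mod_hom_def a_kernel_def' Pi_def)
  have dh': "d i \<in> mod_hom R (P' (Suc i)) (P' i)" if "i < j" for i
    using dh[of i] that by (auto simp: P'_def mod_hom_def a_kernel_def' Pi_def)
  \<comment> \<open>For \<open>j = 0\<close> the map out of \<open>P j\<close> is the augmentation
    \<open>e\<close>; for positive \<open>j\<close> it is the preceding differential, treated in
    \<open>dim\<close>.\<close>
  have eim: "e ` carrier (P' 0) = e ` carrier (P 0)"
  proof (cases "j = 0")
    case True
    have "e x \<in> e ` carrier (P' 0)" if "x \<in> carrier (P 0)" for x
    proof (rule image_eqI)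
      show "r x \<in> carrier (P' 0)" using rK that True by (simp add: P'_def)
      interpret M: Module.module R M by fact
      have "e (r x) = e x \<ominus>\<^bsub>M\<^esub> e (d j (h x))"
        using that hc dc True unfolding r_def by (intro mod_hom_minus[OF _ M]) (use P0 eh in auto)
      then show "e x = e (r x)"
        using that mod_hom_closed[OF eh] dker[OF hc] True by (simp add: mem_syzygy_0 M.M.minus_eq)
    qed
    then show ?thesis using inc by blast
  qed (simp add: P'_def)
  have dim: "d i ` carrier (P' (Suc i)) = d i ` carrier (P (Suc i))" if "i < j" for i
  proof (cases "Suc i = j")
    case True
    have i: "i < Suc j" using that by simp
    have Pi: "Module.module R (P i)" using Pm i by simp
    have dij: "d i \<in> mod_hom R (P j) (P i)" using dh[OF i] True by simp
    have "d i x \<in> d i ` carrier (P' (Suc i))" if "x \<in> carrier (P (Suc i))" for x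
    proof (rule image_eqI)
      have x: "x \<in> carrier (P j)" using that True by simp
      show "r x \<in> carrier (P' (Suc i))" using rK[OF x] True by (simp add: P'_def)
      interpret Pi: Module.module R "P i" by fact
      have "d i (r x) = d i x \<ominus>\<^bsub>P i\<^esub> d i (d j (h x))"
        unfolding r_def using x hc dc by (intro mod_hom_minus[OF P0 Pi dij]) auto
      then show "d i x = d i (r x)"
        using x mod_hom_closed[OF dij] dker[OF hc[OF x]] True mem_syzygy_Suc[of _ P d e M i]
        by (simp add: Pi.M.minus_eq)
    qed
    then show ?thesis using inc by blast
  qed (use that in \<open>simp add: P'_def\<close>)
  have syz: "x \<in> syzygy P' d e M i \<longleftrightarrow> x \<in> carrier (P' i) \<and> x \<in> syzygy P d e M i" for x i
    using inc[of i] by (cases i) (auto simp: mem_syzygy_0 mem_syzygy_Suc P'_def)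
  show "resolution R j P' d e M" unfolding resolution_def
  proof (intro conjI allI impI P'm eh' dh')
    show "e ` carrier (P' 0) = carrier M" using eim resolution_e_surj[OF M res] by simp
    show "d i ` carrier (P' (Suc i)) = syzygy P' d e M i" if "i < j" for i
    proof -
      have "syzygy P' d e M i = syzygy P d e M i"
        using that subsetD[OF syzygy_subset[of P d e M i]] by (auto simp: syz P'j)
      then show ?thesis using dim[OF that] resolution_image[OF M res] that by simp
    qed
    \<comment> \<open>The two summands meet in zero: if \<open>x = d j y\<close> and
      \<open>h x\<close> vanishes, then so does \<open>y = h (d j y)\<close>.\<close>
    have "x = \<zero>\<^bsub>P j\<^esub>" if "x \<in> syzygy P' d e M j" for x
    proof -
      have x: "h x = \<zero>\<^bsub>P (Suc j)\<^esub>" "x \<in> syzygy P d e M j"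
        using that[unfolded syz] by (auto simp: P'_def a_kernel_def')
      then obtain y where y: "y \<in> carrier (P (Suc j))" "x = d j y" using resolution_image[OF M res j] by auto
      then have "y = \<zero>\<^bsub>P (Suc j)\<^esub>" using x hd by simp
      then show ?thesis using y mod_hom_zero[OF P1 P0 dh[OF j]] by simp
    qed
    moreover have "\<zero>\<^bsub>P j\<^esub> \<in> syzygy P' d e M j"
    proof -
      have "\<zero>\<^bsub>P j\<^esub> \<in> carrier (P' j)"
        by (simp add: P'_def a_kernel_def' mod_hom_zero[OF P0 P1 h])
      moreover have "\<zero>\<^bsub>P j\<^esub> \<in> syzygy P d e M j"
        using dker[of "\<zero>\<^bsub>P (Suc j)\<^esub>"] mod_hom_zero[OF P1 P0 dh[OF j]] by simp
      ultimately show ?thesis by (simp add: syz)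
    qed
    ultimately have "syzygy P' d e M j = {\<zero>\<^bsub>P j\<^esub>}" by blast
    moreover have "\<zero>\<^bsub>P' j\<^esub> = \<zero>\<^bsub>P j\<^esub>" by (simp add: P'_def)
    ultimately show "syzygy P' d e M j = {\<zero>\<^bsub>P' j\<^esub>}" by (simp only:)
  qed
  show "\<exists>k b l. dual_basis R (P' i) k b l" if "i \<le> j" for i
  proof (cases "i = j")
    case True
    obtain k b l where "dual_basis R (P j) k b l" using db[of j] by auto
    from dual_basis_retract[OF P0 K this r', of "\<lambda>x. x"]
    have "dual_basis R ?K k (\<lambda>i. r (b i)) l"
      using ri by (auto simp: mod_hom_def a_kernel_def')
    then show ?thesis using True by (auto simp: P'_def)
  qed (use that db in \<open>simp add: P'_def\<close>)
qed

section \<open>Maximal ideals\<close>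

lemma (in cring) idealI_cring:
  assumes "I \<subseteq> carrier R" "\<zero> \<in> I" "\<And>x y. x \<in> I \<Longrightarrow> y \<in> I \<Longrightarrow> x \<oplus> y \<in> I"
    and l: "\<And>a x. a \<in> carrier R \<Longrightarrow> x \<in> I \<Longrightarrow> a \<otimes> x \<in> I"
  shows "ideal I R"
proof (rule idealI)
  show "ring R" by (rule ring_axioms)
  have "\<ominus> x \<in> I" if "x \<in> I" for x
  proof -
    have "\<ominus> x = (\<ominus> \<one>) \<otimes> x" using assms(1) that by (auto simp: l_minus)
    then show ?thesis using l[of "\<ominus> \<one>" x] that by simp
  qed
  then show "subgroup I (add_monoid R)"
    using assms by (intro subgroup.intro) (auto simp: a_inv_def[symmetric])
  show "x \<otimes> a \<in> I" "a \<otimes> x \<in> I" if "a \<in> I" "x \<in> carrier R" for a x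
    using l[OF that(2,1)] m_comm[of a x] assms(1) that by auto
qed

lemma (in cring) ex_maximalideal:
  assumes I: "ideal I R" "I \<noteq> carrier R"
  shows "\<exists>m. maximalideal m R \<and> I \<subseteq> m"
proof -
  \<comment> \<open>Zorn's lemma is applied with properness in the form
    \<open>\<one> \<notin> J\<close>, which passes to unions of chains.\<close>
  let ?A = "{J. ideal J R \<and> I \<subseteq> J \<and> \<one> \<notin> J}"
  have "I \<in> ?A" using I ideal.one_imp_carrier by auto
  moreover have "\<Union>C \<in> ?A" if C: "C \<noteq> {}" "subset.chain ?A C" for C
  proof -
    have i: "ideal J R" "I \<subseteq> J" "\<one> \<notin> J" if "J \<in> C" for J
      using C that by (auto simp: subset.chain_def)
    have "ideal (\<Union>C) R"
    proof (rule idealI_cring)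
      show "\<Union>C \<subseteq> carrier R" using i(1) ideal.Icarr by fastforce
      show "\<zero> \<in> \<Union>C" using C(1) i(1) additive_subgroup.zero_closed ideal.axioms(1) by fastforce
      show "a \<otimes> x \<in> \<Union>C" if "a \<in> carrier R" "x \<in> \<Union>C" for a x
        using that i(1) ideal.I_l_closed by (metis UnionE UnionI)
      fix x y assume "x \<in> \<Union>C" "y \<in> \<Union>C"
      then obtain J K where JK: "J \<in> C" "K \<in> C" "x \<in> J" "y \<in> K" by blast
      moreover have "J \<subseteq> K \<or> K \<subseteq> J" using C(2) JK by (auto simp: subset.chain_def)
      ultimately have "\<exists>L\<in>C. x \<in> L \<and> y \<in> L" by blast
      then show "x \<oplus> y \<in> \<Union>C"
        using i(1) additive_subgroup.a_closed ideal.axioms(1) by (metis UnionI)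
    qed
    then show ?thesis using C(1) i by blast
  qed
  ultimately have "\<exists>m\<in>?A. \<forall>X\<in>?A. m \<subseteq> X \<longrightarrow> X = m"
    by (intro subset_Zorn_nonempty) auto
  then obtain m where m: "m \<in> ?A" "\<forall>X\<in>?A. m \<subseteq> X \<longrightarrow> X = m" by (rule bexE)
  have "maximalideal m R"
  proof (rule maximalidealI)
    show "ideal m R" "carrier R \<noteq> m" using m(1) by auto
    fix J assume J: "ideal J R" "m \<subseteq> J" "J \<subseteq> carrier R"
    show "J = m \<or> J = carrier R"
    proof (cases "\<one> \<in> J")
      case True
      then show ?thesis using ideal.one_imp_carrier[OF J(1)] by blast
    next
      case False
      then have "J \<in> ?A" using m(1) J by auto
      then show ?thesis using m(2) J(2) by blast
    qed
  qed
  then show ?thesis using m(1) by blast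
qed

section \<open>The local-global argument\<close>

text \<open>Kernels and images of localized maps consist of the fractions whose numerators lie in
  the original kernels and images, so each exactness condition carries over.\<close>

lemma (in mult_set) loc_resolution:
  assumes M: "Module.module R M" and res: "resolution R n P d e M"
  shows "resolution L n (\<lambda>i. LM (P i)) (\<lambda>i. loc_map R S (P i) (d i)) (loc_map R S M e) (LM M)"
proof -
  note Pm = resolution_module[OF M res] and dh = resolution_hom[OF M res] and eh = resolution_e_hom[OF M res]
  have syz: "syzygy (\<lambda>i. LM (P i)) (\<lambda>i. loc_map R S (P i) (d i)) (loc_map R S M e) (LM M) i
      = {mfrac (P i) x s | x s. x \<in> syzygy P d e M i \<and> s \<in> S}" if "i \<le> n" for i
  proof (cases i)
    case 0
    then show ?thesis using loc_map_kernel[OF Pm M eh] by (simp add: syzygy_def)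
  next
    case (Suc i')
    then show ?thesis using loc_map_kernel[OF Pm Pm dh, of i'] that by (simp add: syzygy_def)
  qed
  show ?thesis unfolding resolution_def
  proof (intro conjI allI impI)
    show "Module.module L (LM (P i))" if "i \<le> n" for i
      using mult_set_module.module_LM[OF mult_set_moduleI[OF Pm[OF that]]] .
    show "loc_map R S M e \<in> mod_hom L (LM (P 0)) (LM M)" by (rule loc_map_hom[OF Pm M eh]) simp
    show "loc_map R S (P i) (d i) \<in> mod_hom L (LM (P (Suc i))) (LM (P i))" if "i < n" for i
      using that by (intro loc_map_hom[OF Pm Pm dh]) auto
    show "loc_map R S M e ` carrier (LM (P 0)) = carrier (LM M)"
      using loc_map_image[OF Pm M eh] resolution_e_surj[OF M res] mult_set_module.LM_carrier[OF mult_set_moduleI[OF M]]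
      by simp
    show "loc_map R S (P i) (d i) ` carrier (LM (P (Suc i)))
        = syzygy (\<lambda>i. LM (P i)) (\<lambda>i. loc_map R S (P i) (d i)) (loc_map R S M e) (LM M) i" if "i < n" for i
      using loc_map_image[OF Pm Pm dh, of i] resolution_image[OF M res] that by (simp add: syz)
    have Pn: "Module.module R (P n)" using Pm by simp
    show "syzygy (\<lambda>i. LM (P i)) (\<lambda>i. loc_map R S (P i) (d i)) (loc_map R S M e) (LM M) n = {\<zero>\<^bsub>LM (P n)\<^esub>}"
      using mult_set_module.mfrac_zero[OF mult_set_moduleI[OF Pn]] S_one
      by (auto simp: syz resolution_last[OF M res])
  qed
qed

text \<open>The bound on \<open>fPD L\<close> forces the localized resolution to be longer than some
  projective resolution of the same module; its last map then splits over \<open>L\<close>, and the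
  splitting descends up to a factor in \<open>S\<close>.\<close>

lemma (in mult_set) local_splitting:
  fixes P :: "nat \<Rightarrow> ('a, 'p) module" and M :: "('a, 'm) module"
  assumes M: "Module.module R M" and res: "resolution R N P d e M"
    and db: "\<And>i. i \<le> N \<Longrightarrow> \<exists>k b l. dual_basis R (P i) k b l"
    and fPD: "fPD L \<le> enat n" and nN: "n < N"
  shows "\<exists>s\<in>S. \<exists>h\<in>mod_hom R (P (N - 1)) (P N). \<forall>x\<in>carrier (P N). h (d (N - 1) x) = s \<odot>\<^bsub>P N\<^esub> x"
proof -
  note Pm = resolution_module[OF M res] and dh = resolution_hom[OF M res]
  have LMm: "Module.module L (LM M)" using mult_set_module.module_LM[OF mult_set_moduleI[OF M]] .
  have LPm: "Module.module L (LM (P i))" if "i \<le> N" for i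
    using mult_set_module.module_LM[OF mult_set_moduleI[OF Pm[OF that]]] .
  note lres = loc_resolution[OF M res]
  have ldb: "\<exists>k b l. dual_basis L (LM (P i)) k b l" if "i \<le> N" for i
    using db[OF that] loc_dual_basis[OF Pm[OF that]] by blast
  obtain M' :: "(('a \<times> 'a) set, nat \<Rightarrow> ('a \<times> 'a) set) module" and j k
    where M': "FPR L M'" "mod_iso L (LM M) M' j k"
    using FPR_transport[OF LMm lres ldb] by blast
  have M'm: "Module.module L M'" using M'(1) by (simp add: FPR_def)
  have "pd L M' \<le> fPD L" unfolding fPD_def using M'(1) by (intro SUP_upper) simp
  then have "pd L M' \<le> enat n" using fPD by (rule order_trans)
  then obtain n' Q d' e' where Q: "n' \<le> n"
    "resolution L n' (Q :: nat \<Rightarrow> (('a \<times> 'a) set, (nat \<Rightarrow> ('a \<times> 'a) set) + nat \<Rightarrow> ('a \<times> 'a) set) module) d' e' M'"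
    "\<And>i. i \<le> n' \<Longrightarrow> projective L (Q i)" by (rule pd_le_imp_resolution) blast
  \<comment> \<open>The short resolution \<open>Q\<close> resolves the copy \<open>M'\<close>, so
    the localized resolution is redirected there before the two are compared.\<close>
  have res': "resolution L N (\<lambda>i. LM (P i)) (\<lambda>i. loc_map R S (P i) (d i)) (\<lambda>x. j (loc_map R S M e x)) M'"
    using resolution_transport[OF LMm lres M'm LPm M'(2) mod_iso_refl] .
  have pr: "projective L (LM (P i))" if "i \<le> N" for i
    using ldb[OF that] dual_basis_projective[OF LPm[OF that]] by blast
  obtain g where g: "g \<in> mod_hom L (LM (P (N - 1))) (LM (P N))"
    "\<And>X. X \<in> carrier (LM (P N)) \<Longrightarrow> g (loc_map R S (P (N - 1)) (d (N - 1)) X) = X"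
    using resolution_last_map_split[OF M'm res' pr Q(2,3) le_less_trans[OF Q(1) nN]] by blast
  obtain k1 b1 l1 k2 b2 l2 where "dual_basis R (P (N - 1)) k1 b1 l1" "dual_basis R (P N) k2 b2 l2"
    using db[of "N - 1"] db[of N] by auto
  moreover have "d (N - 1) \<in> mod_hom R (P N) (P (N - 1))" using dh[of "N - 1"] nN by simp
  ultimately show ?thesis
    using loc_retraction_descends[OF Pm _ Pm _ _ g] by auto
qed

lemma (in cring) mult_set_prime:
  assumes "primeideal p R" shows "mult_set R (carrier R - p)"
proof -
  interpret primeideal p R by fact
  show ?thesis
    by unfold_locales (use I_notcarr one_imp_carrier I_prime in auto)
qed

lemma (in cring) global_splitting:
  assumes P: "Module.module R P" and Q: "Module.module R Q" and f: "f \<in> mod_hom R Q P"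
    and loc: "\<And>m. maximalideal m R \<Longrightarrow>
      \<exists>s\<in>carrier R - m. \<exists>h\<in>mod_hom R P Q. \<forall>x\<in>carrier Q. h (f x) = s \<odot>\<^bsub>Q\<^esub> x"
  shows "\<exists>h\<in>mod_hom R P Q. \<forall>x\<in>carrier Q. h (f x) = x"
proof -
  interpret Q: Module.module R Q by fact
  let ?I = "{s \<in> carrier R. \<exists>h\<in>mod_hom R P Q. \<forall>x\<in>carrier Q. h (f x) = s \<odot>\<^bsub>Q\<^esub> x}"
  have "ideal ?I R"
  proof (rule idealI_cring)
    show "\<zero> \<in> ?I" using mod_hom_const_zero[OF Q] by (auto intro!: bexI[of _ "\<lambda>x. \<zero>\<^bsub>Q\<^esub>"])
    fix s t assume "s \<in> ?I" "t \<in> ?I"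
    then obtain g h where "s \<in> carrier R" "t \<in> carrier R" "g \<in> mod_hom R P Q" "h \<in> mod_hom R P Q"
      "\<And>x. x \<in> carrier Q \<Longrightarrow> g (f x) = s \<odot>\<^bsub>Q\<^esub> x" "\<And>x. x \<in> carrier Q \<Longrightarrow> h (f x) = t \<odot>\<^bsub>Q\<^esub> x" by blast
    then show "s \<oplus> t \<in> ?I"
      by (auto simp: Q.smult_l_distr intro!: bexI[OF _ mod_hom_pointwise_add[OF Q, of g P h]])
  next
    fix a s assume "a \<in> carrier R" "s \<in> ?I"
    then obtain h where "a \<in> carrier R" "s \<in> carrier R" "h \<in> mod_hom R P Q"
      "\<And>x. x \<in> carrier Q \<Longrightarrow> h (f x) = s \<odot>\<^bsub>Q\<^esub> x" by blast
    then show "a \<otimes> s \<in> ?I"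
      by (auto simp: Q.smult_assoc1 intro!: bexI[OF _ mod_hom_pointwise_smult[OF Q, of h P a]])
  qed auto
  moreover have "\<not> ?I \<subseteq> m" if "maximalideal m R" for m using loc[OF that] by blast
  \<comment> \<open>A proper \<open>?I\<close> would lie in some maximal ideal. This also covers the
    zero ring, where the local hypothesis is vacuous.\<close>
  ultimately have "?I = carrier R" using ex_maximalideal[of ?I] by blast
  then have "\<one> \<in> ?I" using one_closed by metis
  then show ?thesis by auto
qed

lemma (in cring) fPD_le_of_local:
  assumes loc: "\<And>m. maximalideal m R \<Longrightarrow> fPD (localization_at R m) \<le> enat n"
  shows "fPD R \<le> enat n"
  unfolding fPD_def
proof (rule SUP_least, simp)
  fix M :: "('a, nat \<Rightarrow> 'a) module" assume FPR: "FPR R M"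
  then have M: "Module.module R M" by (simp add: FPR_def)
  \<comment> \<open>Dual bases stand for finitely generated projective modules here.
    \<open>resolution_shorten\<close> stays within this class, so it can contradict the minimality
    of \<open>N\<close>.\<close>
  define good where "good N \<longleftrightarrow> (\<exists>(P :: nat \<Rightarrow> ('a, nat \<Rightarrow> 'a) module) d e. resolution R N P d e M \<and>
    (\<forall>i\<le>N. \<exists>k b l. dual_basis R (P i) k b l))" for N
  have "\<exists>N. good N"
  proof -
    obtain N and P :: "nat \<Rightarrow> ('a, nat \<Rightarrow> 'a) module" and d e where P: "resolution R N P d e M"
      "\<And>i. i \<le> N \<Longrightarrow> fin_gen R (P i) \<and> projective R (P i)" using FPR unfolding FPR_def by blast
    have "\<exists>k b l. dual_basis R (P i) k b l" if "i \<le> N" for i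
      using P(2)[OF that] fin_gen_projective_dual_basis[OF resolution_module[OF M P(1) that]] by blast
    with P(1) show ?thesis unfolding good_def by blast
  qed
  define N where "N = (LEAST N. good N)"
  have N: "good N" unfolding N_def by (rule LeastI_ex) fact
  then obtain P :: "nat \<Rightarrow> ('a, nat \<Rightarrow> 'a) module" and d e where res: "resolution R N P d e M"
    and db: "\<And>i. i \<le> N \<Longrightarrow> \<exists>k b l. dual_basis R (P i) k b l" unfolding good_def by blast
  note Pm = resolution_module[OF M res]
  have "N \<le> n"
  proof (rule ccontr)
    assume "\<not> N \<le> n"
    \<comment> \<open>\<open>N\<close> exceeds \<open>n\<close>, so it is positive and there is a
      last differential \<open>d j\<close> to split.\<close>
    then obtain j where j: "N = Suc j" "n < N" by (cases N) auto
    have "\<exists>h\<in>mod_hom R (P j) (P N). \<forall>x\<in>carrier (P N). h (d j x) = x"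
    proof (rule global_splitting)
      fix m assume m: "maximalideal m R"
      interpret ms: mult_set R "carrier R - m" by (rule mult_set_prime[OF maximalideal_prime[OF m]])
      show "\<exists>s\<in>carrier R - m. \<exists>h\<in>mod_hom R (P j) (P N). \<forall>x\<in>carrier (P N). h (d j x) = s \<odot>\<^bsub>P N\<^esub> x"
        using ms.local_splitting[OF M res db loc[OF m, unfolded localization_at_def] j(2)] j(1) by simp
    qed (use Pm j resolution_hom[OF M res] in auto)
    then obtain h where h: "h \<in> mod_hom R (P j) (P (Suc j))"
      "\<And>x. x \<in> carrier (P (Suc j)) \<Longrightarrow> h (d j x) = x" using j(1) by auto
    have "good j"
      using resolution_shorten[OF M res[unfolded j(1)] h db[unfolded j(1)]] unfolding good_def by blast
    then have "N \<le> j" unfolding N_def by (rule Least_le)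
    then show False using j by simp
  qed
  then show "pd R M \<le> enat n" using pd_le_resolution[OF M res db] by (meson enat_ord_simps(1) order_trans)
qed

theorem proposition3p6:
  fixes R :: "('a, 'c) ring_scheme"
  assumes "cring R"
  shows "fPD R \<le> (SUP m \<in> Max_ideals R. fPD (localization_at R m)) \<and>
         fPD R \<le> (SUP p \<in> Spec R. fPD (localization_at R p))"
proof -
  interpret cring R by fact
  let ?F = "\<lambda>p. fPD (localization_at R p)"
  have max: "fPD R \<le> (SUP m \<in> Max_ideals R. ?F m)"
  \<comment> \<open>An infinite supremum leaves nothing to prove. A finite one is a common bound
    \<open>n\<close> for all localizations; over the zero ring the supremum is empty and
    \<open>n\<close> is zero.\<close>
  proof (cases "SUP m \<in> Max_ideals R. ?F m")
    case (enat n)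
    have "?F m \<le> enat n" if "maximalideal m R" for m
      unfolding enat[symmetric] using that by (intro SUP_upper) (simp add: Max_ideals_def)
    then show ?thesis unfolding enat by (rule fPD_le_of_local)
  qed simp
  also have "\<dots> \<le> (SUP p \<in> Spec R. ?F p)"
    by (rule SUP_subset_mono) (auto simp: Max_ideals_def Spec_def maximalideal_prime)
  finally show ?thesis using max by blast
qed

end
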